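(* Let $\mathbf{K}$ be an abstract elementary class and let $\lambda\geq\operatorname{LS}(\mathbf{K})$. If $\mathbf{K}$ has amalgamation in $\lambda$, has no maximal model in $\lambda$, is stable in $\lambda$, and splitting is continuous in $\lambda$, then $\mathbf{K}$ has a model of cardinality $\lambda^{++}$.
   Context: $\mathbf{K}_\lambda$ denotes the models of $\mathbf{K}$ of cardinality $\lambda$; $\mathbf{S}(M)$ is the set of Galois (orbital) types over $M$, and $\mathbf{S}^{na}(M)$ the non-algebraic ones. $\mathbf{K}$ has amalgamation in $\lambda$ if any two $\leq_{\mathbf{K}}$-extensions in $\mathbf{K}_\lambda$ of a model in $\mathbf{K}_\lambda$ can be $\mathbf{K}$-embedded over it into a common model; no maximal model in $\lambda$ means every model in $\mathbf{K}_\lambda$ has a proper extension in $\mathbf{K}_\lambda$. $\mathbf{K}$ is stable in $\lambda$ if $|\mathbf{S}(M)|\leq\lambda$ for all $M\in\mathbf{K}_\lambda$. For $M\leq_{\mathbf{K}}N$ both of cardinality $\mu$, $N$ is universal over $M$ if every $N^*\in\mathbf{K}_\mu$ with $M\leq_{\mathbf{K}}N^*$ admits a $\mathbf{K}$-embedding $N^*\to N$ fixing $M$. For $M\in\mathbf{K}_\lambda$, $M\leq_{\mathbf{K}}N$ and $p\in\mathbf{S}(N)$, $p$ splits over $M$ if there are $N_1,N_2\in\mathbf{K}_\lambda$ with $M\leq_{\mathbf{K}}N_1,N_2\leq_{\mathbf{K}}N$ and an isomorphism $h:N_1\cong N_2$ fixing $M$ with $h(p\restriction N_1)\neq p\restriction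 N_2$. Splitting is continuous in $\lambda$ if for every limit ordinal $\delta<\lambda^+$ and every increasing continuous chain $\langle M_i : i\leq\delta\rangle$ in $\mathbf{K}_\lambda$ with $M_{i+1}$ universal over $M_i$ for all $i<\delta$, if $p\in\mathbf{S}^{na}(M_\delta)$ and $p\restriction M_i$ does not split over $M_0$ for all $i<\delta$, then $p$ does not split over $M_0$.
   Formalization: The formal theorem also assumes that K has a model of cardinality λ (for the empty class the claim fails), and takes K as a class of structures whose universes lie in a fixed arbitrary set of size at least λ⁺⁺, to which any AEC can be restricted by Löwenheim–Skolem. *)

theory Defs
  imports Main
begin

unbundle cardinal_syntax

text \<open>
  The type \<open>'a\<close> plays the role of the universe of sets: carriers of structures are sets of elements
  of \<open>'a\<close>, and a cardinal is a relation satisfying \<open>Card_order\<close>, compared by \<open>\<le>o\<close> and \<open>=o\<close>.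
\<close>

section \<open>Structures in a finitary vocabulary\<close>

record ('f, 'r) vocabulary =
  funs :: "'f set"
  rels :: "'r set"
  far :: "'f \<Rightarrow> nat"
  rar :: "'r \<Rightarrow> nat"

record ('a, 'f, 'r) struct =
  carrier :: "'a set"
  fint :: "'f \<Rightarrow> 'a list \<Rightarrow> 'a"
  rint :: "'r \<Rightarrow> 'a list set"

definition tuples :: "nat \<Rightarrow> 'a set \<Rightarrow> 'a list set" where
  "tuples n A = {xs. length xs = n \<and> set xs \<subseteq> A}"

text \<open>
  Interpretations are made canonical outside their proper domain, so that equality of records is
  equality of structures.
\<close>

definition is_struct :: "('f, 'r) vocabulary \<Rightarrow> ('a, 'f, 'r) struct \<Rightarrow> bool" where
  "is_struct L M \<longleftrightarrow>
     carrier M \<noteq> {} \<and>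
     (\<forall>f\<in>funs L. \<forall>xs\<in>tuples (far L f) (carrier M). fint M f xs \<in> carrier M) \<and>
     (\<forall>f xs. \<not> (f \<in> funs L \<and> xs \<in> tuples (far L f) (carrier M)) \<longrightarrow> fint M f xs = undefined) \<and>
     (\<forall>R\<in>rels L. rint M R \<subseteq> tuples (rar L R) (carrier M)) \<and>
     (\<forall>R. R \<notin> rels L \<longrightarrow> rint M R = {})"

definition substruct ::
    "('f, 'r) vocabulary \<Rightarrow> ('a, 'f, 'r) struct \<Rightarrow> ('a, 'f, 'r) struct \<Rightarrow> bool" where
  "substruct L M N \<longleftrightarrow>
     is_struct L M \<and> is_struct L N \<and> carrier M \<subseteq> carrier N \<and>
     (\<forall>f\<in>funs L. \<forall>xs\<in>tuples (far L f) (carrier M). fint M f xs = fint N f xs) \<and>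
     (\<forall>R\<in>rels L. rint M R = rint N R \<inter> tuples (rar L R) (carrier M))"

definition struct_iso ::
    "('f, 'r) vocabulary \<Rightarrow> ('a \<Rightarrow> 'a) \<Rightarrow> ('a, 'f, 'r) struct \<Rightarrow> ('a, 'f, 'r) struct \<Rightarrow> bool" where
  "struct_iso L h M N \<longleftrightarrow>
     is_struct L M \<and> is_struct L N \<and> bij_betw h (carrier M) (carrier N) \<and>
     (\<forall>f\<in>funs L. \<forall>xs\<in>tuples (far L f) (carrier M). h (fint M f xs) = fint N f (map h xs)) \<and>
     (\<forall>R\<in>rels L. \<forall>xs\<in>tuples (rar L R) (carrier M). xs \<in> rint M R \<longleftrightarrow> map h xs \<in> rint N R)"

text \<open>
  The union of a chain of structures. The choice of \<open>M\<close> is immaterial when \<open>S\<close> is a chain under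
  \<open>substruct\<close>, and every finite tuple of the union then lies in some member of \<open>S\<close>.
\<close>

definition union_struct :: "('a, 'f, 'r) struct set \<Rightarrow> ('a, 'f, 'r) struct" where
  "union_struct S =
     \<lparr> carrier = (\<Union>M\<in>S. carrier M),
       fint = (\<lambda>f xs. if \<exists>M\<in>S. set xs \<subseteq> carrier M
                      then fint (SOME M. M \<in> S \<and> set xs \<subseteq> carrier M) f xs else undefined),
       rint = (\<lambda>R. \<Union>M\<in>S. rint M R) \<rparr>"

section \<open>Abstract elementary classes\<close>

record ('a, 'f, 'r) aclass =
  voc :: "('f, 'r) vocabulary"
  models :: "('a, 'f, 'r) struct set"
  le :: "('a, 'f, 'r) struct \<Rightarrow> ('a, 'f, 'r) struct \<Rightarrow> bool"

abbreviation le_syntax ::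
    "('a, 'f, 'r) struct \<Rightarrow> ('a, 'f, 'r) aclass \<Rightarrow> ('a, 'f, 'r) struct \<Rightarrow> bool"
    ("(_/ \<preceq>\<^bsub>_\<^esub> _)" [51, 0, 51] 50) where
  "M \<preceq>\<^bsub>K\<^esub> N \<equiv> le K M N"

definition LS_bound :: "('a, 'f, 'r) aclass \<Rightarrow> 'k rel \<Rightarrow> bool" where
  "LS_bound K \<kappa> \<longleftrightarrow>
     Card_order \<kappa> \<and>
     |funs (voc K) <+> rels (voc K)| +c natLeq \<le>o \<kappa> \<and>
     (\<forall>M\<in>models K. \<forall>A. A \<subseteq> carrier M \<longrightarrow>
        (\<exists>N. N \<preceq>\<^bsub>K\<^esub> M \<and> A \<subseteq> carrier N \<and> |carrier N| \<le>o |A| +c \<kappa> ))"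

definition LS :: "('a, 'f, 'r) aclass \<Rightarrow> 'a rel" where
  "LS K = (SOME \<kappa>. LS_bound K \<kappa> \<and> (\<forall>\<kappa>' :: 'a rel. LS_bound K \<kappa>' \<longrightarrow> \<kappa> \<le>o \<kappa>'))"

text \<open>
  A limit ordinal is given by a well-order \<open>r\<close> that is nonempty and has no last element. In the
  chain axioms below, well-orders on \<open>'a\<close> suffice: a strictly increasing chain of structures has
  strictly increasing carriers, so its length injects into \<open>'a\<close>.
\<close>

definition limit_order :: "'i rel \<Rightarrow> bool" where
  "limit_order r \<longleftrightarrow>
     Well_order r \<and> Field r \<noteq> {} \<and> (\<forall>i\<in>Field r. \<exists>j\<in>Field r. i \<in> underS r j)"

definition AEC :: "('a, 'f, 'r) aclass \<Rightarrow> bool" where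
  "AEC K \<longleftrightarrow>
     (\<forall>M\<in>models K. is_struct (voc K) M) \<and>
     (\<forall>M N. M \<preceq>\<^bsub>K\<^esub> N \<longrightarrow> M \<in> models K \<and> N \<in> models K \<and> substruct (voc K) M N) \<and>
     (\<forall>M\<in>models K. M \<preceq>\<^bsub>K\<^esub> M) \<and>
     (\<forall>M N. M \<preceq>\<^bsub>K\<^esub> N \<and> N \<preceq>\<^bsub>K\<^esub> M \<longrightarrow> M = N) \<and>
     (\<forall>M N P. M \<preceq>\<^bsub>K\<^esub> N \<and> N \<preceq>\<^bsub>K\<^esub> P \<longrightarrow> M \<preceq>\<^bsub>K\<^esub> P) \<and>
     (\<forall>h M M'. M \<in> models K \<and> struct_iso (voc K) h M M' \<longrightarrow> M' \<in> models K) \<and>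
     (\<forall>h M N M' N'. M \<preceq>\<^bsub>K\<^esub> N \<and> struct_iso (voc K) h N N' \<and> struct_iso (voc K) h M M' \<longrightarrow> M' \<preceq>\<^bsub>K\<^esub> N') \<and>
     (\<forall>M0 M1 M2. M0 \<preceq>\<^bsub>K\<^esub> M2 \<and> M1 \<preceq>\<^bsub>K\<^esub> M2 \<and> substruct (voc K) M0 M1 \<longrightarrow> M0 \<preceq>\<^bsub>K\<^esub> M1) \<and>
     (\<forall>(r :: 'a rel) M. limit_order r \<and> (\<forall>i j. (i, j) \<in> r \<longrightarrow> M i \<preceq>\<^bsub>K\<^esub> M j) \<longrightarrow>
        union_struct (M ` Field r) \<in> models K \<and>
        (\<forall>i\<in>Field r. M i \<preceq>\<^bsub>K\<^esub> union_struct (M ` Field r)) \<and>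
        (\<forall>N\<in>models K. (\<forall>i\<in>Field r. M i \<preceq>\<^bsub>K\<^esub> N) \<longrightarrow> union_struct (M ` Field r) \<preceq>\<^bsub>K\<^esub> N)) \<and>
     (\<exists>\<kappa> :: 'a rel. LS_bound K \<kappa>)"

definition models_of_card :: "('a, 'f, 'r) aclass \<Rightarrow> 'c rel \<Rightarrow> ('a, 'f, 'r) struct set" where
  "models_of_card K \<mu> = {M \<in> models K. |carrier M| =o \<mu>}"

definition K_embedding ::
    "('a, 'f, 'r) aclass \<Rightarrow> ('a \<Rightarrow> 'a) \<Rightarrow> ('a, 'f, 'r) struct \<Rightarrow> ('a, 'f, 'r) struct \<Rightarrow> bool" where
  "K_embedding K f M N \<longleftrightarrow> (\<exists>M'. struct_iso (voc K) f M M' \<and> M' \<preceq>\<^bsub>K\<^esub> N)"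

definition fixes_pointwise :: "('a \<Rightarrow> 'a) \<Rightarrow> ('a, 'f, 'r) struct \<Rightarrow> bool" where
  "fixes_pointwise f M \<longleftrightarrow> (\<forall>x\<in>carrier M. f x = x)"

definition amalgamation_in :: "('a, 'f, 'r) aclass \<Rightarrow> 'c rel \<Rightarrow> bool" where
  "amalgamation_in K \<mu> \<longleftrightarrow>
     (\<forall>M0\<in>models_of_card K \<mu>. \<forall>M1\<in>models_of_card K \<mu>. \<forall>M2\<in>models_of_card K \<mu>.
        M0 \<preceq>\<^bsub>K\<^esub> M1 \<and> M0 \<preceq>\<^bsub>K\<^esub> M2 \<longrightarrow>
        (\<exists>N\<in>models K. \<exists>f1 f2. K_embedding K f1 M1 N \<and> K_embedding K f2 M2 N \<and>
           fixes_pointwise f1 M0 \<and> fixes_pointwise f2 M0))"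

definition no_maximal_model_in :: "('a, 'f, 'r) aclass \<Rightarrow> 'c rel \<Rightarrow> bool" where
  "no_maximal_model_in K \<mu> \<longleftrightarrow>
     (\<forall>M\<in>models_of_card K \<mu>. \<exists>N\<in>models_of_card K \<mu>. M \<preceq>\<^bsub>K\<^esub> N \<and> M \<noteq> N)"

definition universal_over ::
    "('a, 'f, 'r) aclass \<Rightarrow> ('a, 'f, 'r) struct \<Rightarrow> ('a, 'f, 'r) struct \<Rightarrow> bool" where
  "universal_over K N M \<longleftrightarrow>
     M \<preceq>\<^bsub>K\<^esub> N \<and> |carrier N| =o |carrier M| \<and>
     (\<forall>N'\<in>models_of_card K |carrier M|. M \<preceq>\<^bsub>K\<^esub> N' \<longrightarrow>
        (\<exists>f. K_embedding K f N' N \<and> fixes_pointwise f M))"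

section \<open>Galois types\<close>

type_synonym ('a, 'f, 'r) triple = "'a \<times> ('a, 'f, 'r) struct \<times> ('a, 'f, 'r) struct"

definition triples :: "('a, 'f, 'r) aclass \<Rightarrow> ('a, 'f, 'r) triple set" where
  "triples K = {(a, M, N). M \<preceq>\<^bsub>K\<^esub> N \<and> a \<in> carrier N}"

definition E_at :: "('a, 'f, 'r) aclass \<Rightarrow> ('a, 'f, 'r) triple rel" where
  "E_at K = {((a1, M1, N1), (a2, M2, N2)).
     (a1, M1, N1) \<in> triples K \<and> (a2, M2, N2) \<in> triples K \<and> M1 = M2 \<and>
     (\<exists>N\<in>models K. \<exists>f1 f2. K_embedding K f1 N1 N \<and> K_embedding K f2 N2 N \<and>
        fixes_pointwise f1 M1 \<and> fixes_pointwise f2 M1 \<and> f1 a1 = f2 a2)}"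

text \<open>
  \<open>E_at K\<close> is reflexive and symmetric on \<open>triples K\<close>, so its transitive closure is an equivalence
  relation there.
\<close>

definition gtp :: "('a, 'f, 'r) aclass \<Rightarrow> 'a \<Rightarrow> ('a, 'f, 'r) struct \<Rightarrow> ('a, 'f, 'r) struct \<Rightarrow>
    ('a, 'f, 'r) triple set" where
  "gtp K a M N = (E_at K)\<^sup>+ `` {(a, M, N)}"

definition gS :: "('a, 'f, 'r) aclass \<Rightarrow> ('a, 'f, 'r) struct \<Rightarrow> ('a, 'f, 'r) triple set set" where
  "gS K M = {gtp K a M N | a N. M \<preceq>\<^bsub>K\<^esub> N \<and> a \<in> carrier N}"

definition gS_na :: "('a, 'f, 'r) aclass \<Rightarrow> ('a, 'f, 'r) struct \<Rightarrow> ('a, 'f, 'r) triple set set" where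
  "gS_na K M = {gtp K a M N | a N. M \<preceq>\<^bsub>K\<^esub> N \<and> a \<in> carrier N - carrier M}"

definition stable_in :: "('a, 'f, 'r) aclass \<Rightarrow> 'c rel \<Rightarrow> bool" where
  "stable_in K \<mu> \<longleftrightarrow> (\<forall>M\<in>models_of_card K \<mu>. |gS K M| \<le>o \<mu>)"

definition restrict_type :: "('a, 'f, 'r) aclass \<Rightarrow> ('a, 'f, 'r) triple set \<Rightarrow>
    ('a, 'f, 'r) struct \<Rightarrow> ('a, 'f, 'r) triple set" where
  "restrict_type K p M0 = (THE q. \<exists>a M N. (a, M, N) \<in> p \<and> q = gtp K a M0 N)"

text \<open>
  \<open>h(gtp(a/N\<^sub>1; N)) = gtp(h'(a)/N\<^sub>2; N')\<close>, where \<open>h : N\<^sub>1 \<cong> N\<^sub>2\<close> and \<open>h' : N \<cong> N'\<close> extends \<open>h\<close>.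
\<close>

definition map_type :: "('a, 'f, 'r) aclass \<Rightarrow> ('a \<Rightarrow> 'a) \<Rightarrow> ('a, 'f, 'r) struct \<Rightarrow>
    ('a, 'f, 'r) struct \<Rightarrow> ('a, 'f, 'r) triple set \<Rightarrow> ('a, 'f, 'r) triple set" where
  "map_type K h N1 N2 p =
     (THE q. \<exists>a N N' h'. (a, N1, N) \<in> p \<and> struct_iso (voc K) h' N N' \<and>
        (\<forall>x\<in>carrier N1. h' x = h x) \<and> q = gtp K (h' a) N2 N')"

section \<open>Splitting\<close>

text \<open>To be used for \<open>M\<close> in \<open>models_of_card K \<mu>\<close>, \<open>M \<preceq>\<^bsub>K\<^esub> N\<close> and \<open>p\<close> in \<open>gS K N\<close>.\<close>

definition splits_over :: "('a, 'f, 'r) aclass \<Rightarrow> 'c rel \<Rightarrow> ('a, 'f, 'r) triple set \<Rightarrow>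
    ('a, 'f, 'r) struct \<Rightarrow> ('a, 'f, 'r) struct \<Rightarrow> bool" where
  "splits_over K \<mu> p N M \<longleftrightarrow>
     (\<exists>N1\<in>models_of_card K \<mu>. \<exists>N2\<in>models_of_card K \<mu>. \<exists>h.
        M \<preceq>\<^bsub>K\<^esub> N1 \<and> N1 \<preceq>\<^bsub>K\<^esub> N \<and> M \<preceq>\<^bsub>K\<^esub> N2 \<and> N2 \<preceq>\<^bsub>K\<^esub> N \<and>
        struct_iso (voc K) h N1 N2 \<and> fixes_pointwise h M \<and>
        map_type K h N1 N2 (restrict_type K p N1) \<noteq> restrict_type K p N2)"

text \<open>
  Ordinals below a cardinal \<open>r\<close> are identified with the elements of \<open>Field r\<close>. In particular the
  ordinals \<open>\<delta> < \<mu>\<^sup>+\<close> are the elements of \<open>Field (cardSuc \<mu>)\<close>, and a sequence indexed by \<open>i \<le> \<delta>\<close>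
  is a function restricted to \<open>under (cardSuc \<mu>) \<delta>\<close>.
\<close>

definition limit_elem :: "'i rel \<Rightarrow> 'i \<Rightarrow> bool" where
  "limit_elem r d \<longleftrightarrow>
     d \<in> Field r \<and> underS r d \<noteq> {} \<and> (\<forall>i\<in>underS r d. \<exists>j\<in>underS r d. i \<in> underS r j)"

definition cont_chain ::
    "('a, 'f, 'r) aclass \<Rightarrow> 'c rel \<Rightarrow> 'i rel \<Rightarrow> 'i \<Rightarrow> ('i \<Rightarrow> ('a, 'f, 'r) struct) \<Rightarrow> bool" where
  "cont_chain K \<mu> r d M \<longleftrightarrow>
     (\<forall>i\<in>under r d. M i \<in> models_of_card K \<mu>) \<and>
     (\<forall>j\<in>under r d. \<forall>i\<in>under r j. M i \<preceq>\<^bsub>K\<^esub> M j) \<and>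
     (\<forall>j\<in>under r d. limit_elem r j \<longrightarrow> M j = union_struct (M ` underS r j))"

definition splitting_continuous_in :: "('a, 'f, 'r) aclass \<Rightarrow> 'c rel \<Rightarrow> bool" where
  "splitting_continuous_in K \<mu> \<longleftrightarrow>
     (let r = cardSuc \<mu>; z = wo_rel.minim r (Field r) in
      \<forall>d M p. limit_elem r d \<and> cont_chain K \<mu> r d M \<and>
        (\<forall>i\<in>underS r d. universal_over K (M (wo_rel.suc r {i})) (M i)) \<and>
        p \<in> gS_na K (M d) \<and>
        (\<forall>i\<in>underS r d. \<not> splits_over K \<mu> (restrict_type K p (M i)) (M i) (M z)) \<longrightarrow>
        \<not> splits_over K \<mu> p (M d) (M z))"

end

theory Submission
  imports Defs
begin

text \<open>
  It suffices to show that no model of cardinality \<open>\<lambda>\<^sup>+\<close> is maximal. Suppose \<open>B\<close> were. Amalgamation in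
  \<open>\<lambda>\<close>, applied along a filtration, amalgamates \<open>B\<close> with any extension of a submodel of cardinality
  \<open>\<lambda>\<close>, and maximality then forces the amalgam to be \<open>B\<close>. So \<open>B\<close> is its own monster model: embeddings of
  submodels of cardinality \<open>\<lambda>\<close> extend to automorphisms, types over such submodels are orbits, and by
  stability \<open>B\<close> is the union of a continuous chain \<open>(M\<^sub>i)\<close>, \<open>i < \<lambda>\<^sup>+\<close>, with \<open>M\<^sub>i\<^sub>+\<^sub>1\<close> universal over \<open>M\<^sub>i\<close>.
  Stability also provides an element outside \<open>M\<^sub>1\<close> whose type over \<open>M\<^sub>1\<close> does not split over \<open>M\<^sub>0\<close>, for
  a suitable \<open>M\<^sub>0\<close>.
  Non-splitting types extend from \<open>M\<^sub>i\<close> to \<open>M\<^sub>i\<^sub>+\<^sub>1\<close>, because \<open>M\<^sub>i\<^sub>+\<^sub>1\<close> embeds into \<open>M\<^sub>i\<close> over \<open>M\<^sub>0\<close>, and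
  continuity of splitting passes through limits. Hence there is an embedding of \<open>B\<close> into \<open>B\<close>, built
  along the chain, that omits a fixed element \<open>b\<close> because the type of \<open>b\<close> over the image of each \<open>M\<^sub>i\<close>
  corresponds to a non-algebraic non-splitting type. Its image is a maximal model with a proper extension.
\<close>

section \<open>Well-orders of limit type\<close>

text \<open>Amalgamation is assumed at \<lambda> only, so models of size
  \<open>\<lambda>\<^sup>+\<close> are reached through chains of \<lambda>-sized submodels. For a
  maximal \<open>B\<close> this costs nothing: every embedding of \<open>B\<close> is onto, so where
  a back-and-forth would be expected the forth direction is enough. While the embedding
  \<open>f\<close> of \<open>B\<close> that omits \<open>b\<close> is built, stage \<open>i\<close>
  carries an automorphism \<open>\<tau>\<close> agreeing with \<open>f\<close> on \<open>M i\<close>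
  and a point \<open>c\<close> outside \<open>M i\<close> with \<open>\<tau> c = b\<close>; hence
  \<open>b\<close> is not in the image of \<open>M i\<close>. Non-algebraicity of the type of
  \<open>c\<close> alone could not be propagated. Non-splitting over the fixed bottom model can be,
  since it allows the type to be pulled back along an embedding of the next model into the present
  one. The obstacle is the limit stage: the automorphisms of earlier stages agree only on the models
  of those stages and have no limit. A fresh automorphism extending \<open>f\<close> is chosen
  there, and the preimage of \<open>b\<close> under it has over each earlier model the type already
  found. Continuity of splitting is exactly what turns this into non-splitting over the limit
  model.\<close>

locale index_order =
  fixes r :: "'i rel"
  assumes limit: "limit_order r"
begin

sublocale wo_rel r
  using limit by unfold_locales (simp add: limit_order_def)

abbreviation z :: 'i where "z \<equiv> minim (Field r)"
abbreviation sc :: "'i \<Rightarrow> 'i" where "sc i \<equiv> suc {i}"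

lemma z_in: "z \<in> Field r" and z_least: "i \<in> Field r \<Longrightarrow> (z, i) \<in> r"
  using limit minim_in minim_least by (auto simp: limit_order_def)

lemma AboveS_singleton: "i \<in> Field r \<Longrightarrow> AboveS {i} \<noteq> {}"
  using limit unfolding limit_order_def AboveS_def underS_def by blast

lemma sc_in: "i \<in> Field r \<Longrightarrow> sc i \<in> Field r"
  and sc_greater: "i \<in> Field r \<Longrightarrow> i \<in> underS (sc i)"
  using suc_inField[of "{i}"] suc_greater[of "{i}" i] AboveS_singleton[of i] by (auto simp: underS_def)

lemma le_in: "(i, j) \<in> r \<Longrightarrow> i \<in> Field r" "(i, j) \<in> r \<Longrightarrow> j \<in> Field r"
  by (auto simp: Field_def)

lemma less_in: "i \<in> underS j \<Longrightarrow> i \<in> Field r" "i \<in> underS j \<Longrightarrow> j \<in> Field r"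
  by (auto simp: Field_def underS_def)

lemma r_refl: "i \<in> Field r \<Longrightarrow> (i, i) \<in> r"
  using REFL by (auto simp: refl_on_def)

lemma r_trans: "(i, j) \<in> r \<Longrightarrow> (j, k) \<in> r \<Longrightarrow> (i, k) \<in> r"
  using TRANS by (auto simp: trans_def)

lemma less_le: "i \<in> underS j \<Longrightarrow> (i, j) \<in> r"
  by (auto simp: underS_def)

lemma r_antisym: "(i, j) \<in> r \<Longrightarrow> (j, i) \<in> r \<Longrightarrow> i = j"
  using ANTISYM by (auto simp: antisym_def)

lemma less_le_trans: "i \<in> underS j \<Longrightarrow> (j, k) \<in> r \<Longrightarrow> i \<in> underS k"
  unfolding underS_def using r_trans r_antisym by blast

lemma le_less_trans: "(i, j) \<in> r \<Longrightarrow> j \<in> underS k \<Longrightarrow> i \<in> underS k"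
  unfolding underS_def using r_trans r_antisym by blast

lemma le_cases: "(i, j) \<in> r \<Longrightarrow> i = j \<or> i \<in> underS j"
  by (auto simp: underS_def)

lemma le_iff_not_less: "i \<in> Field r \<Longrightarrow> j \<in> Field r \<Longrightarrow> (i, j) \<in> r \<longleftrightarrow> j \<notin> underS i"
  using r_antisym r_refl TOTALS by (auto simp: underS_def)

lemma sc_le: "i \<in> underS j \<Longrightarrow> (sc i, j) \<in> r"
  using suc_least_AboveS[of j "{i}"] by (auto simp: AboveS_def underS_def Field_def)

lemma less_sc: "i \<in> Field r \<Longrightarrow> j \<in> underS (sc i) \<longleftrightarrow> (j, i) \<in> r"
  by (metis le_iff_not_less le_less_trans less_in(1) le_in(1) sc_greater sc_in sc_le)

lemma sc_inj: "i \<in> Field r \<Longrightarrow> j \<in> Field r \<Longrightarrow> sc i = sc j \<Longrightarrow> i = j"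
  by (metis r_antisym less_sc sc_greater)

lemma limit_elem_sc: "limit_elem r d \<Longrightarrow> i \<in> underS d \<Longrightarrow> sc i \<in> underS d"
  unfolding limit_elem_def using sc_le le_less_trans by blast

lemma z_not_limit: "\<not> limit_elem r z" and sc_not_limit: "i \<in> Field r \<Longrightarrow> \<not> limit_elem r (sc i)"
  and sc_not_z: "i \<in> Field r \<Longrightarrow> sc i \<noteq> z"
  subgoal unfolding limit_elem_def using z_least le_iff_not_less[OF z_in] less_in(1) by blast
  subgoal using limit_elem_sc[of "sc i" i] sc_greater by (auto simp: underS_def)
  subgoal using sc_greater[of i] z_least[of i] le_iff_not_less[OF z_in, of i] by metis
  done

lemma z_sc_limit_cases:
  assumes "i \<in> Field r"
  obtains (z) "i = z" | (sc) j where "j \<in> Field r" "i = sc j" | (limit) "limit_elem r i"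
proof (cases "i = z \<or> limit_elem r i")
  case False
  then have "underS i \<noteq> {}"
    using z_least[OF assms] by (auto simp: underS_def)
  with False assms obtain j where j: "j \<in> underS i" "\<forall>k\<in>underS i. j \<notin> underS k"
    unfolding limit_elem_def by blast
  then have "(sc j, i) \<in> r" "sc j \<notin> underS i"
    using sc_le sc_greater less_in by blast+
  then show ?thesis
    using that(2)[of j] j less_in le_cases by blast
qed (use that in auto)

lemma less_induct [consumes 1, case_names less]:
  assumes "i \<in> Field r" and "\<And>i. i \<in> Field r \<Longrightarrow> (\<And>j. j \<in> underS i \<Longrightarrow> P j) \<Longrightarrow> P i"
  shows "P i"
proof -
  have "i \<in> Field r \<longrightarrow> P i"
    using WF
  proof (induction i rule: wf_induct_rule)
    case (less i)
    then show ?case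
      using assms(2) less_in by (auto simp: underS_def)
  qed
  with assms(1) show ?thesis by simp
qed

text \<open>
  The relation \<open>R\<close> is indexed so that a state at stage \<open>i\<close> may be compared with a later one only as
  far as stage \<open>i\<close> determines it.
\<close>

lemma transfinite_chain:
  fixes s0 :: 's and Lim :: "'i \<Rightarrow> ('i \<Rightarrow> 's) \<Rightarrow> 's"
  assumes base: "P z s0"
    and refl: "\<And>i s. R i s s"
    and trans: "\<And>i j s t u. (i, j) \<in> r \<Longrightarrow> R i s t \<Longrightarrow> R j t u \<Longrightarrow> R i s u"
    and step: "\<And>i s. i \<in> Field r \<Longrightarrow> P i s \<Longrightarrow> \<exists>s'. R i s s' \<and> P (sc i) s' \<and> St i s s'"
    and Lim_cong: "\<And>d g g'. (\<And>i. i \<in> underS d \<Longrightarrow> g i = g' i) \<Longrightarrow> Lim d g = Lim d g'"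
    and Lim: "\<And>d g. limit_elem r d \<Longrightarrow> (\<And>i. i \<in> underS d \<Longrightarrow> P i (g i)) \<Longrightarrow>
      (\<And>i j. (i, j) \<in> r \<Longrightarrow> j \<in> underS d \<Longrightarrow> R i (g i) (g j)) \<Longrightarrow>
      (\<And>i. i \<in> underS d \<Longrightarrow> St i (g i) (g (sc i))) \<Longrightarrow>
      (\<And>i. i \<in> underS d \<Longrightarrow> limit_elem r i \<Longrightarrow> g i = Lim i g) \<Longrightarrow>
      P d (Lim d g) \<and> (\<forall>i\<in>underS d. R i (g i) (Lim d g))"
  obtains g where "g z = s0" "\<And>i. i \<in> Field r \<Longrightarrow> P i (g i)"
    "\<And>i j. (i, j) \<in> r \<Longrightarrow> R i (g i) (g j)"
    "\<And>i. i \<in> Field r \<Longrightarrow> St i (g i) (g (sc i))"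
    "\<And>d. limit_elem r d \<Longrightarrow> g d = Lim d g"
proof -
  \<comment> \<open>The successor clause is demanded only when \<open>P\<close> holds at the
    predecessor, so some state satisfies \<open>T\<close> whatever came before and well-founded
    dependent choice applies. That \<open>P\<close> never fails is shown afterwards, in
    \<open>main\<close>.\<close>
  define T where "T g i s \<longleftrightarrow> (i = z \<longrightarrow> s = s0) \<and>
    (\<forall>j. j \<in> Field r \<and> i = sc j \<and> P j (g j) \<longrightarrow> R j (g j) s \<and> P i s \<and> St j (g j) s) \<and>
    (limit_elem r i \<longrightarrow> s = Lim i g)" for g i s
  have "\<exists>g. \<forall>i. T g i (g i)"
  proof (rule dependent_wf_choice[OF WF])
    fix f g :: "'i \<Rightarrow> 's" and i s
    assume "\<And>j. (j, i) \<in> r - Id \<Longrightarrow> f j = g j"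
    then have eq: "j \<in> underS i \<Longrightarrow> f j = g j" for j by (auto simp: underS_def)
    have "j \<in> Field r \<Longrightarrow> i = sc j \<Longrightarrow> f j = g j" for j
      using eq sc_greater by blast
    with Lim_cong[of i f g] eq show "T f i s = T g i s"
      unfolding T_def by (smt (verit))
  next
    fix i g
    show "\<exists>s. T g i s"
    proof (cases "i \<in> Field r")
      case True
      then show ?thesis
      proof (cases rule: z_sc_limit_cases)
        case z
        then show ?thesis unfolding T_def using z_not_limit sc_not_z by metis
      next
        case (sc j)
        then show ?thesis unfolding T_def using sc_not_limit sc_not_z sc_inj step[of j "g j"] by metis
      next
        case limit
        then show ?thesis unfolding T_def using z_not_limit sc_not_limit by metis
      qed
    qed (auto simp: T_def limit_elem_def z_in sc_in)
  qed
  then obtain g where "\<And>i. T g i (g i)" by blast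
  then have gz: "g z = s0"
    and gs: "\<And>j. j \<in> Field r \<Longrightarrow> P j (g j) \<Longrightarrow> R j (g j) (g (sc j)) \<and> P (sc j) (g (sc j)) \<and> St j (g j) (g (sc j))"
    and gl: "\<And>d. limit_elem r d \<Longrightarrow> g d = Lim d g"
    unfolding T_def by blast+
  have main: "P i (g i) \<and> (\<forall>j\<in>underS i. R j (g j) (g i))" if "i \<in> Field r" for i
    using that
  proof (induction i rule: less_induct)
    case (less i)
    from less.hyps show ?case
    proof (cases rule: z_sc_limit_cases)
      case z
      then show ?thesis using gz base z_least le_iff_not_less less_in by blast
    next
      case (sc j)
      then have "P j (g j) \<and> (\<forall>k\<in>underS j. R k (g k) (g j))"
        using less.IH sc_greater by blast
      with gs[of j] sc show ?thesis
        using less_sc[of j] le_cases trans less_le by (metis refl)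
    next
      case limit
      have "P i (Lim i g) \<and> (\<forall>j\<in>underS i. R j (g j) (Lim i g))"
      proof (rule Lim[OF limit])
        show "\<And>j. j \<in> underS i \<Longrightarrow> P j (g j)" using less.IH by blast
        show "\<And>j k. (j, k) \<in> r \<Longrightarrow> k \<in> underS i \<Longrightarrow> R j (g j) (g k)"
          using less.IH le_cases refl by metis
        show "\<And>j. j \<in> underS i \<Longrightarrow> St j (g j) (g (sc j))" using less.IH gs less_in by blast
      qed (use gl in auto)
      with gl[OF limit] show ?thesis by simp
    qed
  qed
  show ?thesis
  proof (rule that[of g])
    show "R i (g i) (g j)" if "(i, j) \<in> r" for i j
      using le_cases[OF that] main[of j] le_in[OF that] refl by auto
  qed (use main gz gs gl in auto)
qed

end

section \<open>Images of structures\<close>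

text \<open>The copy of \<open>M\<close> along \<open>h\<close>, meant for \<open>h\<close>
  injective on the carrier. The value \<open>undefined\<close> elsewhere meets the canonical form
  demanded by \<open>is_struct\<close>, which is what makes such a copy unique.\<close>

definition image_struct ::
    "('f, 'r) vocabulary \<Rightarrow> ('a \<Rightarrow> 'a) \<Rightarrow> ('a, 'f, 'r) struct \<Rightarrow> ('a, 'f, 'r) struct" where
  "image_struct L h M =
     \<lparr> carrier = h ` carrier M,
       fint = (\<lambda>f xs. if f \<in> funs L \<and> xs \<in> tuples (far L f) (h ` carrier M)
                      then h (fint M f (map (inv_into (carrier M) h) xs)) else undefined),
       rint = (\<lambda>R. map h ` rint M R) \<rparr>"

lemma carrier_image_struct [simp]: "carrier (image_struct L h M) = h ` carrier M"
  by (simp add: image_struct_def)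

lemma map_in_tuples: "xs \<in> tuples n A \<Longrightarrow> h ` A \<subseteq> B \<Longrightarrow> map h xs \<in> tuples n B"
  by (auto simp: tuples_def)

lemma map_inv_into_in_tuples: "xs \<in> tuples n (h ` A) \<Longrightarrow> map (inv_into A h) xs \<in> tuples n A"
  by (auto simp: tuples_def intro: inv_into_into)

lemma map_inv_into_map: "inj_on h A \<Longrightarrow> xs \<in> tuples n A \<Longrightarrow> map (inv_into A h) (map h xs) = xs"
  by (auto simp: tuples_def intro!: map_idI)

lemma map_map_inv_into: "xs \<in> tuples n (h ` A) \<Longrightarrow> map h (map (inv_into A h) xs) = xs"
  by (auto simp: tuples_def f_inv_into_f subset_iff intro!: map_idI)

lemma map_inj_on_tuples:
  "inj_on h A \<Longrightarrow> xs \<in> tuples n A \<Longrightarrow> ys \<in> tuples m A \<Longrightarrow> map h xs = map h ys \<Longrightarrow> xs = ys"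
  unfolding tuples_def by (auto intro: map_inj_on inj_on_subset)

lemma struct_iso_image_struct:
  assumes M: "is_struct L M" and h: "inj_on h (carrier M)"
  shows "struct_iso L h M (image_struct L h M)"
  unfolding struct_iso_def
proof (intro conjI ballI)
  show "is_struct L M" by fact
  show "is_struct L (image_struct L h M)"
    unfolding is_struct_def image_struct_def struct.simps
  proof (intro conjI ballI allI impI)
    show "h ` carrier M \<noteq> {}" using M by (simp add: is_struct_def)
  next
    fix f xs assume "f \<in> funs L" "xs \<in> tuples (far L f) (h ` carrier M)"
    then show "(if f \<in> funs L \<and> xs \<in> tuples (far L f) (h ` carrier M)
        then h (fint M f (map (inv_into (carrier M) h) xs)) else undefined) \<in> h ` carrier M"
      using M map_inv_into_in_tuples[of xs _ h "carrier M"] by (auto simp: is_struct_def)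
  next
    fix f xs assume "\<not> (f \<in> funs L \<and> xs \<in> tuples (far L f) (h ` carrier M))"
    then show "(if f \<in> funs L \<and> xs \<in> tuples (far L f) (h ` carrier M)
        then h (fint M f (map (inv_into (carrier M) h) xs)) else undefined) = undefined"
      by (rule if_not_P)
  next
    fix R assume "R \<in> rels L"
    then have "rint M R \<subseteq> tuples (rar L R) (carrier M)" using M by (simp add: is_struct_def)
    then show "map h ` rint M R \<subseteq> tuples (rar L R) (h ` carrier M)"
      using map_in_tuples[of _ _ "carrier M" h] by blast
  next
    fix R assume "R \<notin> rels L"
    then show "map h ` rint M R = {}" using M by (simp add: is_struct_def)
  qed
  show "bij_betw h (carrier M) (carrier (image_struct L h M))"
    using h by (simp add: bij_betw_def)
next
  fix f xs assume f: "f \<in> funs L" and xs: "xs \<in> tuples (far L f) (carrier M)"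
  then show "h (fint M f xs) = fint (image_struct L h M) f (map h xs)"
    using map_in_tuples[OF xs subset_refl, of h] map_inv_into_map[OF h xs] by (simp add: image_struct_def)
next
  fix R xs assume R: "R \<in> rels L" and xs: "xs \<in> tuples (rar L R) (carrier M)"
  have "rint M R \<subseteq> tuples (rar L R) (carrier M)" using M R by (simp add: is_struct_def)
  then show "xs \<in> rint M R \<longleftrightarrow> map h xs \<in> rint (image_struct L h M) R"
    using map_inj_on_tuples[OF h _ xs] by (auto simp: image_struct_def)
qed

lemma struct_isoD:
  assumes "struct_iso L h M N"
  shows "is_struct L M" "is_struct L N" "inj_on h (carrier M)" "carrier N = h ` carrier M"
    "bij_betw h (carrier M) (carrier N)"
  using assms by (auto simp: struct_iso_def bij_betw_def)

lemma struct_eqI: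
  assumes M: "is_struct L M" and N: "is_struct L N" and C: "carrier M = carrier N"
    and f: "\<And>f xs. f \<in> funs L \<Longrightarrow> xs \<in> tuples (far L f) (carrier M) \<Longrightarrow> fint M f xs = fint N f xs"
    and R: "\<And>R xs. R \<in> rels L \<Longrightarrow> xs \<in> tuples (rar L R) (carrier M) \<Longrightarrow> xs \<in> rint M R \<longleftrightarrow> xs \<in> rint N R"
  shows "M = (N :: ('a, 'f, 'r) struct)"
proof (rule struct.equality)
  show "fint M = fint N"
  proof (intro ext)
    fix g xs show "fint M g xs = fint N g xs"
    proof (cases "g \<in> funs L \<and> xs \<in> tuples (far L g) (carrier M)")
      case False
      then have "fint M g xs = undefined" "fint N g xs = undefined"
        using M N C by (simp_all add: is_struct_def)
      then show ?thesis by simp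
    qed (use f in auto)
  qed
  show "rint M = rint N"
  proof (intro ext)
    fix S show "rint M S = rint N S"
    proof (cases "S \<in> rels L")
      case True
      then have "rint M S \<subseteq> tuples (rar L S) (carrier M)" "rint N S \<subseteq> tuples (rar L S) (carrier M)"
        using M N C by (simp_all add: is_struct_def)
      with R[OF True] show ?thesis by blast
    qed (use M N in \<open>simp add: is_struct_def\<close>)
  qed
qed (use C in auto)

lemma substruct_eqI: "substruct L M N \<Longrightarrow> carrier M = carrier N \<Longrightarrow> M = N"
  by (rule struct_eqI[of L]) (auto simp: substruct_def)

text \<open>Every tuple of the target is \<open>map h\<close> of a tuple of \<open>M\<close>, so the
  values of \<open>h\<close> on the carrier determine the whole target. Any isomorphic copy can thus
  be identified with \<open>image_struct\<close>.\<close>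

lemma struct_iso_unique_image:
  assumes "struct_iso L h M N" "struct_iso L h' M N'" "\<And>x. x \<in> carrier M \<Longrightarrow> h x = h' x"
  shows "N = N'"
proof (rule struct_eqI[of L])
  have map_eq: "map h xs = map h' xs" if "xs \<in> tuples n (carrier M)" for n xs
    using that assms(3) by (auto simp: tuples_def)
  show C: "carrier N = carrier N'"
    using struct_isoD(4)[OF assms(1)] struct_isoD(4)[OF assms(2)] assms(3) by auto
  have pre: "\<exists>ys\<in>tuples n (carrier M). xs = map h ys" if "xs \<in> tuples n (carrier N)" for n xs
    using that map_inv_into_in_tuples map_map_inv_into struct_isoD(4)[OF assms(1)] by metis
  show "fint N f xs = fint N' f xs" if f: "f \<in> funs L" and xs: "xs \<in> tuples (far L f) (carrier N)" for f xs
  proof -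
    obtain ys where ys: "ys \<in> tuples (far L f) (carrier M)" "xs = map h ys" using pre[OF xs] by blast
    have "fint M f ys \<in> carrier M" using struct_isoD(1)[OF assms(1)] f ys by (simp add: is_struct_def)
    then have "h (fint M f ys) = h' (fint M f ys)" by (rule assms(3))
    moreover have "h (fint M f ys) = fint N f (map h ys)" "h' (fint M f ys) = fint N' f (map h' ys)"
      using assms f ys(1) by (simp_all add: struct_iso_def)
    ultimately show ?thesis
      using ys(2) map_eq[OF ys(1)] by simp
  qed
  show "xs \<in> rint N R \<longleftrightarrow> xs \<in> rint N' R" if R: "R \<in> rels L" and xs: "xs \<in> tuples (rar L R) (carrier N)" for R xs
  proof -
    obtain ys where ys: "ys \<in> tuples (rar L R) (carrier M)" "xs = map h ys" using pre[OF xs] by blast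
    have "ys \<in> rint M R \<longleftrightarrow> map h ys \<in> rint N R" "ys \<in> rint M R \<longleftrightarrow> map h' ys \<in> rint N' R"
      using assms R ys(1) by (simp_all add: struct_iso_def)
    then show ?thesis
      using ys map_eq[OF ys(1)] by simp
  qed
qed (use assms struct_isoD in blast)+

lemma struct_iso_cong:
  assumes "struct_iso L h M N" "\<And>x. x \<in> carrier M \<Longrightarrow> h x = h' x"
  shows "struct_iso L h' M N"
proof -
  have "struct_iso L h' M (image_struct L h' M)"
    using assms struct_isoD[OF assms(1)] by (intro struct_iso_image_struct) (auto simp: inj_on_def)
  then show ?thesis using struct_iso_unique_image assms by metis
qed

lemma struct_iso_id: "is_struct L M \<Longrightarrow> struct_iso L id M M"
  by (simp add: struct_iso_def)

lemma struct_iso_comp: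
  assumes "struct_iso L g M N" "struct_iso L h N P"
  shows "struct_iso L (h \<circ> g) M P"
  unfolding struct_iso_def
proof (intro conjI ballI)
  show "bij_betw (h \<circ> g) (carrier M) (carrier P)"
    using assms struct_isoD(5) bij_betw_trans by blast
  have g: "g ` carrier M \<subseteq> carrier N" using struct_isoD(4)[OF assms(1)] by simp
  show "(h \<circ> g) (fint M f xs) = fint P f (map (h \<circ> g) xs)"
    if "f \<in> funs L" "xs \<in> tuples (far L f) (carrier M)" for f xs
    using assms that map_in_tuples[OF that(2) g] by (simp add: struct_iso_def)
  show "xs \<in> rint M R \<longleftrightarrow> map (h \<circ> g) xs \<in> rint P R"
    if "R \<in> rels L" "xs \<in> tuples (rar L R) (carrier M)" for R xs
    using assms that map_in_tuples[OF that(2) g] by (simp add: struct_iso_def)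
qed (use assms struct_isoD in blast)+

text \<open>The copy of \<open>N\<close> along the inverse map is \<open>M\<close> itself, by
  uniqueness of images, because the composite agrees with \<open>id\<close> on \<open>M\<close>. No
  clause about function or relation symbols has to be inverted by hand.\<close>

lemma struct_iso_inv_into:
  assumes "struct_iso L h M N"
  shows "struct_iso L (inv_into (carrier M) h) N M"
proof -
  let ?g = "inv_into (carrier M) h"
  have g: "inj_on ?g (carrier N)" using struct_isoD[OF assms] by (simp add: inj_on_inv_into)
  then have iso: "struct_iso L ?g N (image_struct L ?g N)"
    using struct_isoD(2)[OF assms] by (simp add: struct_iso_image_struct)
  have "struct_iso L (?g \<circ> h) M (image_struct L ?g N)"
    by (rule struct_iso_comp[OF assms iso])
  then have "image_struct L ?g N = M"
    by (rule struct_iso_unique_image[OF _ struct_iso_id]) (use struct_isoD[OF assms] in auto)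
  with iso show ?thesis by simp
qed

lemma struct_iso_bij_inv:
  assumes "struct_iso L h M N" "bij h"
  shows "struct_iso L (inv h) N M"
proof (rule struct_iso_cong[OF struct_iso_inv_into[OF assms(1)]])
  fix x assume "x \<in> carrier N"
  then obtain y where "y \<in> carrier M" "x = h y" using struct_isoD(4)[OF assms(1)] by auto
  then show "inv_into (carrier M) h x = inv h x"
    using struct_isoD(3)[OF assms(1)] assms(2) by (simp add: bij_is_inj)
qed

text \<open>
  Renaming along permutations of the whole universe makes every embedding of a small model into an
  inclusion.
\<close>

lemma inj_on_extends_to_bij:
  fixes f :: "'a \<Rightarrow> 'a"
  assumes inf: "infinite (UNIV :: 'a set)" and small: "|A| <o |UNIV :: 'a set|" and inj: "inj_on f A"
  obtains \<pi> where "bij \<pi>" "\<And>x. x \<in> A \<Longrightarrow> \<pi> x = f x"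
proof -
  \<comment> \<open>An infinite set is not the union of two smaller ones, so the complements of
    \<open>A\<close> and of its image both have the size of the universe and can be matched with
    each other.\<close>
  have compl: "|- B| =o |UNIV :: 'a set|" if B: "|B| <o |UNIV :: 'a set|" for B :: "'a set"
  proof -
    have "\<not> |- B| <o |UNIV :: 'a set|"
      using card_of_Un_ordLess_infinite[OF inf B, of "- B"] ordLess_irreflexive by (metis Compl_partition)
    moreover have "|- B| \<le>o |UNIV :: 'a set|" by (rule card_of_mono1[OF subset_UNIV])
    ultimately show ?thesis using ordLeq_iff_ordLess_or_ordIso by blast
  qed
  have "|f ` A| <o |UNIV :: 'a set|"
    using ordLeq_ordLess_trans[OF card_of_image small] .
  then have "|- A| =o |- f ` A|"
    using compl small ordIso_symmetric ordIso_transitive by metis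
  then obtain g where g: "bij_betw g (- A) (- f ` A)"
    unfolding card_of_ordIso[symmetric] by blast
  have "bij_betw f A (f ` A)" using inj by (simp add: bij_betw_def)
  then have "bij_betw (\<lambda>x. if x \<in> A then f x else g x) (A \<union> - A) (f ` A \<union> - f ` A)"
    by (rule bij_betw_disjoint_Un) (use g in auto)
  then show ?thesis using that[of "\<lambda>x. if x \<in> A then f x else g x"] by simp
qed

section \<open>Embeddings, unions and types\<close>

locale aec =
  fixes K :: "('a, 'f, 'r) aclass"
  assumes aec: "AEC K"
begin

abbreviation emb :: "('a \<Rightarrow> 'a) \<Rightarrow> ('a, 'f, 'r) struct \<Rightarrow> ('a, 'f, 'r) struct \<Rightarrow> bool" where
  "emb \<equiv> K_embedding K"

lemma aec_axioms:
  shows "\<forall>M\<in>models K. is_struct (voc K) M"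
    and "\<forall>M N. M \<preceq>\<^bsub>K\<^esub> N \<longrightarrow> M \<in> models K \<and> N \<in> models K \<and> substruct (voc K) M N"
    and "\<forall>M\<in>models K. M \<preceq>\<^bsub>K\<^esub> M"
    and "\<forall>M N P. M \<preceq>\<^bsub>K\<^esub> N \<and> N \<preceq>\<^bsub>K\<^esub> P \<longrightarrow> M \<preceq>\<^bsub>K\<^esub> P"
    and "\<forall>h M M'. M \<in> models K \<and> struct_iso (voc K) h M M' \<longrightarrow> M' \<in> models K"
    and "\<forall>h M N M' N'. M \<preceq>\<^bsub>K\<^esub> N \<and> struct_iso (voc K) h N N' \<and> struct_iso (voc K) h M M' \<longrightarrow> M' \<preceq>\<^bsub>K\<^esub> N'"
    and "\<forall>M0 M1 M2. M0 \<preceq>\<^bsub>K\<^esub> M2 \<and> M1 \<preceq>\<^bsub>K\<^esub> M2 \<and> substruct (voc K) M0 M1 \<longrightarrow> M0 \<preceq>\<^bsub>K\<^esub> M1"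
    and "\<forall>(r :: 'a rel) M. limit_order r \<and> (\<forall>i j. (i, j) \<in> r \<longrightarrow> M i \<preceq>\<^bsub>K\<^esub> M j) \<longrightarrow>
        union_struct (M ` Field r) \<in> models K \<and>
        (\<forall>i\<in>Field r. M i \<preceq>\<^bsub>K\<^esub> union_struct (M ` Field r)) \<and>
        (\<forall>N\<in>models K. (\<forall>i\<in>Field r. M i \<preceq>\<^bsub>K\<^esub> N) \<longrightarrow> union_struct (M ` Field r) \<preceq>\<^bsub>K\<^esub> N)"
    and "\<exists>\<kappa> :: 'a rel. LS_bound K \<kappa>"
  using aec unfolding AEC_def by - (elim conjE, assumption)+

lemmas model_is_struct = aec_axioms(1)[rule_format]
  and le_refl = aec_axioms(3)[rule_format]

lemma leD:
  assumes "M \<preceq>\<^bsub>K\<^esub> N"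
  shows "M \<in> models K" "N \<in> models K" "substruct (voc K) M N" "carrier M \<subseteq> carrier N"
  using aec_axioms(2) assms by (auto simp: substruct_def)

lemma le_trans: "M \<preceq>\<^bsub>K\<^esub> N \<Longrightarrow> N \<preceq>\<^bsub>K\<^esub> P \<Longrightarrow> M \<preceq>\<^bsub>K\<^esub> P"
  using aec_axioms(4) by blast

lemma iso_model: "M \<in> models K \<Longrightarrow> struct_iso (voc K) h M M' \<Longrightarrow> M' \<in> models K"
  using aec_axioms(5) by blast

lemma iso_le:
  "M \<preceq>\<^bsub>K\<^esub> N \<Longrightarrow> struct_iso (voc K) h N N' \<Longrightarrow> struct_iso (voc K) h M M' \<Longrightarrow> M' \<preceq>\<^bsub>K\<^esub> N'"
  using aec_axioms(6) by blast

text \<open>Coherence: both structures inherit their interpretations from the common extension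
  \<open>N\<close>, so inclusion of carriers already makes one a substructure of the other.\<close>

lemma le_of_subset:
  assumes "M0 \<preceq>\<^bsub>K\<^esub> N" "M1 \<preceq>\<^bsub>K\<^esub> N" "carrier M0 \<subseteq> carrier M1"
  shows "M0 \<preceq>\<^bsub>K\<^esub> M1"
proof -
  have sub: "substruct (voc K) M0 N" "substruct (voc K) M1 N" using leD assms by blast+
  have tup: "tuples n (carrier M0) \<subseteq> tuples n (carrier M1)" for n
    using assms(3) by (auto simp: tuples_def)
  have "substruct (voc K) M0 M1"
    unfolding substruct_def
  proof (intro conjI ballI)
    show "fint M0 f xs = fint M1 f xs"
      if "f \<in> funs (voc K)" "xs \<in> tuples (far (voc K) f) (carrier M0)" for f xs
      using that sub tup[of "far (voc K) f"] by (simp add: substruct_def subset_iff)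
    show "rint M0 R = rint M1 R \<inter> tuples (rar (voc K) R) (carrier M0)" if "R \<in> rels (voc K)" for R
      using that sub tup[of "rar (voc K) R"] by (auto simp: substruct_def)
  qed (use sub assms(3) in \<open>auto simp: substruct_def\<close>)
  then show ?thesis
    using aec_axioms(7) assms by blast
qed

lemma le_carrier_eqI: "M \<preceq>\<^bsub>K\<^esub> N \<Longrightarrow> carrier N \<subseteq> carrier M \<Longrightarrow> M = N"
  using leD(3,4) substruct_eqI subset_antisym by metis

section \<open>The calculus of embeddings\<close>

lemma embE:
  assumes "emb f M N"
  obtains M' where "struct_iso (voc K) f M M'" "M' \<preceq>\<^bsub>K\<^esub> N"
  using assms by (auto simp: K_embedding_def)

lemma embI: "struct_iso (voc K) f M M' \<Longrightarrow> M' \<preceq>\<^bsub>K\<^esub> N \<Longrightarrow> emb f M N"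
  by (auto simp: K_embedding_def)

lemma embD:
  assumes "emb f M N"
  shows "M \<in> models K" "N \<in> models K" "inj_on f (carrier M)" "f ` carrier M \<subseteq> carrier N"
proof -
  obtain M' where M': "struct_iso (voc K) f M M'" "M' \<preceq>\<^bsub>K\<^esub> N" using assms by (rule embE)
  show "M \<in> models K" using iso_model[OF leD(1)[OF M'(2)] struct_iso_inv_into[OF M'(1)]] .
  show "N \<in> models K" using leD(2)[OF M'(2)] .
  show "inj_on f (carrier M)" "f ` carrier M \<subseteq> carrier N"
    using struct_isoD[OF M'(1)] leD(4)[OF M'(2)] by auto
qed

lemma emb_iso: "struct_iso (voc K) f M N \<Longrightarrow> M \<in> models K \<Longrightarrow> emb f M N"
  using embI iso_model le_refl by blast

lemma emb_cong: "emb f M N \<Longrightarrow> (\<And>x. x \<in> carrier M \<Longrightarrow> f x = g x) \<Longrightarrow> emb g M N"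
  by (meson embE embI struct_iso_cong)

text \<open>The bridge from maps to inclusions: an embedding that fixes a model pointwise agrees
  there with \<open>id\<close>, and this turns it into an instance of \<preceq>.\<close>

lemma emb_id_iff: "emb id M N \<longleftrightarrow> M \<preceq>\<^bsub>K\<^esub> N"
proof
  assume *: "emb id M N"
  then obtain M' where M': "struct_iso (voc K) id M M'" "M' \<preceq>\<^bsub>K\<^esub> N" by (rule embE)
  have "struct_iso (voc K) id M M" using struct_isoD(1)[OF M'(1)] struct_iso_id by blast
  then show "M \<preceq>\<^bsub>K\<^esub> N" using struct_iso_unique_image[OF M'(1)] M'(2) by blast
qed (use embI struct_iso_id leD model_is_struct in blast)

lemma emb_restrict:
  assumes f: "emb f M N" and M0: "M0 \<preceq>\<^bsub>K\<^esub> M"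
  shows "emb f M0 N"
proof -
  obtain M' where M': "struct_iso (voc K) f M M'" "M' \<preceq>\<^bsub>K\<^esub> N" using f by (rule embE)
  have iso: "struct_iso (voc K) f M0 (image_struct (voc K) f M0)"
    using embD(3)[OF f] leD[OF M0] model_is_struct by (blast intro: struct_iso_image_struct inj_on_subset)
  then show ?thesis using iso_le[OF M0 M'(1) iso] le_trans[OF _ M'(2)] embI by blast
qed

lemma emb_le: "emb f M N \<Longrightarrow> N \<preceq>\<^bsub>K\<^esub> P \<Longrightarrow> emb f M P"
  by (meson embE embI le_trans)

lemma emb_comp:
  assumes f: "emb f M N" and g: "emb g N P"
  shows "emb (g \<circ> f) M P"
proof -
  obtain M' where M': "struct_iso (voc K) f M M'" "M' \<preceq>\<^bsub>K\<^esub> N" using f by (rule embE)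
  obtain M'' where "struct_iso (voc K) g M' M''" "M'' \<preceq>\<^bsub>K\<^esub> P"
    using emb_restrict[OF g M'(2)] by (rule embE)
  then show ?thesis using struct_iso_comp[OF M'(1)] embI by blast
qed

lemma emb_into:
  assumes f: "emb f M N" and N0: "N0 \<preceq>\<^bsub>K\<^esub> N" "f ` carrier M \<subseteq> carrier N0"
  shows "emb f M N0"
proof -
  obtain M' where M': "struct_iso (voc K) f M M'" "M' \<preceq>\<^bsub>K\<^esub> N" using f by (rule embE)
  then show ?thesis
    using le_of_subset[OF M'(2) N0(1)] N0(2) struct_isoD(4)[OF M'(1)] embI by auto
qed

lemma emb_inv_into:
  assumes f: "emb f M N" and N0: "N0 \<preceq>\<^bsub>K\<^esub> N" "carrier N0 \<subseteq> f ` carrier M"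
  shows "emb (inv_into (carrier M) f) N0 M"
proof -
  obtain M' where M': "struct_iso (voc K) f M M'" "M' \<preceq>\<^bsub>K\<^esub> N" using f by (rule embE)
  have "N0 \<preceq>\<^bsub>K\<^esub> M'" using le_of_subset[OF N0(1) M'(2)] N0(2) struct_isoD(4)[OF M'(1)] by simp
  moreover have "emb (inv_into (carrier M) f) M' M"
    using emb_iso[OF struct_iso_inv_into[OF M'(1)]] leD(1)[OF M'(2)] by blast
  ultimately show ?thesis using emb_restrict by blast
qed

text \<open>The points of \<open>N\<close> outside the image of \<open>M\<close> need names that do
  not collide with \<open>M\<close>; the inverse of a permutation of the universe supplies all of
  them at once.\<close>

lemma emb_extends_to_iso:
  assumes inf: "infinite (UNIV :: 'a set)" and small: "|carrier M| <o |UNIV :: 'a set|" and f: "emb f M N"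
  obtains \<pi> P where "bij \<pi>" "\<And>x. x \<in> carrier M \<Longrightarrow> \<pi> x = f x" "M \<preceq>\<^bsub>K\<^esub> P" "struct_iso (voc K) \<pi> P N"
proof -
  obtain \<pi> where \<pi>: "bij \<pi>" "\<And>x. x \<in> carrier M \<Longrightarrow> \<pi> x = f x"
    using inj_on_extends_to_bij[OF inf small embD(3)[OF f]] by blast
  obtain M' where M': "struct_iso (voc K) f M M'" "M' \<preceq>\<^bsub>K\<^esub> N" using f by (rule embE)
  have iso: "struct_iso (voc K) \<pi> M M'" using struct_iso_cong[OF M'(1)] \<pi>(2) by simp
  let ?P = "image_struct (voc K) (inv \<pi>) N"
  have bij: "bij (inv \<pi>)" using \<pi>(1) by (rule bij_imp_bij_inv)
  have P: "struct_iso (voc K) (inv \<pi>) N ?P"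
    using model_is_struct[OF leD(2)[OF M'(2)]] bij
    by (intro struct_iso_image_struct) (auto intro: bij_is_inj inj_on_subset)
  have "M \<preceq>\<^bsub>K\<^esub> ?P" by (rule iso_le[OF M'(2) P struct_iso_bij_inv[OF iso \<pi>(1)]])
  moreover have "struct_iso (voc K) \<pi> ?P N"
    using struct_iso_bij_inv[OF P bij] inv_inv_eq[OF \<pi>(1)] by simp
  ultimately show ?thesis using that \<pi> by blast
qed

text \<open>The chain axioms speak of well-orders on \<open>'a\<close> only. An injection
  \<open>e\<close> of the index set into \<open>'a\<close> carries the restricted order over, and
  \<open>unbounded\<close> makes the transported order one of limit type.\<close>

lemma union_of_chain:
  fixes r :: "'i rel"
  assumes wo: "Well_order r" and I: "I \<subseteq> Field r" "I \<noteq> {}" and card: "|I| \<le>o |UNIV :: 'a set|"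
    and unbounded: "\<And>i. i \<in> I \<Longrightarrow> \<exists>j\<in>I. i \<in> underS r j"
    and chain: "\<And>i j. i \<in> I \<Longrightarrow> j \<in> I \<Longrightarrow> (i, j) \<in> r \<Longrightarrow> M i \<preceq>\<^bsub>K\<^esub> M j"
  shows "union_struct (M ` I) \<in> models K"
    and "\<And>i. i \<in> I \<Longrightarrow> M i \<preceq>\<^bsub>K\<^esub> union_struct (M ` I)"
    and "\<And>N. (\<And>i. i \<in> I \<Longrightarrow> M i \<preceq>\<^bsub>K\<^esub> N) \<Longrightarrow> union_struct (M ` I) \<preceq>\<^bsub>K\<^esub> N"
proof -
  obtain e :: "'i \<Rightarrow> 'a" where e: "inj_on e I"
    using card unfolding card_of_ordLeq[symmetric] by blast
  let ?q = "Restr r I"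
  let ?s = "dir_image ?q e"
  have fld: "Field ?q = I" using I(1) wo Refl_Field_Restr2[of r I]
    by (simp add: order_on_defs)
  have wos: "Well_order ?s" using Well_order_dir_image[OF Well_order_Restr[OF wo], of e I] e fld by simp
  have flds: "Field ?s = e ` I" using fld by (simp add: dir_image_Field)
  have "limit_order ?s"
    unfolding limit_order_def
  proof (intro conjI ballI)
    fix x assume "x \<in> Field ?s"
    then obtain i where i: "i \<in> I" "x = e i" using flds by auto
    obtain j where j: "j \<in> I" "i \<in> underS r j" using unbounded i by blast
    then have "e i \<noteq> e j" using i e by (auto simp: underS_def inj_on_def)
    then have "x \<in> underS ?s (e j)" using i j by (auto simp: underS_def dir_image_def)
    then show "\<exists>y\<in>Field ?s. x \<in> underS ?s y" using j flds by blast
  qed (use wos flds I in auto)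
  moreover have "M (inv_into I e x) \<preceq>\<^bsub>K\<^esub> M (inv_into I e y)" if "(x, y) \<in> ?s" for x y
    using that chain e by (auto simp: dir_image_def)
  ultimately have
    "union_struct ((M \<circ> inv_into I e) ` Field ?s) \<in> models K \<and>
     (\<forall>i\<in>Field ?s. (M \<circ> inv_into I e) i \<preceq>\<^bsub>K\<^esub> union_struct ((M \<circ> inv_into I e) ` Field ?s)) \<and>
     (\<forall>N\<in>models K. (\<forall>i\<in>Field ?s. (M \<circ> inv_into I e) i \<preceq>\<^bsub>K\<^esub> N) \<longrightarrow>
        union_struct ((M \<circ> inv_into I e) ` Field ?s) \<preceq>\<^bsub>K\<^esub> N)"
    using aec_axioms(8)[rule_format, of ?s "M \<circ> inv_into I e"] by auto
  moreover have "(M \<circ> inv_into I e) ` Field ?s = M ` I"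
    unfolding flds image_comp comp_def using e by (intro image_cong) auto
  ultimately have *: "union_struct (M ` I) \<in> models K"
     "\<forall>i\<in>e ` I. M (inv_into I e i) \<preceq>\<^bsub>K\<^esub> union_struct (M ` I)"
     "\<forall>N\<in>models K. (\<forall>i\<in>e ` I. M (inv_into I e i) \<preceq>\<^bsub>K\<^esub> N) \<longrightarrow> union_struct (M ` I) \<preceq>\<^bsub>K\<^esub> N"
    unfolding flds comp_def by auto
  show "union_struct (M ` I) \<in> models K" by (rule *(1))
  show "M i \<preceq>\<^bsub>K\<^esub> union_struct (M ` I)" if "i \<in> I" for i
    using *(2) that e by auto
  show "union_struct (M ` I) \<preceq>\<^bsub>K\<^esub> N" if N: "\<And>i. i \<in> I \<Longrightarrow> M i \<preceq>\<^bsub>K\<^esub> N" for N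
    using *(3) N I(2) e leD(2) by (metis (no_types, lifting) all_not_in_conv imageE inv_into_f_f)
qed

lemma carrier_union [simp]: "carrier (union_struct S) = (\<Union>M\<in>S. carrier M)"
  by (simp add: union_struct_def)

text \<open>Cardinals are well-ordered, so a least bound exists and the choice in the definition of
  \<open>LS\<close> is a genuine one.\<close>

lemma LS_bound_LS: "LS_bound K (LS K)"
proof -
  have "\<exists>\<kappa>\<in>{\<kappa> :: 'a rel. LS_bound K \<kappa>}. \<forall>\<kappa>'\<in>{\<kappa> :: 'a rel. LS_bound K \<kappa>}. \<kappa> \<le>o \<kappa>'"
  proof (rule exists_minim_Card_order)
    show "{\<kappa> :: 'a rel. LS_bound K \<kappa>} \<noteq> {}" using aec_axioms(9) by blast
  qed (simp add: LS_bound_def)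
  then show ?thesis
    unfolding LS_def by (rule someI2_ex[where Q = "LS_bound K", OF bexE]) auto
qed

section \<open>Submodels of prescribed cardinality\<close>

lemma infinite_Field_above_LS:
  assumes "LS K \<le>o \<kappa>" "Card_order \<kappa>"
  shows "infinite (Field \<kappa>)"
proof -
  have "natLeq \<le>o |funs (voc K) <+> rels (voc K)| +c natLeq"
    by (rule ordLeq_csum2[OF natLeq_Card_order])
  then have "natLeq \<le>o \<kappa>"
    using LS_bound_LS assms(1) unfolding LS_bound_def by (meson ordLeq_transitive)
  then have "natLeq \<le>o |Field \<kappa>|"
    using assms(2) card_of_Field_ordIso ordIso_symmetric ordLeq_ordIso_trans by blast
  then show ?thesis using infinite_iff_natLeq_ordLeq by blast
qed

lemma LS_submodel:
  assumes \<kappa>: "LS K \<le>o \<kappa>" "Card_order \<kappa>" and A: "M \<in> models K" "A \<subseteq> carrier M" "|A| \<le>o \<kappa>"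
  obtains N where "N \<preceq>\<^bsub>K\<^esub> M" "A \<subseteq> carrier N" "|carrier N| \<le>o \<kappa>"
proof -
  obtain N where N: "N \<preceq>\<^bsub>K\<^esub> M" "A \<subseteq> carrier N" "|carrier N| \<le>o |A| +c LS K"
    using LS_bound_LS A unfolding LS_bound_def by blast
  have "Cinfinite \<kappa>" using infinite_Field_above_LS[OF \<kappa>] \<kappa>(2) by (simp add: cinfinite_def)
  then have "|A| +c LS K \<le>o \<kappa>" using A(3) \<kappa> LS_bound_LS csum_cinfinite_bound[of "|A|" \<kappa> "LS K"] by (simp add: LS_bound_def card_of_Card_order)
  then show ?thesis using that N ordLeq_transitive by blast
qed

lemma models_of_cardI: "M \<in> models K \<Longrightarrow> |carrier M| \<le>o \<kappa> \<Longrightarrow> \<kappa> \<le>o |carrier M| \<Longrightarrow> M \<in> models_of_card K \<kappa>"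
  by (simp add: models_of_card_def ordIso_iff_ordLeq)

lemma models_of_cardD:
  assumes "M \<in> models_of_card K \<kappa>"
  shows "M \<in> models K" "|carrier M| =o \<kappa>" "|carrier M| \<le>o \<kappa>" "\<kappa> \<le>o |carrier M|"
  using assms ordIso_iff_ordLeq by (auto simp: models_of_card_def)

text \<open>The Loewenheim-Skolem bound is only an upper one. Padding \<open>A\<close> with a copy
  of \<open>Field \<kappa>\<close> inside \<open>M\<close> keeps the submodel from being too
  small.\<close>

lemma LS_submodel_of_card:
  assumes \<kappa>: "LS K \<le>o \<kappa>" "Card_order \<kappa>" and A: "M \<in> models K" "A \<subseteq> carrier M" "|A| \<le>o \<kappa>"
    and M: "\<kappa> \<le>o |carrier M|"
  obtains N where "N \<preceq>\<^bsub>K\<^esub> M" "A \<subseteq> carrier N" "N \<in> models_of_card K \<kappa>"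
proof -
  have "|Field \<kappa>| \<le>o |carrier M|"
    using M \<kappa>(2) card_of_Field_ordIso ordIso_ordLeq_trans by blast
  then obtain e where e: "inj_on e (Field \<kappa>)" "e ` Field \<kappa> \<subseteq> carrier M"
    unfolding card_of_ordLeq[symmetric] by blast
  have "|e ` Field \<kappa>| \<le>o \<kappa>"
    using card_of_image card_of_Field_ordIso[OF \<kappa>(2)] ordLeq_ordIso_trans by blast
  then have "|A \<union> e ` Field \<kappa>| \<le>o \<kappa>"
    using card_of_Un_ordLeq_infinite_Field[OF infinite_Field_above_LS[OF \<kappa>] A(3)] \<kappa>(2) by blast
  then obtain N where N: "N \<preceq>\<^bsub>K\<^esub> M" "A \<union> e ` Field \<kappa> \<subseteq> carrier N" "|carrier N| \<le>o \<kappa>"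
    using LS_submodel[OF \<kappa> A(1)] A(2) e(2) by (metis Un_least)
  have "|Field \<kappa>| \<le>o |carrier N|" using e(1) N(2) unfolding card_of_ordLeq[symmetric] by blast
  then have "\<kappa> \<le>o |carrier N|"
    using card_of_Field_ordIso[OF \<kappa>(2)] ordIso_symmetric ordIso_ordLeq_trans by blast
  then show ?thesis using that N models_of_cardI leD(1) by blast
qed

section \<open>Galois types, their restriction and their transport\<close>

lemma triplesI: "M \<preceq>\<^bsub>K\<^esub> N \<Longrightarrow> a \<in> carrier N \<Longrightarrow> (a, M, N) \<in> triples K"
  by (simp add: triples_def)

lemma triplesD: "(a, M, N) \<in> triples K \<Longrightarrow> M \<preceq>\<^bsub>K\<^esub> N" "(a, M, N) \<in> triples K \<Longrightarrow> a \<in> carrier N"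
  by (simp_all add: triples_def)

lemma E_atI:
  assumes "M \<preceq>\<^bsub>K\<^esub> N1" "M \<preceq>\<^bsub>K\<^esub> N2" "a1 \<in> carrier N1" "a2 \<in> carrier N2"
    and "emb f1 N1 N" "emb f2 N2 N" "fixes_pointwise f1 M" "fixes_pointwise f2 M" "f1 a1 = f2 a2"
  shows "((a1, M, N1), (a2, M, N2)) \<in> E_at K"
  using assms triplesI embD(2) unfolding E_at_def by blast

lemma E_atE:
  assumes "((a1, M1, N1), (a2, M2, N2)) \<in> E_at K"
  obtains f1 f2 N where "M2 = M1" "M1 \<preceq>\<^bsub>K\<^esub> N1" "M1 \<preceq>\<^bsub>K\<^esub> N2" "a1 \<in> carrier N1" "a2 \<in> carrier N2"
    "emb f1 N1 N" "emb f2 N2 N" "fixes_pointwise f1 M1" "fixes_pointwise f2 M1" "f1 a1 = f2 a2"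
  using assms that triplesD unfolding E_at_def by blast

lemma sym_E_at: "sym (E_at K)"
proof (rule symI)
  fix s t assume "(s, t) \<in> E_at K"
  then show "(t, s) \<in> E_at K"
    by (cases s; cases t) (auto elim!: E_atE intro: E_atI)
qed

text \<open>\<open>P\<close> itself is the amalgam, with \<open>f\<close> on one side and the
  identity on the other.\<close>

lemma E_at_emb:
  assumes "M \<preceq>\<^bsub>K\<^esub> N" "a \<in> carrier N" "emb f N P" "fixes_pointwise f M"
  shows "((a, M, N), (f a, M, P)) \<in> E_at K"
proof (rule E_atI)
  have "emb id M P"
    by (rule emb_cong[OF emb_restrict[OF assms(3,1)]]) (use assms(4) in \<open>simp add: fixes_pointwise_def\<close>)
  then show "M \<preceq>\<^bsub>K\<^esub> P" by (simp add: emb_id_iff)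
  show "emb id P P" using embD(2)[OF assms(3)] by (simp add: emb_id_iff le_refl)
  show "f a \<in> carrier P" using embD(4)[OF assms(3)] assms(2) by blast
qed (use assms in \<open>auto simp: fixes_pointwise_def\<close>)

lemma E_at_refl: "M \<preceq>\<^bsub>K\<^esub> N \<Longrightarrow> a \<in> carrier N \<Longrightarrow> ((a, M, N), (a, M, N)) \<in> E_at K"
  using E_at_emb[of M N a id N] by (simp add: emb_id_iff le_refl leD fixes_pointwise_def)

lemma gtp_eqI: "((a, M, N), (b, M, P)) \<in> (E_at K)\<^sup>+ \<Longrightarrow> gtp K a M N = gtp K b M P"
  unfolding gtp_def using sym_trancl[OF sym_E_at] by (auto dest: symD intro: trancl_trans)

lemma gtp_eqD:
  assumes "M \<preceq>\<^bsub>K\<^esub> P" "b \<in> carrier P" "gtp K a M N = gtp K b M P"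
  shows "((a, M, N), (b, M, P)) \<in> (E_at K)\<^sup>+"
  using assms E_at_refl[OF assms(1,2)] unfolding gtp_def by blast

lemma gtp_emb:
  "M \<preceq>\<^bsub>K\<^esub> N \<Longrightarrow> a \<in> carrier N \<Longrightarrow> emb f N P \<Longrightarrow> fixes_pointwise f M \<Longrightarrow> gtp K a M N = gtp K (f a) M P"
  using gtp_eqI E_at_emb by blast

text \<open>Types are classes of a transitive closure, as a single amalgamation step need not be
  transitive. An operation on representatives therefore respects types as soon as it respects single
  steps.\<close>

lemma trancl_E_at_map:
  assumes "((a, M, N), t) \<in> (E_at K)\<^sup>+"
    and step: "\<And>a b N P. ((a, M, N), (b, M, P)) \<in> E_at K \<Longrightarrow> ((f a, M', g N), (f b, M', g P)) \<in> E_at K"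
  shows "fst (snd t) = M \<and> ((f a, M', g N), (f (fst t), M', g (snd (snd t)))) \<in> (E_at K)\<^sup>+"
  using assms(1)
proof (induction rule: trancl_induct)
  case (base t)
  then obtain b P where t: "t = (b, M, P)" by (cases t) (auto elim!: E_atE)
  then show ?case using base assms(2)[of a N b P] by (auto intro: r_into_trancl)
next
  case (step t u)
  obtain b P c Q where t: "t = (b, M, P)" and u: "u = (c, M, Q)"
    using step by (cases t; cases u) (auto elim!: E_atE)
  then have "((f b, M', g P), (f c, M', g Q)) \<in> E_at K"
    using step(2) assms(2) by simp
  then show ?case using step(3) t u by (auto intro: trancl_into_trancl)
qed

text \<open>This justifies the definite description in \<open>restrict_type\<close>: maps that fix
  \<open>N\<close> also fix \<open>N1\<close>, so an amalgam over \<open>N\<close> is one over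
  \<open>N1\<close>.\<close>

lemma restrict_gtp:
  assumes "N1 \<preceq>\<^bsub>K\<^esub> N" "N \<preceq>\<^bsub>K\<^esub> P" "a \<in> carrier P"
  shows "restrict_type K (gtp K a N P) N1 = gtp K a N1 P"
  unfolding restrict_type_def
proof (rule the_equality)
  have "(a, N, P) \<in> gtp K a N P" using E_at_refl[OF assms(2,3)] unfolding gtp_def by blast
  then show "\<exists>b M Q. (b, M, Q) \<in> gtp K a N P \<and> gtp K a N1 P = gtp K b N1 Q" by blast
next
  fix q assume "\<exists>b M Q. (b, M, Q) \<in> gtp K a N P \<and> q = gtp K b N1 Q"
  then obtain b M Q where b: "((a, N, P), (b, M, Q)) \<in> (E_at K)\<^sup>+" "q = gtp K b N1 Q"
    unfolding gtp_def by blast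
  have "((c, N1, R), (d, N1, S)) \<in> E_at K" if "((c, N, R), (d, N, S)) \<in> E_at K" for c d R S
    using that
  proof (rule E_atE)
    fix f1 f2 T
    assume *: "N \<preceq>\<^bsub>K\<^esub> R" "N \<preceq>\<^bsub>K\<^esub> S" "c \<in> carrier R" "d \<in> carrier S" "emb f1 R T" "emb f2 S T"
      "fixes_pointwise f1 N" "fixes_pointwise f2 N" "f1 c = f2 d"
    show ?thesis
      by (rule E_atI[OF le_trans[OF assms(1) *(1)] le_trans[OF assms(1) *(2)] *(3-6)])
        (use * leD(4)[OF assms(1)] in \<open>auto simp: fixes_pointwise_def\<close>)
  qed
  from trancl_E_at_map[OF b(1), of "\<lambda>x. x" N1 "\<lambda>x. x", OF this]
  have "((a, N1, P), (b, N1, Q)) \<in> (E_at K)\<^sup>+" by simp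
  then show "q = gtp K a N1 P" using b(2) gtp_eqI by metis
qed

text \<open>The description in \<open>map_type\<close> leaves open both the representative and the
  extension of \<open>h\<close>. A permutation \<open>\<sigma>\<close> of the whole universe acts on
  every model of a chain of steps at once, including those unrelated to \<open>P\<close>, and so
  settles the first freedom; two extensions of \<open>h\<close> differ by a map fixing
  \<open>N2\<close>, which settles the second.\<close>

lemma map_gtp:
  assumes N1: "N1 \<preceq>\<^bsub>K\<^esub> P" "a \<in> carrier P" and h: "struct_iso (voc K) h N1 N2"
    and \<sigma>: "bij \<sigma>" "\<And>x. x \<in> carrier N1 \<Longrightarrow> \<sigma> x = h x" and P': "struct_iso (voc K) \<sigma> P P'"
  shows "map_type K h N1 N2 (gtp K a N1 P) = gtp K (\<sigma> a) N2 P'"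
  unfolding map_type_def
proof (rule the_equality)
  show "\<exists>a' N N' h'. (a', N1, N) \<in> gtp K a N1 P \<and> struct_iso (voc K) h' N N' \<and>
      (\<forall>x\<in>carrier N1. h' x = h x) \<and> gtp K (\<sigma> a) N2 P' = gtp K (h' a') N2 N'"
    using E_at_refl[OF N1] P' \<sigma>(2) unfolding gtp_def by blast
next
  fix q assume "\<exists>a' N N' h'. (a', N1, N) \<in> gtp K a N1 P \<and> struct_iso (voc K) h' N N' \<and>
      (\<forall>x\<in>carrier N1. h' x = h x) \<and> q = gtp K (h' a') N2 N'"
  then obtain b Q Q' h' where b: "((a, N1, P), (b, N1, Q)) \<in> (E_at K)\<^sup>+" "struct_iso (voc K) h' Q Q'"
    "\<And>x. x \<in> carrier N1 \<Longrightarrow> h' x = h x" "q = gtp K (h' b) N2 Q'"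
    unfolding gtp_def by blast
  let ?img = "image_struct (voc K) \<sigma>"
  have img: "struct_iso (voc K) \<sigma> R (?img R)" "struct_iso (voc K) (inv \<sigma>) (?img R) R" if "R \<in> models K" for R
  proof -
    show "struct_iso (voc K) \<sigma> R (?img R)"
      by (rule struct_iso_image_struct[OF model_is_struct[OF that]]) (use \<sigma>(1) bij_is_inj inj_on_subset in blast)
    then show "struct_iso (voc K) (inv \<sigma>) (?img R) R" using \<sigma>(1) by (rule struct_iso_bij_inv)
  qed
  have isoN: "struct_iso (voc K) \<sigma> N1 N2" using struct_iso_cong[OF h] \<sigma>(2) by simp
  have N2: "carrier N2 = \<sigma> ` carrier N1" using struct_isoD(4)[OF isoN] .
  have N2_le: "N2 \<preceq>\<^bsub>K\<^esub> ?img R" if "N1 \<preceq>\<^bsub>K\<^esub> R" for R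
    using iso_le[OF that img(1) isoN] leD(2)[OF that] by blast
  have inv\<sigma>: "inv \<sigma> (\<sigma> x) = x" for x using \<sigma>(1) by (simp add: bij_is_inj)
  have step: "((\<sigma> c, N2, ?img R), (\<sigma> d, N2, ?img S)) \<in> E_at K" if "((c, N1, R), (d, N1, S)) \<in> E_at K" for c d R S
    using that
  proof (rule E_atE)
    fix f1 f2 N
    assume *: "N1 \<preceq>\<^bsub>K\<^esub> R" "N1 \<preceq>\<^bsub>K\<^esub> S" "c \<in> carrier R" "d \<in> carrier S" "emb f1 R N" "emb f2 S N"
      "fixes_pointwise f1 N1" "fixes_pointwise f2 N1" "f1 c = f2 d"
    \<comment> \<open>The amalgam and its two embeddings are conjugated by \<open>\<sigma>\<close>
      as well.\<close>
    have conj: "emb (\<sigma> \<circ> (f \<circ> inv \<sigma>)) (?img T) (?img N)" if "emb f T N" for f T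
    proof (rule emb_comp[OF emb_comp[OF _ that]])
      have T: "T \<in> models K" and N: "N \<in> models K" using embD[OF that] by auto
      show "emb (inv \<sigma>) (?img T) T"
        using emb_iso[OF img(2)[OF T]] iso_model[OF T img(1)[OF T]] by blast
      show "emb \<sigma> N (?img N)" by (rule emb_iso[OF img(1)[OF N] N])
    qed
    show ?thesis
      by (rule E_atI[OF N2_le[OF *(1)] N2_le[OF *(2)] _ _ conj[OF *(5)] conj[OF *(6)]])
        (use * N2 inv\<sigma> in \<open>auto simp: fixes_pointwise_def\<close>)
  qed
  have "((\<sigma> a, N2, ?img P), (\<sigma> b, N2, ?img Q)) \<in> (E_at K)\<^sup>+"
    using trancl_E_at_map[OF b(1), of \<sigma> N2 ?img, OF step] by simp
  then have eq1: "gtp K (\<sigma> a) N2 (?img P) = gtp K (\<sigma> b) N2 (?img Q)" by (rule gtp_eqI)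
  have "(b, N1, Q) \<in> triples K"
    using b(1) by (rule tranclE) (auto simp: E_at_def)
  then have Q: "N1 \<preceq>\<^bsub>K\<^esub> Q" "b \<in> carrier Q" "Q \<in> models K" using triplesD leD by blast+
  have P'_eq: "P' = ?img P" using struct_iso_unique_image[OF P' img(1)] leD(2)[OF N1(1)] by blast
  have inv: "struct_iso (voc K) (inv_into (carrier Q) h') Q' Q" by (rule struct_iso_inv_into[OF b(2)])
  have comp: "struct_iso (voc K) (\<sigma> \<circ> inv_into (carrier Q) h') Q' (?img Q)"
    by (rule struct_iso_comp[OF inv img(1)[OF Q(3)]])
  have h'inv: "inv_into (carrier Q) h' (h' x) = x" if "x \<in> carrier Q" for x
    using struct_isoD(3)[OF b(2)] that by simp
  have isoh': "struct_iso (voc K) h' N1 N2" using struct_iso_cong[OF h] b(3) by simp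
  have N2Q': "N2 \<preceq>\<^bsub>K\<^esub> Q'" by (rule iso_le[OF Q(1) b(2) isoh'])
  \<comment> \<open>Undoing \<open>h'\<close> and applying \<open>\<sigma>\<close> instead fixes
    \<open>N2\<close> pointwise, since both maps extend \<open>h\<close>.\<close>
  have "gtp K (h' b) N2 Q' = gtp K ((\<sigma> \<circ> inv_into (carrier Q) h') (h' b)) N2 (?img Q)"
  proof (rule gtp_emb[OF N2Q'])
    show "h' b \<in> carrier Q'" using Q(2) struct_isoD(4)[OF b(2)] by simp
    show "emb (\<sigma> \<circ> inv_into (carrier Q) h') Q' (?img Q)" using emb_iso[OF comp] leD(2)[OF N2Q'] by blast
    show "fixes_pointwise (\<sigma> \<circ> inv_into (carrier Q) h') N2"
      unfolding fixes_pointwise_def N2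
      using h'inv leD(4)[OF Q(1)] b(3) \<sigma>(2) by (auto simp: subset_iff) metis
  qed
  then show "q = gtp K (\<sigma> a) N2 P'"
    using b(4) h'inv[OF Q(2)] eq1 P'_eq by simp
qed

end

section \<open>Chains of models and of embeddings\<close>

lemma limit_order_infinite_Card_order:
  assumes "Card_order r" "infinite (Field r)"
  shows "limit_order r"
  unfolding limit_order_def
proof (intro conjI ballI)
  show "Well_order r" using assms(1) by (simp add: card_order_on_def)
  show "Field r \<noteq> {}" using assms(2) by auto
  show "\<exists>j\<in>Field r. i \<in> underS r j" if "i \<in> Field r" for i
    using infinite_Card_order_limit[OF assms that] by (auto simp: underS_def)
qed

lemma card_of_underS_le_Card_order:
  assumes "Card_order r" "i \<in> Field r"
  shows "|underS r i| \<le>o r"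
  using card_of_underS[OF assms] ordLess_imp_ordLeq by blast

lemma card_of_underS_cardSuc:
  assumes "Card_order \<kappa>" "i \<in> Field (cardSuc \<kappa>)"
  shows "|underS (cardSuc \<kappa>) i| \<le>o \<kappa>"
  using card_of_underS[OF cardSuc_Card_order[OF assms(1)] assms(2)]
    cardSuc_ordLeq_ordLess[OF assms(1) card_of_Card_order] by blast

context aec begin

text \<open>Pulling \<open>N\<close> back along a permutation that extends \<open>f\<close> turns
  all the embeddings into inclusions into one model \<open>?P\<close>. The union lies below
  \<open>?P\<close> by leastness, and going forward again gives the claim.\<close>

lemma emb_union:
  assumes inf: "infinite (UNIV :: 'a set)" and small: "|carrier U| <o |UNIV :: 'a set|"
    and C: "carrier U = (\<Union>i\<in>I. carrier (M i))" and ne: "I \<noteq> {}"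
    and least: "\<And>P. (\<And>i. i \<in> I \<Longrightarrow> M i \<preceq>\<^bsub>K\<^esub> P) \<Longrightarrow> U \<preceq>\<^bsub>K\<^esub> P"
    and lin: "\<And>i j. i \<in> I \<Longrightarrow> j \<in> I \<Longrightarrow> M i \<preceq>\<^bsub>K\<^esub> M j \<or> M j \<preceq>\<^bsub>K\<^esub> M i"
    and f: "\<And>i. i \<in> I \<Longrightarrow> emb f (M i) N"
  shows "emb f U N"
proof -
  have "inj_on f (carrier U)"
    unfolding inj_on_def C
  proof clarify
    fix x y i j assume *: "i \<in> I" "x \<in> carrier (M i)" "j \<in> I" "y \<in> carrier (M j)" "f x = f y"
    then obtain k where "k \<in> I" "x \<in> carrier (M k)" "y \<in> carrier (M k)" using lin leD(4) by blast
    then show "x = y" using embD(3)[OF f] * by (auto dest: inj_onD)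
  qed
  then obtain \<pi> where \<pi>: "bij \<pi>" "\<And>x. x \<in> carrier U \<Longrightarrow> \<pi> x = f x"
    using inj_on_extends_to_bij[OF inf small] by blast
  have N: "N \<in> models K" using embD(2)[OF f] ne by blast
  let ?P = "image_struct (voc K) (inv \<pi>) N"
  have bij: "bij (inv \<pi>)" using \<pi>(1) by (rule bij_imp_bij_inv)
  have P: "struct_iso (voc K) (inv \<pi>) N ?P"
    using model_is_struct[OF N] bij
    by (intro struct_iso_image_struct) (auto intro: bij_is_inj inj_on_subset)
  have "U \<preceq>\<^bsub>K\<^esub> ?P"
  proof (rule least)
    fix i assume i: "i \<in> I"
    have "emb \<pi> (M i) N" by (rule emb_cong[OF f[OF i]]) (use \<pi>(2) C i in force)
    then have "emb (inv \<pi> \<circ> \<pi>) (M i) ?P" by (rule emb_comp[OF _ emb_iso[OF P N]])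
    then show "M i \<preceq>\<^bsub>K\<^esub> ?P" using \<pi>(1) by (simp add: bij_is_inj emb_id_iff)
  qed
  then have "emb id U ?P" by (simp add: emb_id_iff)
  moreover have "emb \<pi> ?P N"
    using emb_iso[OF struct_iso_bij_inv[OF P bij]] iso_model[OF N P] inv_inv_eq[OF \<pi>(1)] by simp
  ultimately have "emb (\<pi> \<circ> id) U N" by (rule emb_comp)
  then show ?thesis using \<pi>(2) emb_cong[of \<pi>] by simp
qed

end

text \<open>The bound on the universe serves two ends: models of size \<kappa> are small enough to
  be renamed by permutations, and chains of length \<open>\<kappa>\<^sup>+\<close> have index sets
  that inject into \<open>'a\<close>.\<close>

locale aec_card = aec K for K :: "('a, 'f, 'r) aclass" +
  fixes \<kappa> :: "'c rel"
  assumes card: "Card_order \<kappa>" and LS_le: "LS K \<le>o \<kappa>"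
    and universe: "cardSuc \<kappa> \<le>o |UNIV :: 'a set|"
begin

abbreviation K\<kappa> :: "('a, 'f, 'r) struct set" where "K\<kappa> \<equiv> models_of_card K \<kappa>"

lemma infinite_Field: "infinite (Field \<kappa>)"
  using infinite_Field_above_LS[OF LS_le card] .

lemma \<kappa>_less_UNIV: "\<kappa> <o |UNIV :: 'a set|"
  using cardSuc_greater[OF card] universe ordLess_ordLeq_trans by blast

lemma small: "|A :: 'a set| \<le>o \<kappa> \<Longrightarrow> |A| <o |UNIV :: 'a set|"
  using \<kappa>_less_UNIV ordLeq_ordLess_trans by blast

lemma infinite_UNIV: "infinite (UNIV :: 'a set)"
proof -
  have "|Field \<kappa>| \<le>o |UNIV :: 'a set|"
    using card_of_Field_ordIso[OF card] \<kappa>_less_UNIV ordIso_ordLeq_trans ordLess_imp_ordLeq by blast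
  then show ?thesis using card_of_ordLeq_infinite infinite_Field by blast
qed

lemma card_Un: "|A| \<le>o \<kappa> \<Longrightarrow> |B| \<le>o \<kappa> \<Longrightarrow> |A \<union> B| \<le>o \<kappa>"
  using card_of_Un_ordLeq_infinite_Field[OF infinite_Field _ _ card] by blast

lemma card_UN: "|I| \<le>o \<kappa> \<Longrightarrow> (\<And>i. i \<in> I \<Longrightarrow> |A i| \<le>o \<kappa>) \<Longrightarrow> |\<Union>i\<in>I. A i| \<le>o \<kappa>"
  using card_of_UNION_ordLeq_infinite_Field[OF infinite_Field card] by blast

lemma card_image: "|A| \<le>o \<kappa> \<Longrightarrow> |f ` A| \<le>o \<kappa>"
  using card_of_image ordLeq_transitive by blast

lemma card_singleton: "|{x}| \<le>o \<kappa>"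
proof (rule Card_order_singl_ordLeq[OF card])
  show "Field \<kappa> \<noteq> {}" using infinite_Field by auto
qed

lemma card_model: "M \<in> K\<kappa> \<Longrightarrow> |carrier M| \<le>o \<kappa>"
  by (rule models_of_cardD)

lemma model_in_models: "M \<in> K\<kappa> \<Longrightarrow> M \<in> models K"
  by (rule models_of_cardD)

lemma submodel_containing:
  assumes "M \<in> K\<kappa>" "M \<preceq>\<^bsub>K\<^esub> B" "A \<subseteq> carrier B" "|A| \<le>o \<kappa>"
  obtains N where "N \<in> K\<kappa>" "M \<preceq>\<^bsub>K\<^esub> N" "N \<preceq>\<^bsub>K\<^esub> B" "A \<subseteq> carrier N"
proof -
  have "carrier M \<union> A \<subseteq> carrier B" using leD(4)[OF assms(2)] assms(3) by blast
  moreover have "|carrier M \<union> A| \<le>o \<kappa>" using card_Un card_model assms(1,4) by blast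
  moreover have "\<kappa> \<le>o |carrier B|"
    using models_of_cardD(4)[OF assms(1)] card_of_mono1[OF leD(4)[OF assms(2)]] ordLeq_transitive by blast
  ultimately obtain N where N: "N \<preceq>\<^bsub>K\<^esub> B" "carrier M \<union> A \<subseteq> carrier N" "N \<in> K\<kappa>"
    using LS_submodel_of_card[OF LS_le card leD(2)[OF assms(2)]] by blast
  then show ?thesis using that le_of_subset[OF assms(2) N(1)] by blast
qed

lemma submodel_containing_element:
  assumes "M \<in> K\<kappa>" "M \<preceq>\<^bsub>K\<^esub> P" "x \<in> carrier P"
  obtains N where "N \<in> K\<kappa>" "M \<preceq>\<^bsub>K\<^esub> N" "N \<preceq>\<^bsub>K\<^esub> P" "x \<in> carrier N"
proof -
  have "{x} \<subseteq> carrier P" using assms(3) by simp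
  from submodel_containing[OF assms(1,2) this card_singleton] that show ?thesis by auto
qed

text \<open>\<open>amalgamation_in\<close> handles inclusions only. \<open>N\<close> is renamed to
  an extension \<open>P\<close> of \<open>M0\<close>, amalgamated with \<open>M1\<close>, and the
  amalgam is renamed so as to contain \<open>N\<close> again; as its size is not controlled, it is
  finally cut down to \<kappa>.\<close>

lemma embedding_amalgamation:
  assumes ap: "amalgamation_in K \<kappa>" and M: "M0 \<in> K\<kappa>" "M1 \<in> K\<kappa>" "M0 \<preceq>\<^bsub>K\<^esub> M1"
    and N: "N \<in> K\<kappa>" and f: "emb f M0 N"
  obtains N' f' where "N' \<in> K\<kappa>" "N \<preceq>\<^bsub>K\<^esub> N'" "emb f' M1 N'" "\<And>x. x \<in> carrier M0 \<Longrightarrow> f' x = f x"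
proof -
  obtain \<pi> P where \<pi>: "bij \<pi>" "\<And>x. x \<in> carrier M0 \<Longrightarrow> \<pi> x = f x" "M0 \<preceq>\<^bsub>K\<^esub> P" "struct_iso (voc K) \<pi> P N"
    using emb_extends_to_iso[OF infinite_UNIV small[OF card_model[OF M(1)]] f] by blast
  have "|carrier P| =o |carrier N|"
    using struct_isoD(5)[OF \<pi>(4)] card_of_ordIso by blast
  then have P: "P \<in> K\<kappa>"
    using leD(2)[OF \<pi>(3)] models_of_cardD(2)[OF N] ordIso_transitive by (auto simp: models_of_card_def)
  obtain Q f1 f2 where Q: "emb f1 P Q" "emb f2 M1 Q" "fixes_pointwise f1 M0" "fixes_pointwise f2 M0"
    using ap M P \<pi>(3) unfolding amalgamation_in_def by metis
  let ?\<pi>' = "inv_into (carrier P) \<pi>"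
  have NP: "emb ?\<pi>' N P"
    using emb_iso[OF struct_iso_inv_into[OF \<pi>(4)] model_in_models[OF N]] .
  obtain \<rho> T where \<rho>: "\<And>x. x \<in> carrier N \<Longrightarrow> \<rho> x = (f1 \<circ> ?\<pi>') x" "N \<preceq>\<^bsub>K\<^esub> T" "struct_iso (voc K) \<rho> T Q"
    using emb_extends_to_iso[OF infinite_UNIV small[OF card_model[OF N]] emb_comp[OF NP Q(1)]] by blast
  let ?\<rho>' = "inv_into (carrier T) \<rho>"
  have QT: "emb ?\<rho>' Q T"
    using emb_iso[OF struct_iso_inv_into[OF \<rho>(3)] embD(2)[OF Q(1)]] .
  let ?f = "?\<rho>' \<circ> f2"
  have emb: "emb ?f M1 T" by (rule emb_comp[OF Q(2) QT])
  have agree: "?f x = f x" if x: "x \<in> carrier M0" for x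
  proof -
    have fx: "f x \<in> carrier N" using embD(4)[OF f] x by blast
    have xP: "x \<in> carrier P" using leD(4)[OF \<pi>(3)] x by blast
    have "?\<pi>' (f x) = x"
      using \<pi>(2)[OF x, symmetric] struct_isoD(3)[OF \<pi>(4)] xP by simp
    then have "\<rho> (f x) = x" using \<rho>(1)[OF fx] Q(3) x by (simp add: fixes_pointwise_def)
    moreover have "f x \<in> carrier T" using leD(4)[OF \<rho>(2)] fx by blast
    ultimately have "?\<rho>' x = f x"
      using struct_isoD(3)[OF \<rho>(3)] by (metis inv_into_f_f)
    then show ?thesis using Q(4) x by (simp add: fixes_pointwise_def)
  qed
  obtain N' where N': "N' \<in> K\<kappa>" "N \<preceq>\<^bsub>K\<^esub> N'" "N' \<preceq>\<^bsub>K\<^esub> T" "?f ` carrier M1 \<subseteq> carrier N'"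
    using submodel_containing[OF N \<rho>(2) embD(4)[OF emb] card_image[OF card_model[OF M(2)]]] by blast
  show ?thesis
    by (rule that[OF N'(1,2) emb_into[OF emb N'(3,4)] agree])
qed

end

text \<open>Proper initial segments have at most \<kappa> elements, so unions at limits stay in
  \<open>K\<kappa>\<close>. Instances are \<open>cardSuc \<kappa>\<close>, for filtrations, and
  \<kappa> itself, for building universal extensions.\<close>

locale aec_chain = aec_card K \<kappa> + index_order r
  for K :: "('a, 'f, 'r) aclass" and \<kappa> :: "'c rel" and r :: "'i rel" +
  assumes card_underS: "\<And>i. i \<in> Field r \<Longrightarrow> |underS i| \<le>o \<kappa>"
    and card_Field: "|Field r| \<le>o |UNIV :: 'a set|"
begin

lemma limit_union:
  assumes d: "limit_elem r d" and M: "\<And>i. i \<in> underS d \<Longrightarrow> M i \<in> K\<kappa>"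
    and inc: "\<And>i j. (i, j) \<in> r \<Longrightarrow> j \<in> underS d \<Longrightarrow> M i \<preceq>\<^bsub>K\<^esub> M j"
  shows "union_struct (M ` underS d) \<in> K\<kappa>"
    and "\<And>i. i \<in> underS d \<Longrightarrow> M i \<preceq>\<^bsub>K\<^esub> union_struct (M ` underS d)"
    and "\<And>N. (\<And>i. i \<in> underS d \<Longrightarrow> M i \<preceq>\<^bsub>K\<^esub> N) \<Longrightarrow> union_struct (M ` underS d) \<preceq>\<^bsub>K\<^esub> N"
    and "\<And>f N. (\<And>i. i \<in> underS d \<Longrightarrow> emb f (M i) N) \<Longrightarrow> emb f (union_struct (M ` underS d)) N"
proof -
  let ?U = "union_struct (M ` underS d)"
  have dF: "d \<in> Field r" and ne: "underS d \<noteq> {}"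
    and unb: "\<And>i. i \<in> underS d \<Longrightarrow> \<exists>j\<in>underS d. i \<in> underS j"
    using d by (auto simp: limit_elem_def)
  have sub: "underS d \<subseteq> Field r" using less_in by blast
  have "|underS d| \<le>o |UNIV :: 'a set|"
    using card_of_mono1[OF sub] card_Field ordLeq_transitive by blast
  note U = union_of_chain[OF WELL sub ne this unb, of M]
  show m: "M i \<preceq>\<^bsub>K\<^esub> ?U" if "i \<in> underS d" for i using U(2)[OF _ _ that] inc by blast
  show least: "?U \<preceq>\<^bsub>K\<^esub> N" if "\<And>i. i \<in> underS d \<Longrightarrow> M i \<preceq>\<^bsub>K\<^esub> N" for N
    using U(3)[OF _ _ that] inc by blast
  obtain i where i: "i \<in> underS d" using ne by blast
  show UK: "?U \<in> K\<kappa>"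
  proof (rule models_of_cardI)
    show "?U \<in> models K" using U(1) inc by blast
    have "|\<Union>i\<in>underS d. carrier (M i)| \<le>o \<kappa>"
      by (rule card_UN[OF card_underS[OF dF]]) (use M card_model in blast)
    then show "|carrier ?U| \<le>o \<kappa>" by simp
    show "\<kappa> \<le>o |carrier ?U|"
      using models_of_cardD(4)[OF M[OF i]] card_of_mono1[OF leD(4)[OF m[OF i]]] ordLeq_transitive by blast
  qed
  show "emb f ?U N" if "\<And>i. i \<in> underS d \<Longrightarrow> emb f (M i) N" for f N
  proof (rule emb_union[where I = "underS d" and M = M, OF infinite_UNIV small[OF card_model[OF UK]] _ ne])
    show "M i \<preceq>\<^bsub>K\<^esub> M j \<or> M j \<preceq>\<^bsub>K\<^esub> M i" if "i \<in> underS d" "j \<in> underS d" for i j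
      using that inc sub TOTALS by blast
  qed (use least that in auto)
qed

lemma total_union:
  assumes M: "\<And>i j. (i, j) \<in> r \<Longrightarrow> M i \<preceq>\<^bsub>K\<^esub> M j"
  shows "union_struct (M ` Field r) \<in> models K"
    and "\<And>i. i \<in> Field r \<Longrightarrow> M i \<preceq>\<^bsub>K\<^esub> union_struct (M ` Field r)"
    and "\<And>N. (\<And>i. i \<in> Field r \<Longrightarrow> M i \<preceq>\<^bsub>K\<^esub> N) \<Longrightarrow> union_struct (M ` Field r) \<preceq>\<^bsub>K\<^esub> N"
    and "\<And>f N. |carrier (union_struct (M ` Field r))| <o |UNIV :: 'a set| \<Longrightarrow>
      (\<And>i. i \<in> Field r \<Longrightarrow> emb f (M i) N) \<Longrightarrow> emb f (union_struct (M ` Field r)) N"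
proof -
  have ne: "Field r \<noteq> {}" and unb: "\<And>i. i \<in> Field r \<Longrightarrow> \<exists>j\<in>Field r. i \<in> underS j"
    using limit by (auto simp: limit_order_def)
  note U = union_of_chain[OF WELL subset_refl ne card_Field unb, of M]
  show "union_struct (M ` Field r) \<in> models K"
    and "\<And>i. i \<in> Field r \<Longrightarrow> M i \<preceq>\<^bsub>K\<^esub> union_struct (M ` Field r)"
    using U(1,2) M by blast+
  show least: "union_struct (M ` Field r) \<preceq>\<^bsub>K\<^esub> N" if "\<And>i. i \<in> Field r \<Longrightarrow> M i \<preceq>\<^bsub>K\<^esub> N" for N
    using U(3)[OF _ _ that] M by blast
  show "emb f (union_struct (M ` Field r)) N" if "|carrier (union_struct (M ` Field r))| <o |UNIV :: 'a set|"
    "\<And>i. i \<in> Field r \<Longrightarrow> emb f (M i) N" for f N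
  proof (rule emb_union[where I = "Field r" and M = M, OF infinite_UNIV that(1) _ ne])
    show "M i \<preceq>\<^bsub>K\<^esub> M j \<or> M j \<preceq>\<^bsub>K\<^esub> M i" if "i \<in> Field r" "j \<in> Field r" for i j
      using that M TOTALS by blast
  qed (use least that(2) in auto)
qed

definition continuous_chain :: "('i \<Rightarrow> ('a, 'f, 'r) struct) \<Rightarrow> bool" where
  "continuous_chain M \<longleftrightarrow> (\<forall>i\<in>Field r. M i \<in> K\<kappa>) \<and> (\<forall>i j. (i, j) \<in> r \<longrightarrow> M i \<preceq>\<^bsub>K\<^esub> M j) \<and>
    (\<forall>d. limit_elem r d \<longrightarrow> M d = union_struct (M ` underS d))"

lemma continuous_chainD:
  assumes "continuous_chain M"
  shows "\<And>i. i \<in> Field r \<Longrightarrow> M i \<in> K\<kappa>" "\<And>i j. (i, j) \<in> r \<Longrightarrow> M i \<preceq>\<^bsub>K\<^esub> M j"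
    "\<And>d. limit_elem r d \<Longrightarrow> M d = union_struct (M ` underS d)"
    "\<And>d. limit_elem r d \<Longrightarrow> carrier (M d) = (\<Union>i\<in>underS d. carrier (M i))"
  using assms by (auto simp: continuous_chain_def)

lemma model_chain:
  assumes M0: "M0 \<in> K\<kappa>" "P M0"
    and step: "\<And>i M. i \<in> Field r \<Longrightarrow> M \<in> K\<kappa> \<Longrightarrow> P M \<Longrightarrow> \<exists>M'\<in>K\<kappa>. M \<preceq>\<^bsub>K\<^esub> M' \<and> P M' \<and> St i M M'"
    and union: "\<And>d M. limit_elem r d \<Longrightarrow> (\<And>i. i \<in> underS d \<Longrightarrow> P (M i)) \<Longrightarrow>
      (\<And>N. (\<And>i. i \<in> underS d \<Longrightarrow> M i \<preceq>\<^bsub>K\<^esub> N) \<Longrightarrow> union_struct (M ` underS d) \<preceq>\<^bsub>K\<^esub> N) \<Longrightarrow>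
      P (union_struct (M ` underS d))"
  obtains M where "continuous_chain M" "M z = M0" "\<And>i. i \<in> Field r \<Longrightarrow> P (M i)"
    "\<And>i. i \<in> Field r \<Longrightarrow> St i (M i) (M (sc i))"
proof -
  let ?P = "\<lambda>i M. M \<in> K\<kappa> \<and> P M"
  \<comment> \<open>\<open>transfinite_chain\<close> requires reflexivity for every state, including
    structures outside the class, where \<preceq> fails; hence the disjunct with equality.\<close>
  let ?R = "\<lambda>i M N. M = N \<or> M \<preceq>\<^bsub>K\<^esub> N"
  obtain M where M: "M z = M0" "\<And>i. i \<in> Field r \<Longrightarrow> ?P i (M i)" "\<And>i j. (i, j) \<in> r \<Longrightarrow> ?R i (M i) (M j)"
    "\<And>i. i \<in> Field r \<Longrightarrow> St i (M i) (M (sc i))"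
    "\<And>d. limit_elem r d \<Longrightarrow> M d = union_struct (M ` underS d)"
  proof (rule transfinite_chain[where P = ?P and R = ?R and St = St and Lim = "\<lambda>d M. union_struct (M ` underS d)"])
    show "?P z M0" using M0 by simp
    show "\<exists>M'. ?R i M M' \<and> ?P (sc i) M' \<and> St i M M'" if "i \<in> Field r" "?P i M" for i M
      using step[of i M] that by blast
    show "union_struct (g ` underS d) = union_struct (g' ` underS d)" if "\<And>i. i \<in> underS d \<Longrightarrow> g i = g' i" for d g g'
      using that by (metis image_cong)
    show "?P d (union_struct (g ` underS d)) \<and> (\<forall>i\<in>underS d. ?R i (g i) (union_struct (g ` underS d)))"
      if d: "limit_elem r d" and P: "\<And>i. i \<in> underS d \<Longrightarrow> ?P i (g i)"
        and inc: "\<And>i j. (i, j) \<in> r \<Longrightarrow> j \<in> underS d \<Longrightarrow> ?R i (g i) (g j)" for d g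
    proof -
      have inc': "g i \<preceq>\<^bsub>K\<^esub> g j" if "(i, j) \<in> r" "j \<in> underS d" for i j
        using inc[OF that] P[OF that(2)] le_refl model_in_models by auto
      have gK: "g i \<in> K\<kappa>" if "i \<in> underS d" for i using P[OF that] by simp
      have U: "union_struct (g ` underS d) \<in> K\<kappa>"
        "\<And>i. i \<in> underS d \<Longrightarrow> g i \<preceq>\<^bsub>K\<^esub> union_struct (g ` underS d)"
        "\<And>N. (\<And>i. i \<in> underS d \<Longrightarrow> g i \<preceq>\<^bsub>K\<^esub> N) \<Longrightarrow> union_struct (g ` underS d) \<preceq>\<^bsub>K\<^esub> N"
        using limit_union(1-3)[OF d, of g] gK inc' by simp_all
      have "P (union_struct (g ` underS d))"
        by (rule union[OF d]) (use P U(3) in auto)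
      then show ?thesis using U(1,2) by blast
    qed
  qed (auto intro: le_trans)
  moreover have "continuous_chain M"
    unfolding continuous_chain_def using M le_refl model_in_models le_in(1) by metis
  ultimately show ?thesis using that by blast
qed

text \<open>A stage determines its map only on \<open>M i\<close>, so successive maps are compared
  there alone and \<open>Q\<close> must not depend on other values. This is what allows the maps of
  earlier stages to be glued at limits.\<close>

lemma embedding_chain:
  assumes M: "continuous_chain M" and N0: "N0 \<in> K\<kappa>" "emb f0 (M z) N0" "Q z f0 N0"
    and step: "\<And>i f N. i \<in> Field r \<Longrightarrow> N \<in> K\<kappa> \<Longrightarrow> emb f (M i) N \<Longrightarrow> Q i f N \<Longrightarrow>
      \<exists>f' N'. N' \<in> K\<kappa> \<and> N \<preceq>\<^bsub>K\<^esub> N' \<and> emb f' (M (sc i)) N' \<and> (\<forall>x\<in>carrier (M i). f' x = f x) \<and> Q (sc i) f' N'"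
    and limit: "\<And>d f N. limit_elem r d \<Longrightarrow> emb f (M d) (union_struct (N ` underS d)) \<Longrightarrow>
      (\<And>i. i \<in> underS d \<Longrightarrow> Q i f (N i)) \<Longrightarrow>
      (\<And>B. (\<And>i. i \<in> underS d \<Longrightarrow> N i \<preceq>\<^bsub>K\<^esub> B) \<Longrightarrow> union_struct (N ` underS d) \<preceq>\<^bsub>K\<^esub> B) \<Longrightarrow>
      Q d f (union_struct (N ` underS d))"
    and cong: "\<And>i f g N. (\<And>x. x \<in> carrier (M i) \<Longrightarrow> f x = g x) \<Longrightarrow> Q i f N \<Longrightarrow> Q i g N"
  obtains f N where "N z = N0" "\<And>x. x \<in> carrier (M z) \<Longrightarrow> f x = f0 x"
    "\<And>i. i \<in> Field r \<Longrightarrow> N i \<in> K\<kappa> \<and> emb f (M i) (N i) \<and> Q i f (N i)"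
    "\<And>i j. (i, j) \<in> r \<Longrightarrow> N i \<preceq>\<^bsub>K\<^esub> N j"
proof -
  note MD = continuous_chainD[OF M]
  let ?P = "\<lambda>i (f, N). N \<in> K\<kappa> \<and> emb f (M i) N \<and> Q i f N"
  let ?R = "\<lambda>i (f, N) (f', N'). (\<forall>x\<in>carrier (M i). f' x = f x) \<and> (N = N' \<or> N \<preceq>\<^bsub>K\<^esub> N')"
  \<comment> \<open>The value at \<open>x\<close> is read off at some stage whose model contains
    \<open>x\<close>; coherence makes the choice of stage immaterial.\<close>
  define glue where "glue I g x = (if \<exists>i\<in>I. x \<in> carrier (M i)
    then fst (g (SOME i. i \<in> I \<and> x \<in> carrier (M i))) x else x)"
    for I and g :: "'i \<Rightarrow> ('a \<Rightarrow> 'a) \<times> ('a, 'f, 'r) struct" and x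
  have glue: "glue I g x = fst (g i) x"
    if I: "I \<subseteq> Field r" and i: "i \<in> I" "x \<in> carrier (M i)"
      and inc: "\<And>i j. (i, j) \<in> r \<Longrightarrow> j \<in> I \<Longrightarrow> \<forall>x\<in>carrier (M i). fst (g j) x = fst (g i) x"
    for I g x i
  proof -
    let ?j = "SOME i. i \<in> I \<and> x \<in> carrier (M i)"
    have j: "?j \<in> I \<and> x \<in> carrier (M ?j)" 
      by (rule someI[where P = "\<lambda>i. i \<in> I \<and> x \<in> carrier (M i)" and x = i]) (simp add: i)
    have "(i, ?j) \<in> r \<or> (?j, i) \<in> r" using I i(1) j TOTALS by blast
    then have "fst (g ?j) x = fst (g i) x"
    proof
      assume "(i, ?j) \<in> r"
      from inc[OF this conjunct1[OF j]] i(2) show ?thesis by simp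
    next
      assume "(?j, i) \<in> r"
      from inc[OF this i(1)] conjunct2[OF j] show ?thesis by simp
    qed
    then show ?thesis using i unfolding glue_def by auto
  qed
  let ?Lim = "\<lambda>d g. (glue (underS d) g, union_struct ((snd \<circ> g) ` underS d))"
  obtain g where g: "g z = (f0, N0)" "\<And>i. i \<in> Field r \<Longrightarrow> ?P i (g i)" "\<And>i j. (i, j) \<in> r \<Longrightarrow> ?R i (g i) (g j)"
  proof (rule transfinite_chain[where P = ?P and R = ?R and St = "\<lambda>_ _ _. True" and Lim = ?Lim])
    show "?P z (f0, N0)" using N0 by simp
    show "\<exists>s'. ?R i s s' \<and> ?P (sc i) s' \<and> True" if "i \<in> Field r" "?P i s" for i s
      using step[of i "snd s" "fst s"] that by (auto simp: case_prod_beta)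
    show "?R i s u" if "(i, j) \<in> r" "?R i s t" "?R j t u" for i j s t u
      using that leD(4)[OF MD(2)[OF that(1)]] by (auto simp: case_prod_beta subset_iff intro: le_trans)
    show "?Lim d g = ?Lim d g'" if eq: "\<And>i. i \<in> underS d \<Longrightarrow> g i = g' i" for d g g'
    proof -
      have "glue (underS d) g x = glue (underS d) g' x" for x
      proof (cases "\<exists>i\<in>underS d. x \<in> carrier (M i)")
        case True
        then have "(SOME i. i \<in> underS d \<and> x \<in> carrier (M i)) \<in> underS d"
          by (metis (mono_tags, lifting) someI_ex)
        from eq[OF this] show ?thesis unfolding glue_def by simp
      qed (auto simp: glue_def)
      moreover have "(snd \<circ> g) ` underS d = (snd \<circ> g') ` underS d" using eq by (auto intro!: image_cong)
      ultimately show ?thesis by auto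
    qed
    show "?P d (?Lim d g) \<and> (\<forall>i\<in>underS d. ?R i (g i) (?Lim d g))"
      if d: "limit_elem r d" and P: "\<And>i. i \<in> underS d \<Longrightarrow> ?P i (g i)"
        and inc: "\<And>i j. (i, j) \<in> r \<Longrightarrow> j \<in> underS d \<Longrightarrow> ?R i (g i) (g j)" for d g
    proof -
      let ?f = "glue (underS d) g" and ?N = "snd \<circ> g"
      have sub: "underS d \<subseteq> Field r" using less_in by blast
      have agree: "?f x = fst (g i) x" if "i \<in> underS d" "x \<in> carrier (M i)" for i x
        by (rule glue[OF sub that]) (use inc in \<open>auto simp: case_prod_beta\<close>)
      have NK: "?N i \<in> K\<kappa>" if "i \<in> underS d" for i using P[OF that] by (simp add: case_prod_beta)
      have inc': "?N i \<preceq>\<^bsub>K\<^esub> ?N j" if "(i, j) \<in> r" "j \<in> underS d" for i j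
        using inc[OF that] NK[OF that(2)] le_refl model_in_models by (auto simp: case_prod_beta)
      have U: "union_struct (?N ` underS d) \<in> K\<kappa>"
        "\<And>i. i \<in> underS d \<Longrightarrow> ?N i \<preceq>\<^bsub>K\<^esub> union_struct (?N ` underS d)"
        "\<And>N. (\<And>i. i \<in> underS d \<Longrightarrow> ?N i \<preceq>\<^bsub>K\<^esub> N) \<Longrightarrow> union_struct (?N ` underS d) \<preceq>\<^bsub>K\<^esub> N"
        using limit_union(1-3)[OF d, of ?N] NK inc' by simp_all
      have "emb ?f (M i) (union_struct (?N ` underS d))" if "i \<in> underS d" for i
        by (rule emb_cong[OF emb_le[OF _ U(2)[OF that]], of "fst (g i)"])
          (use P[OF that] agree that in \<open>auto simp: case_prod_beta\<close>)
      then have emb: "emb ?f (M d) (union_struct (?N ` underS d))"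
        using limit_union(4)[OF d, of M] MD(1,2) less_in(1) unfolding MD(3)[OF d] by simp
      have "Q d ?f (union_struct (?N ` underS d))"
      proof (rule limit[OF d emb])
        show "Q i ?f (?N i)" if "i \<in> underS d" for i
          by (rule cong[of _ "fst (g i)"]) (use P[OF that] agree that in \<open>auto simp: case_prod_beta\<close>)
      qed (use U(3) in blast)
      then show ?thesis using U(1,2) emb agree by (auto simp: case_prod_beta)
    qed
  qed (auto simp: case_prod_beta)
  let ?f = "glue (Field r) g" and ?N = "snd \<circ> g"
  have agree: "?f x = fst (g i) x" if "i \<in> Field r" "x \<in> carrier (M i)" for i x
    by (rule glue[OF subset_refl that]) (use g(3) in \<open>auto simp: case_prod_beta\<close>)
  show ?thesis
  proof (rule that[of ?N ?f])
    show "?N z = N0" using g(1) by simp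
    show "\<And>x. x \<in> carrier (M z) \<Longrightarrow> ?f x = f0 x" using agree[OF z_in] g(1) by simp
    show "?N i \<in> K\<kappa> \<and> emb ?f (M i) (?N i) \<and> Q i ?f (?N i)" if i: "i \<in> Field r" for i
      using g(2)[OF i] agree[OF i] emb_cong[of "fst (g i)" "M i" "?N i" ?f] cong[of i "fst (g i)" ?f "?N i"]
      by (auto simp: case_prod_beta)
    show "?N i \<preceq>\<^bsub>K\<^esub> ?N j" if "(i, j) \<in> r" for i j
      using g(3)[OF that] g(2)[OF le_in(2)[OF that]] le_refl model_in_models by (auto simp: case_prod_beta)
  qed
qed

text \<open>The target \<open>B\<close> may be larger than \<kappa>, while
  \<open>embedding_chain\<close> needs targets in \<open>K\<kappa>\<close>. The chain is therefore
  run through submodels of \<open>B\<close> of size \<kappa> that contain the images obtained so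
  far.\<close>

lemma embedding_chain_into:
  assumes M: "continuous_chain M" and f0: "emb f0 (M z) B" "Q z f0"
    and step: "\<And>i f. i \<in> Field r \<Longrightarrow> emb f (M i) B \<Longrightarrow> Q i f \<Longrightarrow>
      \<exists>f'. emb f' (M (sc i)) B \<and> (\<forall>x\<in>carrier (M i). f' x = f x) \<and> Q (sc i) f'"
    and limit: "\<And>d f. limit_elem r d \<Longrightarrow> emb f (M d) B \<Longrightarrow> (\<And>i. i \<in> underS d \<Longrightarrow> Q i f) \<Longrightarrow> Q d f"
    and cong: "\<And>i f g. (\<And>x. x \<in> carrier (M i) \<Longrightarrow> f x = g x) \<Longrightarrow> Q i f \<Longrightarrow> Q i g"
  obtains f where "\<And>x. x \<in> carrier (M z) \<Longrightarrow> f x = f0 x" "\<And>i. i \<in> Field r \<Longrightarrow> emb f (M i) B \<and> Q i f"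
proof -
  note MD = continuous_chainD[OF M]
  obtain M' where M': "struct_iso (voc K) f0 (M z) M'" "M' \<preceq>\<^bsub>K\<^esub> B" using f0(1) by (rule embE)
  have "|carrier (M z)| =o |carrier M'|" using struct_isoD(5)[OF M'(1)] card_of_ordIso by blast
  then have M'K: "M' \<in> K\<kappa>"
    using leD(1)[OF M'(2)] models_of_cardD(2)[OF MD(1)[OF z_in]] ordIso_symmetric ordIso_transitive
    unfolding models_of_card_def by blast
  have e0: "emb f0 (M z) M'" using embI[OF M'(1)] le_refl leD(1)[OF M'(2)] by blast
  let ?Q = "\<lambda>i f N. N \<preceq>\<^bsub>K\<^esub> B \<and> Q i f"
  obtain f N where "\<And>x. x \<in> carrier (M z) \<Longrightarrow> f x = f0 x"
    "\<And>i. i \<in> Field r \<Longrightarrow> N i \<in> K\<kappa> \<and> emb f (M i) (N i) \<and> ?Q i f (N i)"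
  proof (rule embedding_chain[OF M M'K e0, of ?Q])
    show "M' \<preceq>\<^bsub>K\<^esub> B \<and> Q z f0" using M' f0 by simp
    show "\<exists>f' N'. N' \<in> K\<kappa> \<and> N \<preceq>\<^bsub>K\<^esub> N' \<and> emb f' (M (sc i)) N' \<and> (\<forall>x\<in>carrier (M i). f' x = f x) \<and> ?Q (sc i) f' N'"
      if i: "i \<in> Field r" and N: "N \<in> K\<kappa>" "emb f (M i) N" "?Q i f N" for i f N
    proof -
      obtain f' where f': "emb f' (M (sc i)) B" "\<forall>x\<in>carrier (M i). f' x = f x" "Q (sc i) f'"
        using step[OF i emb_le[OF N(2)]] N(3) by blast
      obtain N' where N': "N' \<in> K\<kappa>" "N \<preceq>\<^bsub>K\<^esub> N'" "N' \<preceq>\<^bsub>K\<^esub> B" "f' ` carrier (M (sc i)) \<subseteq> carrier N'"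
        using submodel_containing[OF N(1) conjunct1[OF N(3)] embD(4)[OF f'(1)]]
          card_image[OF card_model[OF MD(1)[OF sc_in[OF i]]]] by blast
      then show ?thesis using f' emb_into[OF f'(1)] by blast
    qed
    show "?Q d f (union_struct (N ` underS d))"
      if "limit_elem r d" "emb f (M d) (union_struct (N ` underS d))" "\<And>i. i \<in> underS d \<Longrightarrow> ?Q i f (N i)"
        "\<And>B. (\<And>i. i \<in> underS d \<Longrightarrow> N i \<preceq>\<^bsub>K\<^esub> B) \<Longrightarrow> union_struct (N ` underS d) \<preceq>\<^bsub>K\<^esub> B" for d f N
      using that limit[OF that(1) emb_le[OF that(2)]] by blast
    show "?Q i g N" if "\<And>x. x \<in> carrier (M i) \<Longrightarrow> f x = g x" "?Q i f N" for i f g N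
      using that cong by blast
  qed blast
  then show ?thesis using that emb_le by blast
qed

end

context aec_card begin

lemma aec_chain_cardSuc: "aec_chain K \<kappa> (cardSuc \<kappa>)"
proof unfold_locales
  show "limit_order (cardSuc \<kappa>)"
    using limit_order_infinite_Card_order cardSuc_Card_order[OF card] cardSuc_finite[OF card] infinite_Field by blast
  show "\<And>i. i \<in> Field (cardSuc \<kappa>) \<Longrightarrow> |underS (cardSuc \<kappa>) i| \<le>o \<kappa>"
    by (rule card_of_underS_cardSuc[OF card])
  show "|Field (cardSuc \<kappa>)| \<le>o |UNIV :: 'a set|"
    using universe card_of_Field_ordIso[OF cardSuc_Card_order[OF card]] ordIso_ordLeq_trans by blast
qed

lemma aec_chain_self: "aec_chain K \<kappa> \<kappa>"
proof unfold_locales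
  show "limit_order \<kappa>" by (rule limit_order_infinite_Card_order[OF card infinite_Field])
  show "\<And>i. i \<in> Field \<kappa> \<Longrightarrow> |underS \<kappa> i| \<le>o \<kappa>" by (rule card_of_underS_le_Card_order[OF card])
  show "|Field \<kappa>| \<le>o |UNIV :: 'a set|"
    using card_of_Field_ordIso[OF card] \<kappa>_less_UNIV ordIso_ordLeq_trans ordLess_imp_ordLeq by blast
qed

text \<open>A strictly increasing continuous chain of length \<open>\<kappa>\<^sup>+\<close> adds a
  new element \<open>e i\<close> at every step, so its union is large enough; it is a union of
  \<open>\<kappa>\<^sup>+\<close> sets of size at most \<kappa>, so it is not too large.\<close>

lemma model_of_cardSuc:
  assumes "K\<kappa> \<noteq> {}" "no_maximal_model_in K \<kappa>"
  shows "\<exists>M\<in>models K. |carrier M| =o cardSuc \<kappa>"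
proof -
  interpret aec_chain K \<kappa> "cardSuc \<kappa>" by (rule aec_chain_cardSuc)
  obtain M0 where M0: "M0 \<in> K\<kappa>" using assms(1) by blast
  obtain M where M: "continuous_chain M" "\<And>i. i \<in> Field (cardSuc \<kappa>) \<Longrightarrow> M i \<noteq> M (sc i)"
    by (rule model_chain[OF M0, of "\<lambda>_. True" "\<lambda>_ M N. M \<noteq> N"])
      (use assms(2) in \<open>auto simp: no_maximal_model_in_def\<close>)
  note MD = continuous_chainD[OF M(1)]
  let ?U = "union_struct (M ` Field (cardSuc \<kappa>))"
  have "\<exists>x. x \<in> carrier (M (sc i)) - carrier (M i)" if "i \<in> Field (cardSuc \<kappa>)" for i
    using M(2)[OF that] le_carrier_eqI[OF MD(2)[OF less_le[OF sc_greater[OF that]]]] by blast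
  then obtain e where e: "\<And>i. i \<in> Field (cardSuc \<kappa>) \<Longrightarrow> e i \<in> carrier (M (sc i)) - carrier (M i)" by metis
  have ne: "e i \<noteq> e j" if "i \<in> underS j" for i j
    using leD(4)[OF MD(2)[OF sc_le[OF that]]] e[OF less_in(1)[OF that]] e[OF less_in(2)[OF that]] by auto
  have "inj_on e (Field (cardSuc \<kappa>))"
  proof (rule inj_onI)
    fix i j assume "i \<in> Field (cardSuc \<kappa>)" "j \<in> Field (cardSuc \<kappa>)" "e i = e j"
    then show "i = j" using ne TOTALS by (metis le_cases)
  qed
  moreover have "e ` Field (cardSuc \<kappa>) \<subseteq> carrier ?U" using e sc_in by auto
  ultimately have "|Field (cardSuc \<kappa>)| \<le>o |carrier ?U|" unfolding card_of_ordLeq[symmetric] by blast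
  then have ge: "cardSuc \<kappa> \<le>o |carrier ?U|"
    using card_of_Field_ordIso[OF cardSuc_Card_order[OF card]] ordIso_symmetric ordIso_ordLeq_trans by blast
  have "|\<Union>i\<in>Field (cardSuc \<kappa>). carrier (M i)| \<le>o cardSuc \<kappa>"
  proof (rule card_of_UNION_ordLeq_infinite_Field)
    show "infinite (Field (cardSuc \<kappa>))" using cardSuc_finite[OF card] infinite_Field by blast
    show "Card_order (cardSuc \<kappa>)" by (rule cardSuc_Card_order[OF card])
    then show "|Field (cardSuc \<kappa>)| \<le>o cardSuc \<kappa>" using card_of_Field_ordIso ordIso_imp_ordLeq by blast
    show "\<forall>i\<in>Field (cardSuc \<kappa>). |carrier (M i)| \<le>o cardSuc \<kappa>"
      using MD(1) card_model cardSuc_ordLeq[OF card] ordLeq_transitive by blast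
  qed
  then have "|carrier ?U| \<le>o cardSuc \<kappa>" by simp
  then have "|carrier ?U| =o cardSuc \<kappa>" using ge by (simp add: ordIso_iff_ordLeq)
  then show ?thesis using total_union(1)[of M] MD(2) by blast
qed

end

section \<open>Maximal models of successor cardinality\<close>

text \<open>
  A maximal model \<open>B\<close> of cardinality \<open>\<kappa>\<^sup>+\<close> behaves like a monster model: embeddings of its submodels of
  cardinality \<open>\<kappa>\<close> extend to automorphisms, and types are orbits.
\<close>

locale maximal_model = aec_card K \<kappa> for K :: "('a, 'f, 'r) aclass" and \<kappa> :: "'c rel" +
  fixes B :: "('a, 'f, 'r) struct"
  assumes universe2: "cardSuc (cardSuc \<kappa>) \<le>o |UNIV :: 'a set|"
    and amalgamation: "amalgamation_in K \<kappa>"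
    and B: "B \<in> models_of_card K (cardSuc \<kappa>)"
    and maximal: "\<And>N. N \<in> models_of_card K (cardSuc \<kappa>) \<Longrightarrow> B \<preceq>\<^bsub>K\<^esub> N \<Longrightarrow> N = B"
begin

text \<open>The same theory one cardinal higher: \<open>B\<close> now counts as small, so
  \<open>B\<close> itself can be renamed, and models above \<open>B\<close> have submodels of size
  \<open>\<kappa>\<^sup>+\<close> containing \<open>B\<close>.\<close>

sublocale plus: aec_card K "cardSuc \<kappa>"
proof unfold_locales
  show "Card_order (cardSuc \<kappa>)" by (rule cardSuc_Card_order[OF card])
  show "LS K \<le>o cardSuc \<kappa>" using LS_le cardSuc_ordLeq[OF card] ordLeq_transitive by blast
qed (rule universe2)

sublocale aec_chain K \<kappa> "cardSuc \<kappa>"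
  by (rule aec_chain_cardSuc)

sublocale low: aec_chain K \<kappa> \<kappa>
  by (rule aec_chain_self)

section \<open>Extending embeddings to automorphisms of the maximal model\<close>

lemma B_model: "B \<in> models K"
  by (rule models_of_cardD(1)[OF B])

lemma small_B: "|carrier B| <o |UNIV :: 'a set|"
  by (rule plus.small[OF models_of_cardD(3)[OF B]])

text \<open>This is the form in which maximality is used. After renaming, \<open>B\<close> lies
  below a copy \<open>P\<close> of \<open>N\<close>, and any point of \<open>P\<close> belongs to a
  model of size \<open>\<kappa>\<^sup>+\<close> above \<open>B\<close>, hence to \<open>B\<close>.
  The size of \<open>N\<close> is arbitrary.\<close>

lemma emb_B_onto:
  assumes f: "emb f B N"
  shows "carrier N = f ` carrier B"
proof -
  obtain \<pi> P where \<pi>: "\<And>x. x \<in> carrier B \<Longrightarrow> \<pi> x = f x" "B \<preceq>\<^bsub>K\<^esub> P" "struct_iso (voc K) \<pi> P N"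
    using emb_extends_to_iso[OF infinite_UNIV small_B f] by blast
  have "x \<in> carrier B" if x: "x \<in> carrier P" for x
  proof -
    obtain N' where "N' \<in> models_of_card K (cardSuc \<kappa>)" "B \<preceq>\<^bsub>K\<^esub> N'" "x \<in> carrier N'"
      by (rule plus.submodel_containing_element[OF B \<pi>(2) x])
    then show ?thesis using maximal by blast
  qed
  then have "carrier P = carrier B" using leD(4)[OF \<pi>(2)] by blast
  then show ?thesis using struct_isoD(4)[OF \<pi>(3)] \<pi>(1) by simp
qed

text \<open>\<open>B\<close> is enumerated along \<open>\<kappa>\<^sup>+\<close> and step
  \<open>i\<close> absorbs the \<open>i\<close>-th element, which makes the union all of
  \<open>B\<close>. Monotonicity of \<open>U\<close> allows this enlargement after \<open>U\<close>
  has been achieved.\<close>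

lemma filtration:
  assumes M0: "M0 \<in> K\<kappa>" "M0 \<preceq>\<^bsub>K\<^esub> B"
    and ext: "\<And>M. M \<in> K\<kappa> \<Longrightarrow> M \<preceq>\<^bsub>K\<^esub> B \<Longrightarrow> \<exists>M'\<in>K\<kappa>. M \<preceq>\<^bsub>K\<^esub> M' \<and> M' \<preceq>\<^bsub>K\<^esub> B \<and> U M M'"
    and mono: "\<And>M M' M''. M \<in> K\<kappa> \<Longrightarrow> M'' \<in> K\<kappa> \<Longrightarrow> U M M' \<Longrightarrow> M' \<preceq>\<^bsub>K\<^esub> M'' \<Longrightarrow> U M M''"
  obtains M where "continuous_chain M" "M z = M0" "\<And>i. i \<in> Field (cardSuc \<kappa>) \<Longrightarrow> M i \<preceq>\<^bsub>K\<^esub> B"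
    "\<And>i. i \<in> Field (cardSuc \<kappa>) \<Longrightarrow> U (M i) (M (sc i))" "B = union_struct (M ` Field (cardSuc \<kappa>))"
proof -
  let ?r = "cardSuc \<kappa>"
  have "|Field ?r| =o |carrier B|"
    using card_of_Field_ordIso[OF plus.card] models_of_cardD(2)[OF B] ordIso_symmetric ordIso_transitive by blast
  then obtain e where "bij_betw e (Field ?r) (carrier B)" unfolding card_of_ordIso[symmetric] by blast
  then have e: "e ` Field ?r = carrier B" by (simp add: bij_betw_def)
  obtain M where M: "continuous_chain M" "M z = M0" "\<And>i. i \<in> Field ?r \<Longrightarrow> M i \<preceq>\<^bsub>K\<^esub> B"
    "\<And>i. i \<in> Field ?r \<Longrightarrow> U (M i) (M (sc i)) \<and> e i \<in> carrier (M (sc i))"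
  proof (rule model_chain[of M0 "\<lambda>M. M \<preceq>\<^bsub>K\<^esub> B" "\<lambda>i M M'. U M M' \<and> e i \<in> carrier M'"])
    show "\<exists>M'\<in>K\<kappa>. M \<preceq>\<^bsub>K\<^esub> M' \<and> M' \<preceq>\<^bsub>K\<^esub> B \<and> U M M' \<and> e i \<in> carrier M'"
      if i: "i \<in> Field ?r" and M: "M \<in> K\<kappa>" "M \<preceq>\<^bsub>K\<^esub> B" for i M
    proof -
      obtain M1 where M1: "M1 \<in> K\<kappa>" "M \<preceq>\<^bsub>K\<^esub> M1" "M1 \<preceq>\<^bsub>K\<^esub> B" "U M M1" using ext[OF M] by blast
      have "e i \<in> carrier B" using e i by blast
      then obtain M2 where M2: "M2 \<in> K\<kappa>" "M1 \<preceq>\<^bsub>K\<^esub> M2" "M2 \<preceq>\<^bsub>K\<^esub> B" "e i \<in> carrier M2"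
        by (rule submodel_containing_element[OF M1(1,3)])
      have "U M M2" by (rule mono[OF M(1) M2(1) M1(4) M2(2)])
      then show ?thesis using M2 le_trans[OF M1(2) M2(2)] by blast
    qed
  qed (use M0 in simp_all)
  let ?U = "union_struct (M ` Field ?r)"
  have "?U \<preceq>\<^bsub>K\<^esub> B"
    by (rule total_union(3)) (use M(3) continuous_chainD(2)[OF M(1)] in blast)+
  moreover have "carrier B \<subseteq> carrier ?U"
    unfolding e[symmetric] using M(4) sc_in by fastforce
  ultimately have "?U = B" by (rule le_carrier_eqI)
  then show ?thesis using that M by blast
qed

text \<open>\<open>B\<close> is too large for the amalgamation hypothesis, so \<open>N0\<close> is
  amalgamated with the pieces of a filtration of \<open>B\<close> one after another. The resulting
  embedding of \<open>B\<close> into a model above \<open>N0\<close> is onto, and its inverse is the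
  desired map.\<close>

lemma homogeneous:
  assumes M0: "M0 \<in> K\<kappa>" "M0 \<preceq>\<^bsub>K\<^esub> B" and N0: "N0 \<in> K\<kappa>" "M0 \<preceq>\<^bsub>K\<^esub> N0"
  obtains g where "emb g N0 B" "fixes_pointwise g M0"
proof -
  obtain M where M: "continuous_chain M" "M z = M0" "B = union_struct (M ` Field (cardSuc \<kappa>))"
    by (rule filtration[OF M0, of "\<lambda>_ _. True"]) (use le_refl model_in_models in blast)+
  note MD = continuous_chainD[OF M(1)]
  have e0: "emb id (M z) N0" using M(2) N0 by (simp add: emb_id_iff)
  obtain f N where fN: "N z = N0" "\<And>x. x \<in> carrier (M z) \<Longrightarrow> f x = id x"
    "\<And>i. i \<in> Field (cardSuc \<kappa>) \<Longrightarrow> N i \<in> K\<kappa> \<and> emb f (M i) (N i) \<and> True"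
    "\<And>i j. (i, j) \<in> cardSuc \<kappa> \<Longrightarrow> N i \<preceq>\<^bsub>K\<^esub> N j"
  proof (rule embedding_chain[OF M(1) N0(1) e0, of "\<lambda>_ _ _. True"])
    fix i f N assume *: "i \<in> Field (cardSuc \<kappa>)" "N \<in> K\<kappa>" "emb f (M i) N"
    have "M i \<preceq>\<^bsub>K\<^esub> M (sc i)" using MD(2) less_le sc_greater *(1) by blast
    from embedding_amalgamation[OF amalgamation MD(1)[OF *(1)] MD(1)[OF sc_in[OF *(1)]] this *(2,3)]
    show "\<exists>f' N'. N' \<in> K\<kappa> \<and> N \<preceq>\<^bsub>K\<^esub> N' \<and> emb f' (M (sc i)) N' \<and> (\<forall>x\<in>carrier (M i). f' x = f x) \<and> True"
      by metis
  qed auto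
  let ?T = "union_struct (N ` Field (cardSuc \<kappa>))"
  have NT: "N i \<preceq>\<^bsub>K\<^esub> ?T" if "i \<in> Field (cardSuc \<kappa>)" for i
    by (rule total_union(2)[OF fN(4) that])
  have "emb f (union_struct (M ` Field (cardSuc \<kappa>))) ?T"
  proof (rule total_union(4))
    show "|carrier (union_struct (M ` Field (cardSuc \<kappa>)))| <o |UNIV :: 'a set|" using small_B M(3) by simp
    show "emb f (M i) ?T" if "i \<in> Field (cardSuc \<kappa>)" for i
      using fN(3)[OF that] emb_le NT[OF that] by blast
  qed (rule MD(2))
  then have f: "emb f B ?T" using M(3) by simp
  have N0T: "N0 \<preceq>\<^bsub>K\<^esub> ?T" using NT[OF z_in] fN(1) by simp
  have "emb (inv_into (carrier B) f) N0 B"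
    by (rule emb_inv_into[OF f N0T]) (use leD(4)[OF N0T] emb_B_onto[OF f] in simp)
  moreover have "fixes_pointwise (inv_into (carrier B) f) M0"
    unfolding fixes_pointwise_def
  proof
    fix x assume x: "x \<in> carrier M0"
    then have "f x = x" "x \<in> carrier B" using fN(2) M(2) leD(4)[OF M0(2)] by auto
    then show "inv_into (carrier B) f x = x" using embD(3)[OF f] by (metis inv_into_f_f)
  qed
  ultimately show ?thesis by (rule that)
qed

text \<open>Bijectivity on the whole universe makes \<open>inv\<close> a two-sided inverse without
  side conditions on carriers, and it is the form of map required by \<open>map_gtp\<close>.\<close>

definition aut :: "('a \<Rightarrow> 'a) \<Rightarrow> bool" where
  "aut \<sigma> \<longleftrightarrow> bij \<sigma> \<and> struct_iso (voc K) \<sigma> B B"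

lemma aut_id: "aut id"
  using struct_iso_id model_is_struct[OF B_model] by (simp add: aut_def)

lemma aut_comp: "aut \<sigma> \<Longrightarrow> aut \<tau> \<Longrightarrow> aut (\<sigma> \<circ> \<tau>)"
  unfolding aut_def using struct_iso_comp bij_comp by blast

lemma aut_inv: "aut \<sigma> \<Longrightarrow> aut (inv \<sigma>)"
  unfolding aut_def using struct_iso_bij_inv bij_imp_bij_inv by blast

lemma aut_inv_simps: "aut \<sigma> \<Longrightarrow> inv \<sigma> (\<sigma> x) = x" "aut \<sigma> \<Longrightarrow> \<sigma> (inv \<sigma> x) = x"
  by (simp_all add: aut_def bij_is_inj bij_is_surj surj_f_inv_f)

lemma aut_in_B: "aut \<sigma> \<Longrightarrow> \<sigma> x \<in> carrier B \<longleftrightarrow> x \<in> carrier B"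
proof -
  assume s: "aut \<sigma>"
  have "\<sigma> x \<in> carrier B" if "aut \<sigma>" "x \<in> carrier B" for \<sigma> x
    using that struct_isoD(4)[of "voc K" \<sigma> B B] by (auto simp: aut_def)
  from this[OF s] this[OF aut_inv[OF s], of "\<sigma> x"] show ?thesis
    using aut_inv_simps[OF s] by auto
qed

lemma aut_emb_B: "aut \<sigma> \<Longrightarrow> emb \<sigma> B B"
  using emb_iso B_model by (simp add: aut_def)

lemma aut_emb_le: "aut \<sigma> \<Longrightarrow> N \<preceq>\<^bsub>K\<^esub> B \<Longrightarrow> emb \<sigma> N B"
  using emb_restrict aut_emb_B by blast

lemma iso_in_K\<kappa>:
  assumes "struct_iso (voc K) h N N'" "N \<in> K\<kappa>"
  shows "N' \<in> K\<kappa>"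
proof -
  have "|carrier N| =o |carrier N'|" using struct_isoD(5)[OF assms(1)] card_of_ordIso by blast
  then have "|carrier N'| =o \<kappa>"
    using models_of_cardD(2)[OF assms(2)] ordIso_symmetric ordIso_transitive by blast
  then show ?thesis using iso_model[OF model_in_models[OF assms(2)] assms(1)] by (simp add: models_of_card_def)
qed

text \<open>Amalgamation over the image of \<open>M0\<close> yields an extension of size \<kappa>,
  possibly outside \<open>B\<close>; homogeneity brings it back into \<open>B\<close> without moving
  that image.\<close>

lemma extend_step:
  assumes M: "M0 \<in> K\<kappa>" "M1 \<in> K\<kappa>" "M0 \<preceq>\<^bsub>K\<^esub> M1" and f: "emb f M0 B"
  obtains f' where "emb f' M1 B" "\<And>x. x \<in> carrier M0 \<Longrightarrow> f' x = f x"
proof -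
  obtain M' where M': "struct_iso (voc K) f M0 M'" "M' \<preceq>\<^bsub>K\<^esub> B" using f by (rule embE)
  have M'K: "M' \<in> K\<kappa>" by (rule iso_in_K\<kappa>[OF M'(1) M(1)])
  have "emb f M0 M'" using emb_iso[OF M'(1)] model_in_models[OF M(1)] by blast
  then obtain N' f' where N': "N' \<in> K\<kappa>" "M' \<preceq>\<^bsub>K\<^esub> N'" "emb f' M1 N'" "\<And>x. x \<in> carrier M0 \<Longrightarrow> f' x = f x"
    using embedding_amalgamation[OF amalgamation M M'K] by blast
  obtain g where g: "emb g N' B" "fixes_pointwise g M'"
    by (rule homogeneous[OF M'K M'(2) N'(1,2)])
  show ?thesis
  proof (rule that[of "g \<circ> f'"])
    show "emb (g \<circ> f') M1 B" by (rule emb_comp[OF N'(3) g(1)])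
    show "(g \<circ> f') x = f x" if "x \<in> carrier M0" for x
      using N'(4)[OF that] g(2) struct_isoD(4)[OF M'(1)] that by (simp add: fixes_pointwise_def)
  qed
qed

text \<open>Only the domain has to be exhausted: the map is extended along a filtration to all of
  \<open>B\<close>, and surjectivity then comes for free from maximality.\<close>

lemma emb_extends_to_aut:
  assumes M0: "M0 \<in> K\<kappa>" "M0 \<preceq>\<^bsub>K\<^esub> B" and f0: "emb f0 M0 B"
  obtains \<sigma> where "aut \<sigma>" "\<And>x. x \<in> carrier M0 \<Longrightarrow> \<sigma> x = f0 x"
proof -
  obtain M where M: "continuous_chain M" "M z = M0" "B = union_struct (M ` Field (cardSuc \<kappa>))"
    by (rule filtration[OF M0, of "\<lambda>_ _. True"]) (use le_refl model_in_models in blast)+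
  note MD = continuous_chainD[OF M(1)]
  obtain f where f: "\<And>x. x \<in> carrier (M z) \<Longrightarrow> f x = f0 x" "\<And>i. i \<in> Field (cardSuc \<kappa>) \<Longrightarrow> emb f (M i) B \<and> True"
  proof (rule embedding_chain_into[OF M(1), of f0 B "\<lambda>_ _. True"])
    show "emb f0 (M z) B" using M(2) f0 by simp
    fix i f assume *: "i \<in> Field (cardSuc \<kappa>)" "emb f (M i) B"
    have "M i \<preceq>\<^bsub>K\<^esub> M (sc i)" using MD(2) less_le sc_greater *(1) by blast
    from extend_step[OF MD(1)[OF *(1)] MD(1)[OF sc_in[OF *(1)]] this *(2)]
    show "\<exists>f'. emb f' (M (sc i)) B \<and> (\<forall>x\<in>carrier (M i). f' x = f x) \<and> True" by metis
  qed auto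
  have "emb f (union_struct (M ` Field (cardSuc \<kappa>))) B"
  proof (rule total_union(4))
    show "|carrier (union_struct (M ` Field (cardSuc \<kappa>)))| <o |UNIV :: 'a set|" using small_B M(3) by simp
  qed (use f(2) MD(2) in auto)
  then have fB: "emb f B B" using M(3) by simp
  then obtain B' where B': "struct_iso (voc K) f B B'" "B' \<preceq>\<^bsub>K\<^esub> B" by (rule embE)
  have onto: "carrier B = f ` carrier B" by (rule emb_B_onto[OF fB])
  then have "B' = B" using le_carrier_eqI[OF B'(2)] struct_isoD(4)[OF B'(1)] by simp
  then have iso: "struct_iso (voc K) f B B" using B'(1) by simp
  let ?\<sigma> = "\<lambda>x. if x \<in> carrier B then f x else x"
  have "bij_betw f (carrier B) (carrier B)" using struct_isoD(5)[OF iso] .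
  then have "bij_betw ?\<sigma> (carrier B \<union> - carrier B) (carrier B \<union> - carrier B)"
    by (rule bij_betw_disjoint_Un[OF _ bij_betw_id[unfolded id_def]]) auto
  then have "bij ?\<sigma>" by simp
  moreover have "struct_iso (voc K) ?\<sigma> B B" by (rule struct_iso_cong[OF iso]) simp
  ultimately have "aut ?\<sigma>" by (simp add: aut_def)
  moreover have "?\<sigma> x = f0 x" if "x \<in> carrier M0" for x
    using that f(1) M(2) leD(4)[OF M0(2)] by auto
  ultimately show ?thesis by (rule that)
qed

lemma embeddings_differ_by_aut:
  assumes N: "N \<in> K\<kappa>" and e: "emb e N B" and g: "emb g N B"
  obtains \<sigma> where "aut \<sigma>" "\<And>x. x \<in> carrier N \<Longrightarrow> \<sigma> (e x) = g x"
proof -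
  obtain N' where N': "struct_iso (voc K) e N N'" "N' \<preceq>\<^bsub>K\<^esub> B" using e by (rule embE)
  have "emb (inv_into (carrier N) e) N' N"
    by (rule emb_iso[OF struct_iso_inv_into[OF N'(1)] leD(1)[OF N'(2)]])
  then have "emb (g \<circ> inv_into (carrier N) e) N' B" by (rule emb_comp[OF _ g])
  then obtain \<sigma> where \<sigma>: "aut \<sigma>" "\<And>x. x \<in> carrier N' \<Longrightarrow> \<sigma> x = (g \<circ> inv_into (carrier N) e) x"
    using emb_extends_to_aut[OF iso_in_K\<kappa>[OF N'(1) N] N'(2)] by blast
  show ?thesis
  proof (rule that[OF \<sigma>(1)])
    show "\<sigma> (e x) = g x" if "x \<in> carrier N" for x
      using \<sigma>(2)[of "e x"] struct_isoD(3,4)[OF N'(1)] that by simp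
  qed
qed

section \<open>Types and splitting expressed by automorphisms\<close>

definition conjugate :: "('a, 'f, 'r) struct \<Rightarrow> 'a \<Rightarrow> 'a \<Rightarrow> bool" where
  "conjugate N a b \<longleftrightarrow> (\<exists>\<sigma>. aut \<sigma> \<and> fixes_pointwise \<sigma> N \<and> \<sigma> a = b)"

lemma conjugate_trans:
  assumes "conjugate N a b" "conjugate N b c"
  shows "conjugate N a c"
proof -
  obtain \<sigma> \<tau> where "aut \<sigma>" "fixes_pointwise \<sigma> N" "\<sigma> a = b" "aut \<tau>" "fixes_pointwise \<tau> N" "\<tau> b = c"
    using assms unfolding conjugate_def by blast
  then have "aut (\<tau> \<circ> \<sigma>)" "fixes_pointwise (\<tau> \<circ> \<sigma>) N" "(\<tau> \<circ> \<sigma>) a = c"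
    using aut_comp by (auto simp: fixes_pointwise_def)
  then show ?thesis unfolding conjugate_def by blast
qed

text \<open>From right to left an automorphism is an embedding over \<open>N\<close>. The other
  direction is delicate because a chain of amalgamation steps may pass through models of any size
  outside \<open>B\<close>.\<close>

lemma gtp_eq_iff_conjugate:
  assumes N: "N \<in> K\<kappa>" "N \<preceq>\<^bsub>K\<^esub> B" and ab: "a \<in> carrier B" "b \<in> carrier B"
  shows "gtp K a N B = gtp K b N B \<longleftrightarrow> conjugate N a b"
proof
  assume "conjugate N a b"
  then obtain \<sigma> where "aut \<sigma>" "fixes_pointwise \<sigma> N" "\<sigma> a = b" unfolding conjugate_def by blast
  then show "gtp K a N B = gtp K b N B" using gtp_emb[OF N(2) ab(1) aut_emb_B] by metis
next
  assume "gtp K a N B = gtp K b N B"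
  then have rel: "((a, N, B), (b, N, B)) \<in> (E_at K)\<^sup>+" using gtp_eqD N(2) ab(2) by blast
  \<comment> \<open>The invariant along the chain: however a \<kappa>-sized submodel through
    \<open>c\<close> is placed in \<open>B\<close> over \<open>N\<close>, the image of
    \<open>c\<close> lies in the orbit of \<open>a\<close>.\<close>
  define good where "good c P \<longleftrightarrow> (\<forall>P0 g. P0 \<in> K\<kappa> \<longrightarrow> N \<preceq>\<^bsub>K\<^esub> P0 \<longrightarrow> P0 \<preceq>\<^bsub>K\<^esub> P \<longrightarrow> c \<in> carrier P0 \<longrightarrow>
    emb g P0 B \<longrightarrow> fixes_pointwise g N \<longrightarrow> conjugate N a (g c))" for c P
  have goodD: "conjugate N a (g c)" if "good c P" "P0 \<in> K\<kappa>" "N \<preceq>\<^bsub>K\<^esub> P0" "P0 \<preceq>\<^bsub>K\<^esub> P" "c \<in> carrier P0"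
    "emb g P0 B" "fixes_pointwise g N" for c P P0 g
    using that unfolding good_def by blast
  have start: "good a B"
    unfolding good_def
  proof (intro allI impI)
    fix P0 g assume P0: "P0 \<in> K\<kappa>" "N \<preceq>\<^bsub>K\<^esub> P0" "P0 \<preceq>\<^bsub>K\<^esub> B" "a \<in> carrier P0" "emb g P0 B" "fixes_pointwise g N"
    obtain \<sigma> where \<sigma>: "aut \<sigma>" "\<And>x. x \<in> carrier P0 \<Longrightarrow> \<sigma> x = g x"
      using emb_extends_to_aut[OF P0(1,3,5)] by blast
    have "fixes_pointwise \<sigma> N" using \<sigma>(2) P0(6) leD(4)[OF P0(2)] by (auto simp: fixes_pointwise_def)
    then show "conjugate N a (g a)" using \<sigma> P0(4) unfolding conjugate_def by blast
  qed
  have step: "good d Q" if "((c, N, P), (d, N, Q)) \<in> E_at K" and good: "good c P" for c P d Q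
    using that(1)
  proof (rule E_atE)
    fix f1 f2 R
    assume E: "N \<preceq>\<^bsub>K\<^esub> P" "N \<preceq>\<^bsub>K\<^esub> Q" "c \<in> carrier P" "d \<in> carrier Q" "emb f1 P R" "emb f2 Q R"
      "fixes_pointwise f1 N" "fixes_pointwise f2 N" "f1 c = f2 d"
    show "good d Q"
      unfolding good_def
    proof (intro allI impI)
      fix Q0 g assume Q0: "Q0 \<in> K\<kappa>" "N \<preceq>\<^bsub>K\<^esub> Q0" "Q0 \<preceq>\<^bsub>K\<^esub> Q" "d \<in> carrier Q0" "emb g Q0 B" "fixes_pointwise g N"
      obtain P0 where P0: "P0 \<in> K\<kappa>" "N \<preceq>\<^bsub>K\<^esub> P0" "P0 \<preceq>\<^bsub>K\<^esub> P" "c \<in> carrier P0"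
        by (rule submodel_containing_element[OF N(1) E(1,3)])
      have e1: "emb f1 P0 R" and e2: "emb f2 Q0 R" using emb_restrict E(5,6) P0(3) Q0(3) by blast+
      have "emb id N R"
        by (rule emb_cong[OF emb_restrict[OF E(5,1)]]) (use E(7) in \<open>simp add: fixes_pointwise_def\<close>)
      then have NR: "N \<preceq>\<^bsub>K\<^esub> R" by (simp add: emb_id_iff)
      have "f1 ` carrier P0 \<union> f2 ` carrier Q0 \<subseteq> carrier R" using embD(4)[OF e1] embD(4)[OF e2] by blast
      moreover have "|f1 ` carrier P0 \<union> f2 ` carrier Q0| \<le>o \<kappa>"
        by (rule card_Un[OF card_image card_image]) (rule card_model[OF P0(1)], rule card_model[OF Q0(1)])
      ultimately obtain R0 where R0: "R0 \<in> K\<kappa>" "N \<preceq>\<^bsub>K\<^esub> R0" "R0 \<preceq>\<^bsub>K\<^esub> R"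
        "f1 ` carrier P0 \<union> f2 ` carrier Q0 \<subseteq> carrier R0"
        by (rule submodel_containing[OF N(1) NR])
      \<comment> \<open>A single embedding \<open>k\<close> of the relevant part of the amalgam puts
        \<open>c\<close> and \<open>d\<close> at the same point of \<open>B\<close>; any other
        placement of \<open>Q0\<close> differs from this one by an automorphism over
        \<open>N\<close>.\<close>
      obtain k where k: "emb k R0 B" "fixes_pointwise k N" by (rule homogeneous[OF N R0(1,2)])
      have k1: "emb (k \<circ> f1) P0 B" and k2: "emb (k \<circ> f2) Q0 B"
        by (rule emb_comp[OF emb_into[OF e1 R0(3)] k(1)], use R0(4) in blast)
          (rule emb_comp[OF emb_into[OF e2 R0(3)] k(1)], use R0(4) in blast)
      have "conjugate N a ((k \<circ> f1) c)"
        by (rule goodD[OF good P0(1-3) _ k1]) (use P0(4) E(7) k(2) in \<open>auto simp: fixes_pointwise_def\<close>)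
      moreover obtain \<rho> where \<rho>: "aut \<rho>" "\<And>x. x \<in> carrier Q0 \<Longrightarrow> \<rho> ((k \<circ> f2) x) = g x"
        using embeddings_differ_by_aut[OF Q0(1) k2 Q0(5)] by blast
      have "fixes_pointwise \<rho> N"
        unfolding fixes_pointwise_def
      proof
        fix x assume x: "x \<in> carrier N"
        then have "(k \<circ> f2) x = x" "g x = x" using E(8) k(2) Q0(6) by (auto simp: fixes_pointwise_def)
        then show "\<rho> x = x" using \<rho>(2)[of x] leD(4)[OF Q0(2)] x by auto
      qed
      then have "conjugate N ((k \<circ> f1) c) (g d)"
        using \<rho> Q0(4) E(9) unfolding conjugate_def by (metis comp_apply)
      ultimately show "conjugate N a (g d)" by (rule conjugate_trans)
    qed
  qed
  have "fst (snd t) = N \<and> good (fst t) (snd (snd t))" if "((a, N, B), t) \<in> (E_at K)\<^sup>+" for t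
    using that
  proof (induction rule: trancl_induct)
    case (base t)
    then obtain c P where "t = (c, N, P)" by (cases t) (auto elim!: E_atE)
    then show ?case using step[OF _ start] base by simp
  next
    case (step t u)
    then obtain c P d Q where "t = (c, N, P)" "u = (d, N, Q)" by (cases t; cases u) (auto elim!: E_atE)
    then show ?case using \<open>\<And>c P d Q. ((c, N, P), (d, N, Q)) \<in> E_at K \<Longrightarrow> good c P \<Longrightarrow> good d Q\<close> step by auto
  qed
  from this[OF rel] have "good b B" by simp
  obtain P0 where P0: "P0 \<in> K\<kappa>" "N \<preceq>\<^bsub>K\<^esub> P0" "P0 \<preceq>\<^bsub>K\<^esub> B" "b \<in> carrier P0"
    by (rule submodel_containing_element[OF N ab(2)])
  have "emb id P0 B" "fixes_pointwise id N" using P0(3) by (simp_all add: emb_id_iff fixes_pointwise_def)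
  from goodD[OF \<open>good b B\<close> P0 this] show "conjugate N a b" by simp
qed

text \<open>Non-splitting over \<open>M\<close> of the type of \<open>a\<close> over
  \<open>N\<close>, freed from types: the second model of the splitting definition is the image of
  \<open>h\<close>, and agreement of the two types becomes an automorphism extending
  \<open>h\<close> that fixes \<open>a\<close>.\<close>

definition nonsplit :: "'a \<Rightarrow> ('a, 'f, 'r) struct \<Rightarrow> ('a, 'f, 'r) struct \<Rightarrow> bool" where
  "nonsplit a N M \<longleftrightarrow> (\<forall>N1 h. N1 \<in> K\<kappa> \<longrightarrow> M \<preceq>\<^bsub>K\<^esub> N1 \<longrightarrow> N1 \<preceq>\<^bsub>K\<^esub> N \<longrightarrow> emb h N1 N \<longrightarrow> fixes_pointwise h M \<longrightarrow>
     (\<exists>\<tau>. aut \<tau> \<and> (\<forall>x\<in>carrier N1. \<tau> x = h x) \<and> \<tau> a = a))"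

lemma nonsplitD:
  assumes "nonsplit a N M" "N1 \<in> K\<kappa>" "M \<preceq>\<^bsub>K\<^esub> N1" "N1 \<preceq>\<^bsub>K\<^esub> N" "emb h N1 N" "fixes_pointwise h M"
  obtains \<tau> where "aut \<tau>" "\<And>x. x \<in> carrier N1 \<Longrightarrow> \<tau> x = h x" "\<tau> a = a"
  using assms unfolding nonsplit_def by blast

text \<open>If \<open>\<sigma>\<close> is any automorphism extending \<open>h\<close>, the
  transported type is that of \<open>\<sigma> a\<close> over \<open>N2\<close>. It equals the type
  of \<open>a\<close> iff some automorphism over \<open>N2\<close> moves \<open>\<sigma> a\<close>
  back to \<open>a\<close>, and composing the two gives \<open>\<tau>\<close>.\<close>

lemma map_restrict_gtp_eq_iff:
  assumes N: "N \<preceq>\<^bsub>K\<^esub> B" and a: "a \<in> carrier B" and N1: "N1 \<in> K\<kappa>" "N1 \<preceq>\<^bsub>K\<^esub> N" and N2: "N2 \<preceq>\<^bsub>K\<^esub> N"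
    and h: "struct_iso (voc K) h N1 N2"
  shows "map_type K h N1 N2 (restrict_type K (gtp K a N B) N1) = restrict_type K (gtp K a N B) N2 \<longleftrightarrow>
    (\<exists>\<tau>. aut \<tau> \<and> (\<forall>x\<in>carrier N1. \<tau> x = h x) \<and> \<tau> a = a)"
proof -
  have N2K: "N2 \<in> K\<kappa>" by (rule iso_in_K\<kappa>[OF h N1(1)])
  have N1B: "N1 \<preceq>\<^bsub>K\<^esub> B" and N2B: "N2 \<preceq>\<^bsub>K\<^esub> B" using le_trans N N1(2) N2 by blast+
  obtain \<sigma> where \<sigma>: "aut \<sigma>" "\<And>x. x \<in> carrier N1 \<Longrightarrow> \<sigma> x = h x"
    using emb_extends_to_aut[OF N1(1) N1B embI[OF h N2B]] by blast
  have "map_type K h N1 N2 (gtp K a N1 B) = gtp K (\<sigma> a) N2 B"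
    by (rule map_gtp[OF N1B a h]) (use \<sigma> in \<open>auto simp: aut_def\<close>)
  then have "map_type K h N1 N2 (restrict_type K (gtp K a N B) N1) = restrict_type K (gtp K a N B) N2 \<longleftrightarrow>
      conjugate N2 (\<sigma> a) a"
    using restrict_gtp[OF N1(2) N a] restrict_gtp[OF N2 N a]
      gtp_eq_iff_conjugate[OF N2K N2B, of "\<sigma> a" a] aut_in_B[OF \<sigma>(1)] a by simp
  also have "\<dots> \<longleftrightarrow> (\<exists>\<tau>. aut \<tau> \<and> (\<forall>x\<in>carrier N1. \<tau> x = h x) \<and> \<tau> a = a)"
  proof
    assume "conjugate N2 (\<sigma> a) a"
    then obtain \<rho> where \<rho>: "aut \<rho>" "fixes_pointwise \<rho> N2" "\<rho> (\<sigma> a) = a" unfolding conjugate_def by blast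
    then have "aut (\<rho> \<circ> \<sigma>)" "\<forall>x\<in>carrier N1. (\<rho> \<circ> \<sigma>) x = h x" "(\<rho> \<circ> \<sigma>) a = a"
      using aut_comp \<sigma> struct_isoD(4)[OF h] by (auto simp: fixes_pointwise_def)
    then show "\<exists>\<tau>. aut \<tau> \<and> (\<forall>x\<in>carrier N1. \<tau> x = h x) \<and> \<tau> a = a" by blast
  next
    assume "\<exists>\<tau>. aut \<tau> \<and> (\<forall>x\<in>carrier N1. \<tau> x = h x) \<and> \<tau> a = a"
    then obtain \<tau> where \<tau>: "aut \<tau>" "\<forall>x\<in>carrier N1. \<tau> x = h x" "\<tau> a = a" by blast
    have "aut (\<tau> \<circ> inv \<sigma>)" using aut_comp \<tau>(1) aut_inv \<sigma>(1) by blast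
    moreover have "fixes_pointwise (\<tau> \<circ> inv \<sigma>) N2"
      unfolding fixes_pointwise_def
    proof
      fix y assume "y \<in> carrier N2"
      then obtain x where "x \<in> carrier N1" "y = h x" using struct_isoD(4)[OF h] by auto
      then show "(\<tau> \<circ> inv \<sigma>) y = y" using \<sigma>(2) \<tau>(2) aut_inv_simps(1)[OF \<sigma>(1), of x] by simp
    qed
    moreover have "(\<tau> \<circ> inv \<sigma>) (\<sigma> a) = a" using \<tau>(3) aut_inv_simps[OF \<sigma>(1)] by simp
    ultimately show "conjugate N2 (\<sigma> a) a" unfolding conjugate_def by blast
  qed
  finally show ?thesis .
qed

lemma not_splits_over_iff_nonsplit:
  assumes N: "N \<preceq>\<^bsub>K\<^esub> B" and a: "a \<in> carrier B"
  shows "\<not> splits_over K \<kappa> (gtp K a N B) N M \<longleftrightarrow> nonsplit a N M"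
proof
  assume ns: "\<not> splits_over K \<kappa> (gtp K a N B) N M"
  show "nonsplit a N M"
    unfolding nonsplit_def
  proof (intro allI impI)
    fix N1 h assume *: "N1 \<in> K\<kappa>" "M \<preceq>\<^bsub>K\<^esub> N1" "N1 \<preceq>\<^bsub>K\<^esub> N" "emb h N1 N" "fixes_pointwise h M"
    obtain N2 where N2: "struct_iso (voc K) h N1 N2" "N2 \<preceq>\<^bsub>K\<^esub> N" using *(4) by (rule embE)
    have "emb h N1 N2" using emb_iso[OF N2(1)] model_in_models *(1) by blast
    \<comment> \<open>As \<open>h\<close> fixes \<open>M\<close> pointwise, \<open>M\<close> lies
      below the image \<open>N2\<close> too, which the definition of splitting asks for.\<close>
    then have "emb id M N2"
      using emb_cong[OF emb_restrict[OF _ *(2)], of h N2 id] *(5) by (simp add: fixes_pointwise_def)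
    then have "M \<preceq>\<^bsub>K\<^esub> N2" by (simp add: emb_id_iff)
    then have "map_type K h N1 N2 (restrict_type K (gtp K a N B) N1) = restrict_type K (gtp K a N B) N2"
      using ns * N2 iso_in_K\<kappa>[OF N2(1) *(1)] unfolding splits_over_def by blast
    then show "\<exists>\<tau>. aut \<tau> \<and> (\<forall>x\<in>carrier N1. \<tau> x = h x) \<and> \<tau> a = a"
      using map_restrict_gtp_eq_iff[OF N a *(1,3) N2(2,1)] by blast
  qed
next
  assume ns: "nonsplit a N M"
  show "\<not> splits_over K \<kappa> (gtp K a N B) N M"
  proof
    assume "splits_over K \<kappa> (gtp K a N B) N M"
    then obtain N1 N2 h where *: "N1 \<in> K\<kappa>" "M \<preceq>\<^bsub>K\<^esub> N1" "N1 \<preceq>\<^bsub>K\<^esub> N" "N2 \<preceq>\<^bsub>K\<^esub> N" "struct_iso (voc K) h N1 N2"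
      "fixes_pointwise h M"
      "map_type K h N1 N2 (restrict_type K (gtp K a N B) N1) \<noteq> restrict_type K (gtp K a N B) N2"
      unfolding splits_over_def by blast
    have "emb h N1 N" by (rule embI[OF *(5,4)])
    then have "\<exists>\<tau>. aut \<tau> \<and> (\<forall>x\<in>carrier N1. \<tau> x = h x) \<and> \<tau> a = a"
      using ns *(1-3,6) unfolding nonsplit_def by blast
    then show False using *(7) map_restrict_gtp_eq_iff[OF N a *(1,3,4,5)] by blast
  qed
qed

lemma conjugate_sym:
  assumes "conjugate N a b"
  shows "conjugate N b a"
proof -
  obtain \<sigma> where \<sigma>: "aut \<sigma>" "fixes_pointwise \<sigma> N" "\<sigma> a = b" using assms unfolding conjugate_def by blast
  have "inv \<sigma> x = x" if "\<sigma> x = x" for x using aut_inv_simps(1)[OF \<sigma>(1), of x] that by simp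
  then have "fixes_pointwise (inv \<sigma>) N" using \<sigma>(2) by (simp add: fixes_pointwise_def)
  moreover have "inv \<sigma> b = a" using aut_inv_simps(1)[OF \<sigma>(1)] \<sigma>(3) by blast
  ultimately show ?thesis using aut_inv[OF \<sigma>(1)] unfolding conjugate_def by blast
qed

lemma nonsplit_restrict: "nonsplit a N M \<Longrightarrow> N' \<preceq>\<^bsub>K\<^esub> N \<Longrightarrow> nonsplit a N' M"
  unfolding nonsplit_def using le_trans emb_le by blast

text \<open>Non-splitting depends only on the orbit over \<open>N\<close>: both \<open>N1\<close>
  and its image under \<open>h\<close> lie in \<open>N\<close>, so conjugating the witness by an
  automorphism over \<open>N\<close> leaves its values on \<open>N1\<close> unchanged.\<close>

lemma nonsplit_conjugate:
  assumes ns: "nonsplit a N M" and N: "conjugate N a b"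
  shows "nonsplit b N M"
  unfolding nonsplit_def
proof (intro allI impI)
  fix N1 h assume *: "N1 \<in> K\<kappa>" "M \<preceq>\<^bsub>K\<^esub> N1" "N1 \<preceq>\<^bsub>K\<^esub> N" "emb h N1 N" "fixes_pointwise h M"
  obtain \<tau> where \<tau>: "aut \<tau>" "\<And>x. x \<in> carrier N1 \<Longrightarrow> \<tau> x = h x" "\<tau> a = a"
    using nonsplitD[OF ns *] by blast
  obtain \<rho> where \<rho>: "aut \<rho>" "\<And>x. x \<in> carrier N \<Longrightarrow> \<rho> x = x" "\<rho> a = b"
    using N unfolding conjugate_def fixes_pointwise_def by blast
  have inv: "inv \<rho> x = x" if "x \<in> carrier N" for x
    using aut_inv_simps(1)[OF \<rho>(1), of x] \<rho>(2)[OF that] by simp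
  show "\<exists>\<tau>. aut \<tau> \<and> (\<forall>x\<in>carrier N1. \<tau> x = h x) \<and> \<tau> b = b"
  proof (intro exI conjI ballI)
    show "aut (\<rho> \<circ> \<tau> \<circ> inv \<rho>)" using aut_comp aut_inv \<rho>(1) \<tau>(1) by blast
    show "(\<rho> \<circ> \<tau> \<circ> inv \<rho>) x = h x" if x: "x \<in> carrier N1" for x
    proof -
      have "x \<in> carrier N" "h x \<in> carrier N" using leD(4)[OF *(3)] embD(4)[OF *(4)] x by auto
      then show ?thesis using inv \<rho>(2) \<tau>(2)[OF x] by simp
    qed
    show "(\<rho> \<circ> \<tau> \<circ> inv \<rho>) b = b" using aut_inv_simps(1)[OF \<rho>(1), of a] \<rho>(3) \<tau>(3) by simp
  qed
qed

lemma universal_over_mono: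
  assumes "universal_over K N M" "N \<preceq>\<^bsub>K\<^esub> N'" "M \<in> K\<kappa>" "N' \<in> K\<kappa>"
  shows "universal_over K N' M"
proof -
  have "|carrier N'| =o |carrier M|"
    using models_of_cardD(2)[OF assms(3)] models_of_cardD(2)[OF assms(4)] ordIso_symmetric ordIso_transitive by blast
  then show ?thesis
    using assms(1) le_trans[OF _ assms(2)] emb_le[OF _ assms(2)] unfolding universal_over_def by blast
qed

lemma universal_overE:
  assumes "universal_over K N M" "M \<in> K\<kappa>" "N' \<in> K\<kappa>" "M \<preceq>\<^bsub>K\<^esub> N'"
  obtains f where "emb f N' N" "fixes_pointwise f M"
proof -
  have "|carrier N'| =o |carrier M|"
    using models_of_cardD(2)[OF assms(2)] models_of_cardD(2)[OF assms(3)] ordIso_symmetric ordIso_transitive by blast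
  then have "N' \<in> models_of_card K |carrier M|"
    using model_in_models[OF assms(3)] by (simp add: models_of_card_def)
  then show ?thesis using assms(1,4) that unfolding universal_over_def by blast
qed

text \<open>With \<open>\<sigma>\<close> extending an embedding \<open>f\<close> of
  \<open>M2\<close> into \<open>M1\<close> over \<open>M0\<close>, the new point is the preimage of
  \<open>a\<close> under \<open>\<sigma>\<close>. It avoids \<open>M2\<close> because
  \<open>\<sigma>\<close> maps \<open>M2\<close> into \<open>M1\<close>, which omits
  \<open>a\<close>. Its type over \<open>M1\<close> is the old one because non-splitting of
  \<open>a\<close>, applied to \<open>f\<close> on \<open>M1\<close> itself, provides an
  automorphism that extends this restriction and fixes \<open>a\<close>.\<close>

lemma nonsplit_extension:
  assumes univ: "universal_over K M1 M0" and M0: "M0 \<in> K\<kappa>" and M1: "M1 \<in> K\<kappa>" "M1 \<preceq>\<^bsub>K\<^esub> B"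
    and a: "a \<in> carrier B" "a \<notin> carrier M1" "nonsplit a M1 M0"
    and M2: "M2 \<in> K\<kappa>" "M0 \<preceq>\<^bsub>K\<^esub> M2" "M2 \<preceq>\<^bsub>K\<^esub> B"
  obtains b where "b \<in> carrier B" "b \<notin> carrier M2" "nonsplit b M2 M0" "M1 \<preceq>\<^bsub>K\<^esub> M2 \<Longrightarrow> conjugate M1 b a"
proof -
  obtain f where f: "emb f M2 M1" "fixes_pointwise f M0"
    by (rule universal_overE[OF univ M0 M2(1,2)])
  obtain \<sigma> where \<sigma>: "aut \<sigma>" "\<And>x. x \<in> carrier M2 \<Longrightarrow> \<sigma> x = f x"
    using emb_extends_to_aut[OF M2(1,3) emb_le[OF f(1) M1(2)]] by blast
  let ?b = "inv \<sigma> a"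
  have \<sigma>b: "\<sigma> ?b = a" by (rule aut_inv_simps(2)[OF \<sigma>(1)])
  have 1: "?b \<in> carrier B" using aut_in_B[OF aut_inv[OF \<sigma>(1)]] a(1) by blast
  have 2: "?b \<notin> carrier M2" using \<sigma>(2)[of ?b] \<sigma>b embD(4)[OF f(1)] a(2) by auto
  have 3: "nonsplit ?b M2 M0"
    unfolding nonsplit_def
  proof (intro allI impI)
    fix N1 h assume *: "N1 \<in> K\<kappa>" "M0 \<preceq>\<^bsub>K\<^esub> N1" "N1 \<preceq>\<^bsub>K\<^esub> M2" "emb h N1 M2" "fixes_pointwise h M0"
    obtain N1' where N1': "struct_iso (voc K) f N1 N1'" "N1' \<preceq>\<^bsub>K\<^esub> M1"
      using emb_restrict[OF f(1) *(3)] by (rule embE)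
    let ?g = "inv_into (carrier N1) f"
    have gf: "?g (f x) = x" if "x \<in> carrier N1" for x using struct_isoD(3)[OF N1'(1)] that by simp
    have fx: "f x = x" and hx: "h x = x" and xN1: "x \<in> carrier N1" if "x \<in> carrier M0" for x
      using f(2) *(5) leD(4)[OF *(2)] that by (auto simp: fixes_pointwise_def)
    have gx: "?g x = x" if "x \<in> carrier M0" for x using gf[OF xN1[OF that]] fx[OF that] by simp
    have "emb f N1 N1'" using emb_iso[OF N1'(1)] model_in_models *(1) by blast
    then have "emb id M0 N1'"
      by (rule emb_cong[OF emb_restrict[OF _ *(2)]]) (use fx in simp)
    then have M0N1': "M0 \<preceq>\<^bsub>K\<^esub> N1'" by (simp add: emb_id_iff)
    have "emb ?g N1' N1" by (rule emb_iso[OF struct_iso_inv_into[OF N1'(1)] leD(1)[OF N1'(2)]])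
    \<comment> \<open>Conjugation by \<open>f\<close> turns a partial map of \<open>M2\<close> over
      \<open>M0\<close> into one of \<open>M1\<close>, where non-splitting of \<open>a\<close> is
      available.\<close>
    then have "emb (f \<circ> (h \<circ> ?g)) N1' M1" by (rule emb_comp[OF emb_comp[OF _ *(4)] f(1)])
    moreover have "fixes_pointwise (f \<circ> (h \<circ> ?g)) M0" using fx hx gx by (simp add: fixes_pointwise_def)
    ultimately obtain \<tau> where \<tau>: "aut \<tau>" "\<And>x. x \<in> carrier N1' \<Longrightarrow> \<tau> x = (f \<circ> (h \<circ> ?g)) x" "\<tau> a = a"
      using nonsplitD[OF a(3) iso_in_K\<kappa>[OF N1'(1) *(1)] M0N1' N1'(2)] by blast
    show "\<exists>\<tau>. aut \<tau> \<and> (\<forall>x\<in>carrier N1. \<tau> x = h x) \<and> \<tau> ?b = ?b"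
    proof (intro exI conjI ballI)
      show "aut (inv \<sigma> \<circ> \<tau> \<circ> \<sigma>)" using aut_comp aut_inv \<sigma>(1) \<tau>(1) by blast
      show "(inv \<sigma> \<circ> \<tau> \<circ> \<sigma>) x = h x" if x: "x \<in> carrier N1" for x
      proof -
        have "\<sigma> x = f x" using \<sigma>(2) leD(4)[OF *(3)] x by blast
        moreover have "\<tau> (f x) = f (h x)"
          using \<tau>(2)[of "f x"] gf[OF x] struct_isoD(4)[OF N1'(1)] x by simp
        moreover have "f (h x) = \<sigma> (h x)" using \<sigma>(2)[of "h x"] embD(4)[OF *(4)] x by auto
        ultimately show ?thesis using aut_inv_simps(1)[OF \<sigma>(1)] by simp
      qed
      show "(inv \<sigma> \<circ> \<tau> \<circ> \<sigma>) ?b = ?b" using \<sigma>b \<tau>(3) by simp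
    qed
  qed
  have 4: "conjugate M1 ?b a" if M12: "M1 \<preceq>\<^bsub>K\<^esub> M2"
  proof -
    have M01: "M0 \<preceq>\<^bsub>K\<^esub> M1" using univ by (simp add: universal_over_def)
    obtain \<tau> where \<tau>: "aut \<tau>" "\<And>x. x \<in> carrier M1 \<Longrightarrow> \<tau> x = f x" "\<tau> a = a"
      using nonsplitD[OF a(3) M1(1) M01 le_refl[OF model_in_models[OF M1(1)]] emb_restrict[OF f(1) M12] f(2)]
      by blast
    have "fixes_pointwise (inv \<sigma> \<circ> \<tau>) M1"
      unfolding fixes_pointwise_def
    proof
      fix x assume x: "x \<in> carrier M1"
      then have "\<tau> x = \<sigma> x" using \<tau>(2) \<sigma>(2) leD(4)[OF M12] by auto
      then show "(inv \<sigma> \<circ> \<tau>) x = x" using aut_inv_simps(1)[OF \<sigma>(1)] by simp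
    qed
    moreover have "aut (inv \<sigma> \<circ> \<tau>)" using aut_comp aut_inv \<sigma>(1) \<tau>(1) by blast
    ultimately have "conjugate M1 a ?b" using \<tau>(3) unfolding conjugate_def by auto
    then show ?thesis by (rule conjugate_sym)
  qed
  show ?thesis by (rule that[OF 1 2 3 4])
qed

end

section \<open>Consequences of stability: universal extensions and a non-splitting type\<close>

locale stable_maximal_model = maximal_model K \<kappa> B
  for K :: "('a, 'f, 'r) aclass" and \<kappa> :: "'c rel" and B +
  assumes stable: "stable_in K \<kappa>"
begin

text \<open>There are at most \<kappa> types over \<open>M\<close>, so one representative of each,
  taken in \<open>B\<close>, fits into a submodel of size \<kappa>.\<close>

lemma submodel_realizing_types:
  assumes M: "M \<in> K\<kappa>" "M \<preceq>\<^bsub>K\<^esub> B"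
  obtains N where "N \<in> K\<kappa>" "M \<preceq>\<^bsub>K\<^esub> N" "N \<preceq>\<^bsub>K\<^esub> B" "\<And>b. b \<in> carrier B \<Longrightarrow> \<exists>c\<in>carrier N. conjugate M c b"
proof -
  let ?T = "(\<lambda>b. gtp K b M B) ` carrier B"
  define rep where "rep p = (SOME b. b \<in> carrier B \<and> gtp K b M B = p)" for p
  have rep: "rep p \<in> carrier B \<and> gtp K (rep p) M B = p" if "p \<in> ?T" for p
    unfolding rep_def by (rule someI_ex) (use that in blast)
  have "?T \<subseteq> gS K M" using M(2) by (auto simp: gS_def)
  moreover have "|gS K M| \<le>o \<kappa>" using stable M(1) by (simp add: stable_in_def)
  ultimately have "|?T| \<le>o \<kappa>"
    using card_of_mono1 ordLeq_transitive by metis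
  then have "|rep ` ?T| \<le>o \<kappa>" by (rule card_image)
  moreover have "rep ` ?T \<subseteq> carrier B" using rep by blast
  ultimately obtain N where N: "N \<in> K\<kappa>" "M \<preceq>\<^bsub>K\<^esub> N" "N \<preceq>\<^bsub>K\<^esub> B" "rep ` ?T \<subseteq> carrier N"
    using submodel_containing[OF M, of "rep ` ?T"] by blast
  show ?thesis
  proof (rule that[OF N(1-3)])
    fix b assume b: "b \<in> carrier B"
    then have p: "gtp K b M B \<in> ?T" by blast
    then have "conjugate M (rep (gtp K b M B)) b"
      using rep[OF p] gtp_eq_iff_conjugate[OF M _ b] by blast
    then show "\<exists>c\<in>carrier N. conjugate M c b" using N(4) p by blast
  qed
qed

text \<open>\<open>M1\<close> is the union \<open>?U\<close> of a \<kappa>-chain in which every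
  model realizes all types over its predecessor. To embed \<open>N\<close> into \<open>?U\<close>, a
  copy \<open>N'\<close> of \<open>N\<close> in \<open>B\<close> is enumerated along \<kappa>, and a
  map from \<open>?U\<close> to \<open>B\<close> over \<open>M0\<close> is built whose range
  swallows \<open>N'\<close>; its inverse restricts to the embedding.\<close>

lemma universal_extension:
  assumes M0: "M0 \<in> K\<kappa>" "M0 \<preceq>\<^bsub>K\<^esub> B"
  obtains M1 where "M1 \<in> K\<kappa>" "M0 \<preceq>\<^bsub>K\<^esub> M1" "M1 \<preceq>\<^bsub>K\<^esub> B" "universal_over K M1 M0"
proof -
  obtain M where M: "low.continuous_chain M" "M low.z = M0" "\<And>i. i \<in> Field \<kappa> \<Longrightarrow> M i \<preceq>\<^bsub>K\<^esub> B"
    "\<And>i. i \<in> Field \<kappa> \<Longrightarrow> \<forall>b\<in>carrier B. \<exists>c\<in>carrier (M (low.sc i)). conjugate (M i) c b"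
  proof (rule low.model_chain[of M0 "\<lambda>M. M \<preceq>\<^bsub>K\<^esub> B" "\<lambda>i M M'. \<forall>b\<in>carrier B. \<exists>c\<in>carrier M'. conjugate M c b"])
    show "\<exists>M'\<in>K\<kappa>. M \<preceq>\<^bsub>K\<^esub> M' \<and> M' \<preceq>\<^bsub>K\<^esub> B \<and> (\<forall>b\<in>carrier B. \<exists>c\<in>carrier M'. conjugate M c b)"
      if "M \<in> K\<kappa>" "M \<preceq>\<^bsub>K\<^esub> B" for M
      using submodel_realizing_types[OF that] by metis
  qed (use M0 in simp_all)
  note MD = low.continuous_chainD[OF M(1)]
  let ?U = "union_struct (M ` Field \<kappa>)"
  have MU: "M i \<preceq>\<^bsub>K\<^esub> ?U" if "i \<in> Field \<kappa>" for i
    by (rule low.total_union(2)[OF MD(2) that])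
  have UB: "?U \<preceq>\<^bsub>K\<^esub> B" by (rule low.total_union(3)[OF MD(2) M(3)])
  have M0U: "M0 \<preceq>\<^bsub>K\<^esub> ?U" using MU[OF low.z_in] M(2) by simp
  have UK: "?U \<in> K\<kappa>"
  proof (rule models_of_cardI)
    have "|Field \<kappa>| \<le>o \<kappa>" using card_of_Field_ordIso[OF card] ordIso_imp_ordLeq by blast
    then have "|\<Union>i\<in>Field \<kappa>. carrier (M i)| \<le>o \<kappa>" by (rule card_UN) (use MD(1) card_model in blast)
    then show "|carrier ?U| \<le>o \<kappa>" by simp
    show "\<kappa> \<le>o |carrier ?U|"
      using models_of_cardD(4)[OF M0(1)] card_of_mono1[OF leD(4)[OF M0U]] ordLeq_transitive by blast
  qed (rule leD(1)[OF UB])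
  have "\<exists>f. emb f N U \<and> fixes_pointwise f M0" if "U = ?U" and N: "N \<in> models_of_card K |carrier M0|" "M0 \<preceq>\<^bsub>K\<^esub> N" for N U
  proof -
    have NK: "N \<in> K\<kappa>"
      using N(1) models_of_cardD(2)[OF M0(1)] ordIso_transitive unfolding models_of_card_def by blast
    obtain g where g: "emb g N B" "fixes_pointwise g M0" by (rule homogeneous[OF M0 NK N(2)])
    obtain N' where N': "struct_iso (voc K) g N N'" "N' \<preceq>\<^bsub>K\<^esub> B" using g(1) by (rule embE)
    have "|Field \<kappa>| =o |carrier N'|"
      using card_of_Field_ordIso[OF card] models_of_cardD(2)[OF iso_in_K\<kappa>[OF N'(1) NK]]
        ordIso_symmetric ordIso_transitive by blast
    then obtain e where "bij_betw e (Field \<kappa>) (carrier N')" unfolding card_of_ordIso[symmetric] by blast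
    then have e: "e ` Field \<kappa> = carrier N'" by (simp add: bij_betw_def)
    let ?Q = "\<lambda>i f. \<forall>j\<in>low.underS i. e j \<in> f ` carrier (M (low.sc j))"
    have mono: "carrier (M (low.sc j)) \<subseteq> carrier (M i)" if "j \<in> low.underS i" for i j
      by (rule leD(4)[OF MD(2)[OF low.sc_le[OF that]]])
    have e0: "emb id (M low.z) B" using M0(2) M(2) by (simp add: emb_id_iff)
    obtain f where f: "\<And>x. x \<in> carrier (M low.z) \<Longrightarrow> f x = id x" "\<And>i. i \<in> Field \<kappa> \<Longrightarrow> emb f (M i) B \<and> ?Q i f"
    proof (rule low.embedding_chain_into[OF M(1) e0, of ?Q])
      show "?Q low.z id"
        using low.z_least low.le_iff_not_less[OF low.z_in] low.less_in(1) by blast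
      show "\<exists>f'. emb f' (M (low.sc i)) B \<and> (\<forall>x\<in>carrier (M i). f' x = f x) \<and> ?Q (low.sc i) f'"
        if i: "i \<in> Field \<kappa>" and f: "emb f (M i) B" "?Q i f" for i f
      proof -
        obtain \<sigma> where \<sigma>: "aut \<sigma>" "\<And>x. x \<in> carrier (M i) \<Longrightarrow> \<sigma> x = f x"
          using emb_extends_to_aut[OF MD(1)[OF i] M(3)[OF i] f(1)] by blast
        have "e i \<in> carrier B" using e i leD(4)[OF N'(2)] by blast
        then have "inv \<sigma> (e i) \<in> carrier B" using aut_in_B[OF aut_inv[OF \<sigma>(1)]] by blast
        then obtain c where c: "c \<in> carrier (M (low.sc i))" "conjugate (M i) c (inv \<sigma> (e i))"
          using M(4)[OF i] by blast
        then obtain \<rho> where \<rho>: "aut \<rho>" "fixes_pointwise \<rho> (M i)" "\<rho> c = inv \<sigma> (e i)"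
          unfolding conjugate_def by blast
        \<comment> \<open>\<open>\<rho>\<close> does not move \<open>M i\<close> and sends
          \<open>c\<close> to the preimage of \<open>e i\<close> under \<open>\<sigma>\<close>, so
          this map still extends \<open>f\<close> and takes the value \<open>e i\<close> at
          \<open>c\<close>.\<close>
        let ?f = "\<sigma> \<circ> \<rho>"
        have emb: "emb ?f (M (low.sc i)) B"
          by (rule aut_emb_le[OF aut_comp[OF \<sigma>(1) \<rho>(1)] M(3)[OF low.sc_in[OF i]]])
        have agree: "?f x = f x" if "x \<in> carrier (M i)" for x
          using \<sigma>(2)[OF that] \<rho>(2) that by (simp add: fixes_pointwise_def)
        have "e j \<in> ?f ` carrier (M (low.sc j))" if j: "j \<in> low.underS (low.sc i)" for j
        proof (cases "j = i")
          case True
          have "?f c = e i" using \<rho>(3) aut_inv_simps(2)[OF \<sigma>(1)] by simp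
          then show ?thesis using c(1) True by (metis image_eqI)
        next
          case False
          then have ji: "j \<in> low.underS i" using j low.less_sc[OF i] low.le_cases by blast
          then have "e j \<in> f ` carrier (M (low.sc j))" using f(2) by blast
          moreover have "f ` carrier (M (low.sc j)) = ?f ` carrier (M (low.sc j))"
            by (rule image_cong) (use agree mono[OF ji] in auto)
          ultimately show ?thesis by simp
        qed
        then show ?thesis using emb agree by blast
      qed
      show "?Q d f" if d: "limit_elem \<kappa> d" and Q: "\<And>i. i \<in> low.underS d \<Longrightarrow> ?Q i f" for d f
        using Q[OF low.limit_elem_sc[OF d]] low.sc_greater low.less_in(1) by blast
      show "?Q i h" if eq: "\<And>x. x \<in> carrier (M i) \<Longrightarrow> f x = h x" and Q: "?Q i f" for i f h
      proof
        fix j assume j: "j \<in> low.underS i"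
        have "f ` carrier (M (low.sc j)) = h ` carrier (M (low.sc j))"
          by (rule image_cong) (use eq mono[OF j] in auto)
        then show "e j \<in> h ` carrier (M (low.sc j))" using Q j by blast
      qed
    next
      fix f
      assume "\<And>x. x \<in> carrier (M low.z) \<Longrightarrow> f x = id x" "\<And>i. i \<in> Field \<kappa> \<Longrightarrow> emb f (M i) B \<and> ?Q i f"
      then show thesis by (rule that)
    qed
    have fU: "emb f ?U B"
    proof (rule low.total_union(4)[OF MD(2) small])
      show "|carrier ?U| \<le>o \<kappa>" by (rule card_model[OF UK])
      show "emb f (M i) B" if "i \<in> Field \<kappa>" for i using f(2)[OF that] by (rule conjunct1)
    qed
    have "e j \<in> f ` carrier ?U" if j: "j \<in> Field \<kappa>" for j
    proof -
      have "e j \<in> f ` carrier (M (low.sc j))" using f(2)[OF low.sc_in[OF j]] low.sc_greater[OF j] by blast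
      then show ?thesis using leD(4)[OF MU[OF low.sc_in[OF j]]] by blast
    qed
    then have sub: "carrier N' \<subseteq> f ` carrier ?U" unfolding e[symmetric] by (rule image_subsetI)
    have "emb g N N'" using emb_iso[OF N'(1)] model_in_models[OF NK] by blast
    then have "emb (inv_into (carrier ?U) f \<circ> g) N ?U"
      by (rule emb_comp[OF _ emb_inv_into[OF fU N'(2) sub]])
    moreover have "fixes_pointwise (inv_into (carrier ?U) f \<circ> g) M0"
      unfolding fixes_pointwise_def
    proof
      fix x assume x: "x \<in> carrier M0"
      then have "f x = x" "x \<in> carrier ?U" "g x = x"
        using f(1) M(2) leD(4)[OF M0U] g(2) by (auto simp: fixes_pointwise_def)
      then show "(inv_into (carrier ?U) f \<circ> g) x = x" using embD(3)[OF fU] by (metis comp_apply inv_into_f_f)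
    qed
    ultimately show ?thesis using that(1) by blast
  qed
  moreover have "|carrier ?U| =o |carrier M0|"
    using models_of_cardD(2)[OF M0(1)] models_of_cardD(2)[OF UK] ordIso_symmetric ordIso_transitive by blast
  ultimately have "universal_over K ?U M0"
    using M0U unfolding universal_over_def by blast
  then show ?thesis using that UK M0U UB by blast
qed

lemma universal_filtration:
  assumes M0: "M0 \<in> K\<kappa>" "M0 \<preceq>\<^bsub>K\<^esub> B"
  obtains M where "continuous_chain M" "M z = M0" "\<And>i. i \<in> Field (cardSuc \<kappa>) \<Longrightarrow> M i \<preceq>\<^bsub>K\<^esub> B"
    "\<And>i. i \<in> Field (cardSuc \<kappa>) \<Longrightarrow> universal_over K (M (sc i)) (M i)" "B = union_struct (M ` Field (cardSuc \<kappa>))"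
proof (rule filtration[OF M0, of "\<lambda>M N. universal_over K N M"])
  show "\<exists>M'\<in>K\<kappa>. M \<preceq>\<^bsub>K\<^esub> M' \<and> M' \<preceq>\<^bsub>K\<^esub> B \<and> universal_over K M' M" if "M \<in> K\<kappa>" "M \<preceq>\<^bsub>K\<^esub> B" for M
    using universal_extension[OF that] by metis
  show "universal_over K M'' M" if "M \<in> K\<kappa>" "M'' \<in> K\<kappa>" "universal_over K M' M" "M' \<preceq>\<^bsub>K\<^esub> M''" for M M' M''
    using universal_over_mono that by blast
qed (rule that)

text \<open>Such a \<open>d\<close> exists because \<kappa> is the size of an initial segment of
  \<open>\<kappa>\<^sup>+\<close> and has more than \<kappa> subsets. The least one is a limit: a
  successor step at most doubles the number of subsets, and \<kappa> is infinite.\<close>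

lemma exists_first_large_Pow:
  obtains d where "limit_elem (cardSuc \<kappa>) d" "\<not> |Pow (underS d)| \<le>o \<kappa>"
    "\<And>i. i \<in> underS d \<Longrightarrow> |Pow (underS i)| \<le>o \<kappa>"
proof -
  let ?r = "cardSuc \<kappa>"
  let ?D = "{d \<in> Field ?r. \<not> |Pow (underS d)| \<le>o \<kappa>}"
  have wo\<kappa>: "Well_order \<kappa>" using card by (simp add: card_order_on_def)
  obtain d0 where d0: "d0 \<in> Field ?r" "\<kappa> =o Restr ?r (underS d0)"
    using cardSuc_greater[OF card] ordLess_iff_ordIso_Restr[OF WELL wo\<kappa>] by blast
  have "Field (Restr ?r (underS d0)) = underS d0"
    by (rule Refl_Field_Restr2[OF REFL]) (use less_in(1) in blast)
  then have "|Field \<kappa>| =o |underS d0|" using card_of_cong[OF d0(2)] by simp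
  then have eq: "\<kappa> =o |underS d0|"
    using card_of_Field_ordIso[OF card] ordIso_symmetric ordIso_transitive by blast
  have "\<kappa> <o |Pow (underS d0)|" using eq card_of_Pow ordIso_ordLess_trans by blast
  then have "d0 \<in> ?D" using d0(1) not_ordLess_ordLeq by blast
  then have ne: "?D \<noteq> {}" by blast
  define d where "d = minim ?D"
  have sub: "?D \<subseteq> Field ?r" by blast
  have dD: "d \<in> ?D" unfolding d_def by (rule minim_in[OF sub ne])
  have small: "|Pow (underS i)| \<le>o \<kappa>" if "i \<in> underS d" for i
  proof (rule ccontr)
    assume "\<not> |Pow (underS i)| \<le>o \<kappa>"
    then have "i \<in> ?D" using that less_in(1) by blast
    then have "(d, i) \<in> ?r" unfolding d_def by (rule minim_least[OF sub])
    then show False using le_iff_not_less[of d i] dD less_in(1)[OF that] that by blast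
  qed
  have "d \<in> Field ?r" using dD by blast
  then have "limit_elem ?r d"
  proof (cases rule: z_sc_limit_cases)
    case z
    have "underS z = {}"
      using z_least le_iff_not_less[OF z_in] less_in(1) by blast
    then have "|Pow (underS d)| \<le>o \<kappa>" using z card_singleton by simp
    then show ?thesis using dD by blast
  next
    case (sc j)
    have "underS d = insert j (underS j)"
      using less_sc[OF sc(1)] le_cases less_le r_refl[OF sc(1)] unfolding sc(2) by blast
    then have "Pow (underS d) = Pow (underS j) \<union> insert j ` Pow (underS j)" by (simp add: Pow_insert)
    moreover have "|Pow (underS j)| \<le>o \<kappa>" using small sc_greater sc by blast
    ultimately have "|Pow (underS d)| \<le>o \<kappa>" using card_Un card_image by metis
    then show ?thesis using dD by blast
  qed simp
  then show ?thesis using that dD small by blast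
qed

text \<open>
  Otherwise a universal chain of length \<open>d\<close>, where \<open>2^|d| > \<kappa> \<ge> 2^|i|\<close> for \<open>i < d\<close>, carries a binary
  tree of embeddings into \<open>B\<close>: at stage \<open>i\<close> one may or may not twist by an automorphism that
  witnesses splitting over the \<open>i\<close>-th model. Its \<open>2^|d|\<close> branches yield distinct types over a model of
  cardinality \<open>\<kappa>\<close>.
\<close>

lemma exists_nonsplit:
  obtains M0 M1 a where "M0 \<in> K\<kappa>" "M1 \<in> K\<kappa>" "M0 \<preceq>\<^bsub>K\<^esub> B" "M1 \<preceq>\<^bsub>K\<^esub> B" "universal_over K M1 M0"
    "a \<in> carrier B" "a \<notin> carrier M1" "nonsplit a M1 M0"
proof (rule ccontr)
  assume none: "\<not> thesis"
  note witness = that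
  let ?r = "cardSuc \<kappa>"
  have "\<kappa> \<le>o |carrier B|"
    using cardSuc_ordLeq[OF card] models_of_cardD(4)[OF B] ordLeq_transitive by blast
  moreover have "|{} :: 'a set| \<le>o \<kappa>"
    by (rule ordLeq_transitive[OF card_of_empty card_singleton])
  ultimately obtain M0 where M0: "M0 \<preceq>\<^bsub>K\<^esub> B" "M0 \<in> K\<kappa>"
    using LS_submodel_of_card[OF LS_le card B_model empty_subsetI] by blast
  obtain M where M: "continuous_chain M" "\<And>i. i \<in> Field ?r \<Longrightarrow> M i \<preceq>\<^bsub>K\<^esub> B"
    "\<And>i. i \<in> Field ?r \<Longrightarrow> universal_over K (M (sc i)) (M i)"
    using universal_filtration[OF M0(2,1)] by blast
  note MD = continuous_chainD[OF M(1)]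
  have mono: "carrier (M i) \<subseteq> carrier (M j)" if "(i, j) \<in> ?r" for i j
    by (rule leD(4)[OF MD(2)[OF that]])
  obtain d where d: "limit_elem ?r d" "\<not> |Pow (underS d)| \<le>o \<kappa>"
    "\<And>i. i \<in> underS d \<Longrightarrow> |Pow (underS i)| \<le>o \<kappa>"
    using exists_first_large_Pow by blast
  have dF: "d \<in> Field ?r" using d(1) by (simp add: limit_elem_def)
  have dsub: "i \<in> Field ?r" if "i \<in> underS d" for i using less_in(1)[OF that] .
  \<comment> \<open>\<open>M d\<close> has only \<kappa> elements, so one point \<open>a\<close>
    lies outside it and can serve at every stage below \<open>d\<close>.\<close>
  have "\<not> carrier B \<subseteq> carrier (M d)"
  proof
    assume "carrier B \<subseteq> carrier (M d)"
    then have "cardSuc \<kappa> \<le>o \<kappa>"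
      using models_of_cardD(4)[OF B] card_of_mono1 card_model[OF MD(1)[OF dF]] ordLeq_transitive by metis
    then show False using cardSuc_greater[OF card] not_ordLess_ordLeq by blast
  qed
  then obtain a where a: "a \<in> carrier B" "a \<notin> carrier (M d)" by blast
  \<comment> \<open>Failure of the claim makes the type of \<open>a\<close> over
    \<open>M (sc i)\<close> split over \<open>M i\<close>. The twist \<open>\<sigma>\<close> extends
    the splitting map \<open>h\<close>, and no automorphism extending \<open>h\<close> fixes
    \<open>a\<close>.\<close>
  have "\<exists>N h \<sigma>. N \<preceq>\<^bsub>K\<^esub> M (sc i) \<and> h ` carrier N \<subseteq> carrier (M (sc i)) \<and> aut \<sigma> \<and> fixes_pointwise \<sigma> (M i) \<and>
      (\<forall>x\<in>carrier N. \<sigma> x = h x) \<and> (\<forall>\<tau>. aut \<tau> \<longrightarrow> (\<forall>x\<in>carrier N. \<tau> x = h x) \<longrightarrow> \<tau> a \<noteq> a)"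
    if i: "i \<in> underS d" for i
  proof -
    have iF: "i \<in> Field ?r" by (rule dsub[OF i])
    have "a \<notin> carrier (M (sc i))" using mono[OF sc_le[OF i]] a(2) by blast
    then have "\<not> nonsplit a (M (sc i)) (M i)"
      using none witness MD(1)[OF iF] MD(1)[OF sc_in[OF iF]] M(2)[OF iF] M(2)[OF sc_in[OF iF]] M(3)[OF iF] a(1) by blast
    then obtain N h where N: "N \<in> K\<kappa>" "M i \<preceq>\<^bsub>K\<^esub> N" "N \<preceq>\<^bsub>K\<^esub> M (sc i)" "emb h N (M (sc i))" "fixes_pointwise h (M i)"
      and no: "\<And>\<tau>. aut \<tau> \<Longrightarrow> \<forall>x\<in>carrier N. \<tau> x = h x \<Longrightarrow> \<tau> a \<noteq> a"
      unfolding nonsplit_def by blast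
    obtain \<sigma> where \<sigma>: "aut \<sigma>" "\<And>x. x \<in> carrier N \<Longrightarrow> \<sigma> x = h x"
      using emb_extends_to_aut[OF N(1) le_trans[OF N(3) M(2)[OF sc_in[OF iF]]] emb_le[OF N(4) M(2)[OF sc_in[OF iF]]]]
      by blast
    have "fixes_pointwise \<sigma> (M i)" using \<sigma>(2) N(5) leD(4)[OF N(2)] by (auto simp: fixes_pointwise_def)
    then show ?thesis using N(3) embD(4)[OF N(4)] \<sigma> no by blast
  qed
  then obtain N h \<sigma> where Nh: "\<And>i. i \<in> underS d \<Longrightarrow> N i \<preceq>\<^bsub>K\<^esub> M (sc i) \<and> h i ` carrier (N i) \<subseteq> carrier (M (sc i)) \<and>
      aut (\<sigma> i) \<and> fixes_pointwise (\<sigma> i) (M i) \<and> (\<forall>x\<in>carrier (N i). \<sigma> i x = h i x) \<and>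
      (\<forall>\<tau>. aut \<tau> \<longrightarrow> (\<forall>x\<in>carrier (N i). \<tau> x = h i x) \<longrightarrow> \<tau> a \<noteq> a)"
    by metis
  define s where "s A i = (if i \<in> A then \<sigma> i else id)" for A i
  \<comment> \<open>Fixing one extension for each restriction of \<open>f\<close> to
    \<open>M i\<close> makes branches coincide as long as they have taken the same turns.\<close>
  define ext where "ext i f = (SOME \<tau>. aut \<tau> \<and> (\<forall>x\<in>carrier (M i). \<tau> x = f x))" for i f
  have ext: "aut (ext i f) \<and> (\<forall>x\<in>carrier (M i). ext i f x = f x)" if i: "i \<in> Field ?r" and f: "emb f (M i) B" for i f
    unfolding ext_def
  proof (rule someI_ex[where P = "\<lambda>\<tau>. aut \<tau> \<and> (\<forall>x\<in>carrier (M i). \<tau> x = f x)"])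
    obtain \<tau> where "aut \<tau>" "\<And>x. x \<in> carrier (M i) \<Longrightarrow> \<tau> x = f x"
      using emb_extends_to_aut[OF MD(1)[OF i] M(2)[OF i] f] by blast
    then show "\<exists>\<tau>. aut \<tau> \<and> (\<forall>x\<in>carrier (M i). \<tau> x = f x)" by blast
  qed
  have ext_cong: "ext i f = ext i g" if "\<And>x. x \<in> carrier (M i) \<Longrightarrow> f x = g x" for i f g
  proof -
    have "(\<lambda>\<tau>. aut \<tau> \<and> (\<forall>x\<in>carrier (M i). \<tau> x = f x)) = (\<lambda>\<tau>. aut \<tau> \<and> (\<forall>x\<in>carrier (M i). \<tau> x = g x))"
      using that by auto
    then show ?thesis unfolding ext_def by simp
  qed
  have s: "aut (s A i)" "fixes_pointwise (s A i) (M i)" if "A \<subseteq> underS d" for A i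
    using Nh[of i] that aut_id by (auto simp: s_def fixes_pointwise_def)
  \<comment> \<open>The set \<open>A\<close> records the stages at which the twist is applied.
    Twists fix \<open>M i\<close>, so each stage extends the preceding one.\<close>
  define branch where "branch A f \<longleftrightarrow> (\<forall>x\<in>carrier (M z). f x = x) \<and> (\<forall>i\<in>Field ?r. emb f (M i) B) \<and>
    (\<forall>i\<in>Field ?r. \<forall>x\<in>carrier (M (sc i)). f x = ext i f (s A i x))" for A f
  have "\<exists>f. branch A f" if A: "A \<subseteq> underS d" for A
  proof -
    let ?Q = "\<lambda>i f. \<forall>j\<in>underS i. \<forall>x\<in>carrier (M (sc j)). f x = ext j f (s A j x)"
    have Qcong: "?Q i g" if eq: "\<And>x. x \<in> carrier (M i) \<Longrightarrow> f x = g x" and Q: "?Q i f" for i f g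
    proof (intro ballI)
      fix j x assume j: "j \<in> underS i" and x: "x \<in> carrier (M (sc j))"
      have "ext j f = ext j g" by (rule ext_cong) (use eq mono[OF less_le[OF j]] in auto)
      then show "g x = ext j g (s A j x)" using eq[of x] Q j x mono[OF sc_le[OF j]] by auto
    qed
    have e0: "emb id (M z) B" using M(2)[OF z_in] by (simp add: emb_id_iff)
    obtain f where f: "\<And>x. x \<in> carrier (M z) \<Longrightarrow> f x = id x" "\<And>i. i \<in> Field ?r \<Longrightarrow> emb f (M i) B \<and> ?Q i f"
    proof (rule embedding_chain_into[OF M(1) e0, of ?Q])
      show "?Q z id" using z_least le_iff_not_less[OF z_in] less_in(1) by blast
      show "\<exists>f'. emb f' (M (sc i)) B \<and> (\<forall>x\<in>carrier (M i). f' x = f x) \<and> ?Q (sc i) f'"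
        if i: "i \<in> Field ?r" and f: "emb f (M i) B" "?Q i f" for i f
      proof -
        let ?f = "ext i f \<circ> s A i"
        have emb: "emb ?f (M (sc i)) B"
          using aut_emb_le aut_comp ext[OF i f(1)] s(1)[OF A] M(2)[OF sc_in[OF i]] by blast
        have agree: "?f x = f x" if "x \<in> carrier (M i)" for x
          using ext[OF i f(1)] s(2)[OF A, of i] that by (simp add: fixes_pointwise_def)
        have "?Q i ?f" using Qcong[of i f ?f] agree f(2) by simp
        moreover have "?f x = ext i ?f (s A i x)" if "x \<in> carrier (M (sc i))" for x
          using ext_cong[of i f ?f] agree by simp
        ultimately have "?Q (sc i) ?f" using less_sc[OF i] le_cases by blast
        then show ?thesis using emb agree by blast
      qed
      show "?Q e f" if e: "limit_elem ?r e" and Q: "\<And>i. i \<in> underS e \<Longrightarrow> ?Q i f" for e f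
        using Q[OF limit_elem_sc[OF e]] sc_greater less_in(1) by blast
      show "?Q i g" if "\<And>x. x \<in> carrier (M i) \<Longrightarrow> f x = g x" "?Q i f" for i f g
        by (rule Qcong[OF that])
    next
      fix f
      assume "\<And>x. x \<in> carrier (M z) \<Longrightarrow> f x = id x" "\<And>i. i \<in> Field ?r \<Longrightarrow> emb f (M i) B \<and> ?Q i f"
      then show thesis by (rule that)
    qed
    have "\<forall>x\<in>carrier (M (sc i)). f x = ext i f (s A i x)" if "i \<in> Field ?r" for i
      using conjunct2[OF f(2)[OF sc_in[OF that]]] sc_greater[OF that] by blast
    then show ?thesis using f unfolding branch_def by (intro exI[of _ f]) simp
  qed
  then obtain F where "\<And>A. A \<subseteq> underS d \<Longrightarrow> branch A (F A)" by metis
  then have F: "\<And>A x. A \<subseteq> underS d \<Longrightarrow> x \<in> carrier (M z) \<Longrightarrow> F A x = x"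
    "\<And>A i. A \<subseteq> underS d \<Longrightarrow> i \<in> Field ?r \<Longrightarrow> emb (F A) (M i) B"
    "\<And>A i x. A \<subseteq> underS d \<Longrightarrow> i \<in> Field ?r \<Longrightarrow> x \<in> carrier (M (sc i)) \<Longrightarrow> F A x = ext i (F A) (s A i x)"
    unfolding branch_def by blast+
  have F_cong: "\<forall>x\<in>carrier (M i). F A x = F A' x"
    if "i \<in> Field ?r" and A: "A \<subseteq> underS d" "A' \<subseteq> underS d" and "A \<inter> underS i = A' \<inter> underS i" for i A A'
    using that(1,4)
  proof (induction i rule: less_induct)
    case (less i)
    have IH: "\<forall>x\<in>carrier (M j). F A x = F A' x" if "j \<in> underS i" for j
    proof (rule less.IH[OF that])
      have "underS j \<subseteq> underS i" using that less_le_trans less_le by blast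
      then show "A \<inter> underS j = A' \<inter> underS j" using less.prems by blast
    qed
    from less.hyps show ?case
    proof (cases rule: z_sc_limit_cases)
      case z
      then show ?thesis using F(1) A by simp
    next
      case (sc j)
      then have j: "j \<in> underS i" using sc_greater by blast
      have "ext j (F A) = ext j (F A')" by (rule ext_cong) (use IH[OF j] in blast)
      moreover have "s A j = s A' j" using less.prems j by (auto simp: s_def)
      ultimately show ?thesis using F(3)[OF _ sc(1)] A sc(2) by simp
    next
      case limit
      then show ?thesis using MD(4)[OF limit] IH by blast
    qed
  qed
  have "\<exists>\<tau>. aut \<tau> \<and> (\<forall>x\<in>carrier (M d). \<tau> x = F A x)" if "A \<subseteq> underS d" for A
    using emb_extends_to_aut[OF MD(1)[OF dF] M(2)[OF dF] F(2)[OF that dF]] by metis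
  then obtain T where T: "\<And>A. A \<subseteq> underS d \<Longrightarrow> aut (T A)"
    "\<And>A x. A \<subseteq> underS d \<Longrightarrow> x \<in> carrier (M d) \<Longrightarrow> T A x = F A x"
    by metis
  \<comment> \<open>By \<open>F_cong\<close> only the at most \<kappa> subsets of
    \<open>underS i\<close> matter at a stage \<open>i\<close> below \<open>d\<close>. Minimality of
    \<open>d\<close> thus bounds all points of the tree below \<open>d\<close> by \<kappa>, and a
    single model \<open>P\<close> contains them.\<close>
  let ?S = "\<Union>i\<in>underS d. \<Union>A\<in>Pow (underS i). F A ` carrier (M i)"
  have under_d: "underS i \<subseteq> underS d" if "i \<in> underS d" for i using that less_le_trans less_le by blast
  have "?S \<subseteq> carrier B"
  proof (intro UN_least)
    fix i A assume i: "i \<in> underS d" and "A \<in> Pow (underS i)"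
    then have "A \<subseteq> underS d" using under_d[OF i] by blast
    then show "F A ` carrier (M i) \<subseteq> carrier B" by (rule embD(4)[OF F(2)[OF _ dsub[OF i]]])
  qed
  moreover have "|?S| \<le>o \<kappa>"
  proof (intro card_UN[OF card_underS[OF dF]] card_UN[OF d(3)])
    fix i A assume "i \<in> underS d"
    then show "|F A ` carrier (M i)| \<le>o \<kappa>" by (intro card_image card_model MD(1) dsub)
  qed
  ultimately obtain P where P: "P \<in> K\<kappa>" "M0 \<preceq>\<^bsub>K\<^esub> P" "P \<preceq>\<^bsub>K\<^esub> B" "?S \<subseteq> carrier P"
    by (rule submodel_containing[OF M0(2,1)])
  have in_P: "F A x \<in> carrier P" if A: "A \<subseteq> underS d" and i: "i \<in> underS d" and x: "x \<in> carrier (M i)" for A i x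
  proof -
    have eq: "F A x = F (A \<inter> underS i) x"
      using F_cong[OF dsub[OF i] A, of "A \<inter> underS i"] A x by blast
    have "F (A \<inter> underS i) x \<in> ?S"
      by (rule UN_I[OF i], rule UN_I[of "A \<inter> underS i"], simp, rule imageI[OF x])
    then show ?thesis unfolding eq by (rule subsetD[OF P(4)])
  qed
  have distinct: "\<not> conjugate P (T A a) (T A' a)"
    if A: "A \<subseteq> underS d" "A' \<subseteq> underS d" and i: "i \<in> underS d" "i \<notin> A" "i \<in> A'" "A \<inter> underS i = A' \<inter> underS i"
    for A A' i
  proof
    assume "conjugate P (T A a) (T A' a)"
    then obtain \<rho> where \<rho>: "aut \<rho>" "\<And>y. y \<in> carrier P \<Longrightarrow> \<rho> y = y" "\<rho> (T A a) = T A' a"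
      unfolding conjugate_def fixes_pointwise_def by blast
    note N = Nh[OF i(1)]
    have iF: "i \<in> Field ?r" by (rule dsub[OF i(1)])
    have scd: "sc i \<in> underS d" by (rule limit_elem_sc[OF d(1) i(1)])
    have ext_eq: "ext i (F A) = ext i (F A')"
      by (rule ext_cong) (use F_cong[OF iF A i(4)] in blast)
    \<comment> \<open>Here \<open>i\<close> is a stage where the branches part after equal
      histories. If the two images of \<open>a\<close> had the same type over \<open>P\<close>, this
      automorphism would fix \<open>a\<close> and yet act on \<open>N i\<close> as the splitting map
      \<open>h i\<close>.\<close>
    let ?\<theta> = "inv (T A) \<circ> (inv \<rho> \<circ> T A')"
    have "aut ?\<theta>" by (intro aut_comp aut_inv T(1) A \<rho>(1))
    moreover have "?\<theta> x = h i x" if x: "x \<in> carrier (N i)" for x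
    proof -
      have xM: "x \<in> carrier (M (sc i))" using subsetD[OF leD(4)[OF conjunct1[OF N]] x] .
      have hM: "h i x \<in> carrier (M (sc i))" using subsetD[OF conjunct1[OF conjunct2[OF N]] imageI[OF x]] .
      have sub: "carrier (M (sc i)) \<subseteq> carrier (M d)" by (rule mono[OF less_le[OF scd]])
      have "T A' x = F A' x" using T(2)[OF A(2)] xM sub by blast
      also have "\<dots> = ext i (F A') (\<sigma> i x)" using F(3)[OF A(2) iF xM] i(3) by (simp add: s_def)
      also have "\<dots> = ext i (F A) (h i x)" using ext_eq N x by simp
      also have "\<dots> = F A (h i x)" using F(3)[OF A(1) iF hM] i(2) by (simp add: s_def)
      finally have eq: "T A' x = F A (h i x)" .
      have "F A (h i x) \<in> carrier P" by (rule in_P[OF A(1) scd hM])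
      then have "inv \<rho> (F A (h i x)) = F A (h i x)" 
        using \<rho>(2)[of "F A (h i x)"] aut_inv_simps(1)[OF \<rho>(1), of "F A (h i x)"] by simp
      moreover have "F A (h i x) = T A (h i x)" using T(2)[OF A(1)] hM sub by auto
      ultimately show ?thesis using eq aut_inv_simps(1)[OF T(1)[OF A(1)]] by simp
    qed
    moreover have "?\<theta> a = a"
      using \<rho>(3)[symmetric] aut_inv_simps(1)[OF \<rho>(1)] aut_inv_simps(1)[OF T(1)[OF A(1)]] by simp
    ultimately show False using N by blast
  qed
  have inj: "inj_on (\<lambda>A. gtp K (T A a) P B) (Pow (underS d))"
  proof (rule inj_onI, rule ccontr)
    fix A A' assume "A \<in> Pow (underS d)" "A' \<in> Pow (underS d)" and eq: "gtp K (T A a) P B = gtp K (T A' a) P B"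
      and ne: "A \<noteq> A'"
    then have A: "A \<subseteq> underS d" "A' \<subseteq> underS d" by auto
    have "T A a \<in> carrier B" "T A' a \<in> carrier B" using aut_in_B T(1) A a(1) by blast+
    then have conj: "conjugate P (T A a) (T A' a)" using eq gtp_eq_iff_conjugate[OF P(1,3)] by blast
    let ?E = "(A - A') \<union> (A' - A)"
    have E: "?E \<subseteq> Field ?r" "?E \<noteq> {}" using A dsub ne by blast+
    let ?i = "minim ?E"
    have i: "?i \<in> ?E" by (rule minim_in[OF E])
    have "j \<notin> ?E" if "j \<in> underS ?i" for j
      using minim_least[OF E(1), of j] le_iff_not_less[of ?i j] less_in[OF that] that by blast
    then have agree: "A \<inter> underS ?i = A' \<inter> underS ?i" by blast
    show False
    proof (cases "?i \<in> A'")
      case True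
      then show ?thesis using distinct[OF A, of ?i] i agree A conj by blast
    next
      case False
      then show ?thesis using distinct[OF A(2,1), of ?i] i agree A conjugate_sym[OF conj] by blast
    qed
  qed
  have "(\<lambda>A. gtp K (T A a) P B) ` Pow (underS d) \<subseteq> gS K P"
    using P(3) aut_in_B[OF T(1)] a(1) by (auto simp: gS_def)
  with inj have "|Pow (underS d)| \<le>o |gS K P|" unfolding card_of_ordLeq[symmetric] by blast
  moreover have "|gS K P| \<le>o \<kappa>" using stable P(1) by (simp add: stable_in_def)
  ultimately show False using d(2) ordLeq_transitive by blast
qed

section \<open>Continuity of splitting and the omitted point\<close>

lemma nonsplit_continuous:
  assumes cont: "splitting_continuous_in K \<kappa>"
    and M: "continuous_chain M" "\<And>i. i \<in> Field (cardSuc \<kappa>) \<Longrightarrow> M i \<preceq>\<^bsub>K\<^esub> B"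
      "\<And>i. i \<in> Field (cardSuc \<kappa>) \<Longrightarrow> universal_over K (M (sc i)) (M i)"
    and d: "limit_elem (cardSuc \<kappa>) d" and a: "a \<in> carrier B" "a \<notin> carrier (M d)"
    and ns: "\<And>i. i \<in> underS d \<Longrightarrow> nonsplit a (M i) (M z)"
  shows "nonsplit a (M d) (M z)"
proof -
  note MD = continuous_chainD[OF M(1)]
  have dF: "d \<in> Field (cardSuc \<kappa>)" using d by (simp add: limit_elem_def)
  let ?p = "gtp K a (M d) B"
  have "cont_chain K \<kappa> (cardSuc \<kappa>) d M"
    unfolding cont_chain_def using MD(1-3) le_in(1) by (auto simp: under_def)
  moreover have "\<forall>i\<in>underS d. universal_over K (M (sc i)) (M i)" using M(3) less_in(1) by blast
  moreover have "?p \<in> gS_na K (M d)" using M(2)[OF dF] a unfolding gS_na_def by blast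
  moreover have "\<not> splits_over K \<kappa> (restrict_type K ?p (M i)) (M i) (M z)" if i: "i \<in> underS d" for i
    using restrict_gtp[OF MD(2)[OF less_le[OF i]] M(2)[OF dF] a(1)]
      not_splits_over_iff_nonsplit[OF M(2)[OF less_in(1)[OF i]] a(1)] ns[OF i] by simp
  ultimately have "\<not> splits_over K \<kappa> ?p (M d) (M z)"
    using cont d unfolding splitting_continuous_in_def Let_def by blast
  then show ?thesis using not_splits_over_iff_nonsplit[OF M(2)[OF dF] a(1)] by blast
qed

lemma not_splitting_continuous: "\<not> splitting_continuous_in K \<kappa>"
proof
  assume cont: "splitting_continuous_in K \<kappa>"
  let ?r = "cardSuc \<kappa>"
  obtain M0 M1 a where M0: "M0 \<in> K\<kappa>" "M1 \<in> K\<kappa>" "M0 \<preceq>\<^bsub>K\<^esub> B" "M1 \<preceq>\<^bsub>K\<^esub> B" "universal_over K M1 M0"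
    and a: "a \<in> carrier B" "a \<notin> carrier M1" "nonsplit a M1 M0"
    by (rule exists_nonsplit)
  obtain M where M: "continuous_chain M" "M z = M0" "\<And>i. i \<in> Field ?r \<Longrightarrow> M i \<preceq>\<^bsub>K\<^esub> B"
    "\<And>i. i \<in> Field ?r \<Longrightarrow> universal_over K (M (sc i)) (M i)" "B = union_struct (M ` Field ?r)"
    using universal_filtration[OF M0(1,3)] by blast
  note MD = continuous_chainD[OF M(1)]
  have scz: "sc z \<in> Field ?r" by (rule sc_in[OF z_in])
  have M0i: "M0 \<preceq>\<^bsub>K\<^esub> M i" if "i \<in> Field ?r" for i using MD(2)[OF z_least[OF that]] M(2) by simp
  \<comment> \<open>The filtration starts at \<open>M0\<close> but need not pass through
    \<open>M1\<close>, so the type of \<open>a\<close> is first moved to the second model of the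
    filtration.\<close>
  obtain b where b: "b \<in> carrier B" "b \<notin> carrier (M (sc z))" "nonsplit b (M (sc z)) M0"
    by (rule nonsplit_extension[OF M0(5,1,2,4) a MD(1)[OF scz] M0i[OF scz] M(3)[OF scz]])
  \<comment> \<open>Since \<open>\<tau>\<close> extends \<open>f\<close> and \<open>c\<close> is
    outside \<open>M i\<close>, the point \<open>b\<close> is missed by \<open>f\<close> on
    \<open>M i\<close>. The clause for \<open>z\<close> lets the first step be the identity: the
    extension argument needs \<open>M i\<close> universal over \<open>M0\<close>, which is available
    only after \<open>z\<close>.\<close>
  let ?Q = "\<lambda>i f. (\<exists>\<tau> c. aut \<tau> \<and> (\<forall>x\<in>carrier (M i). \<tau> x = f x) \<and> \<tau> c = b \<and> c \<in> carrier B \<and> c \<notin> carrier (M i) \<and>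
    nonsplit c (M i) M0) \<and> (i = z \<longrightarrow> (\<forall>x\<in>carrier (M i). f x = x))"
  have e0: "emb id (M z) B" using M(3)[OF z_in] by (simp add: emb_id_iff)
  have z_sc: "M z \<preceq>\<^bsub>K\<^esub> M (sc z)" by (rule MD(2)[OF z_least[OF scz]])
  obtain f where f: "\<And>i. i \<in> Field ?r \<Longrightarrow> emb f (M i) B \<and> ?Q i f"
  proof (rule embedding_chain_into[OF M(1) e0, of ?Q])
    have "b \<notin> carrier (M z)" using b(2) leD(4)[OF z_sc] by blast
    then show "?Q z id"
      using aut_id b(1) nonsplit_restrict[OF b(3) z_sc] by (intro conjI exI[of _ id] exI[of _ b]) auto
    show "\<exists>f'. emb f' (M (sc i)) B \<and> (\<forall>x\<in>carrier (M i). f' x = f x) \<and> ?Q (sc i) f'"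
      if i: "i \<in> Field ?r" and f: "emb f (M i) B" "?Q i f" for i f
    proof (cases "i = z")
      case True
      have "emb id (M (sc z)) B" using M(3)[OF scz] by (simp add: emb_id_iff)
      moreover have "?Q (sc z) id"
        using aut_id b sc_not_z[OF z_in] by (intro conjI exI[of _ id] exI[of _ b]) auto
      moreover have "\<forall>x\<in>carrier (M i). id x = f x" using f(2) True by simp
      ultimately show ?thesis using True by blast
    next
      case False
      obtain \<tau> c where \<tau>: "aut \<tau>" "\<And>x. x \<in> carrier (M i) \<Longrightarrow> \<tau> x = f x" "\<tau> c = b" "c \<in> carrier B"
        "c \<notin> carrier (M i)" "nonsplit c (M i) M0"
        using f(2) by blast
      have "z \<in> underS i" using False z_least[OF i] le_cases by metis
      then have "universal_over K (M i) M0"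
        using universal_over_mono[OF M(4)[OF z_in] MD(2)[OF sc_le] _ MD(1)[OF i]] M(2) M0(1) by simp
      moreover have isc: "M i \<preceq>\<^bsub>K\<^esub> M (sc i)" by (rule MD(2)[OF less_le[OF sc_greater[OF i]]])
      ultimately obtain c' where c': "c' \<in> carrier B" "c' \<notin> carrier (M (sc i))" "nonsplit c' (M (sc i)) M0"
        "conjugate (M i) c' c"
        using nonsplit_extension[OF _ M0(1) MD(1)[OF i] M(3)[OF i] \<tau>(4-6) MD(1)[OF sc_in[OF i]]
            M0i[OF sc_in[OF i]] M(3)[OF sc_in[OF i]]] by metis
      then obtain \<rho> where \<rho>: "aut \<rho>" "fixes_pointwise \<rho> (M i)" "\<rho> c' = c" unfolding conjugate_def by blast
      have aut: "aut (\<tau> \<circ> \<rho>)" by (rule aut_comp[OF \<tau>(1) \<rho>(1)])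
      have "emb (\<tau> \<circ> \<rho>) (M (sc i)) B" by (rule aut_emb_le[OF aut M(3)[OF sc_in[OF i]]])
      moreover have "\<forall>x\<in>carrier (M i). (\<tau> \<circ> \<rho>) x = f x" using \<tau>(2) \<rho>(2) by (simp add: fixes_pointwise_def)
      moreover have "?Q (sc i) (\<tau> \<circ> \<rho>)"
      proof
        show "\<exists>\<tau>' c. aut \<tau>' \<and> (\<forall>x\<in>carrier (M (sc i)). \<tau>' x = (\<tau> \<circ> \<rho>) x) \<and> \<tau>' c = b \<and> c \<in> carrier B \<and>
            c \<notin> carrier (M (sc i)) \<and> nonsplit c (M (sc i)) M0"
          using aut c' \<rho>(3) \<tau>(3) by (intro exI[of _ "\<tau> \<circ> \<rho>"] exI[of _ c']) simp
      qed (use sc_not_z[OF i] in blast)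
      ultimately show ?thesis by blast
    qed
    show "?Q d f" if d: "limit_elem ?r d" and f: "emb f (M d) B" and Q: "\<And>i. i \<in> underS d \<Longrightarrow> ?Q i f" for d f
    proof -
      have dF: "d \<in> Field ?r" using d by (simp add: limit_elem_def)
      obtain \<sigma> where \<sigma>: "aut \<sigma>" "\<And>x. x \<in> carrier (M d) \<Longrightarrow> \<sigma> x = f x"
        using emb_extends_to_aut[OF MD(1)[OF dF] M(3)[OF dF] f] by blast
      \<comment> \<open>The earlier \<open>\<tau>\<close> and \<open>c\<close> need not converge. A
        fresh automorphism extends \<open>f\<close> on \<open>M d\<close>, and the candidate is the
        point it sends to \<open>b\<close>.\<close>
      let ?c = "inv \<sigma> b"
      have cB: "?c \<in> carrier B" using aut_in_B[OF aut_inv[OF \<sigma>(1)]] b(1) by blast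
      have *: "?c \<notin> carrier (M i) \<and> nonsplit ?c (M i) M0" if i: "i \<in> underS d" for i
      proof -
        obtain \<tau> c where \<tau>: "aut \<tau>" "\<And>x. x \<in> carrier (M i) \<Longrightarrow> \<tau> x = f x" "\<tau> c = b" "c \<notin> carrier (M i)"
          "nonsplit c (M i) M0"
          using Q[OF i] by blast
        have eq: "\<tau> x = \<sigma> x" if "x \<in> carrier (M i)" for x
          using \<tau>(2)[OF that] \<sigma>(2) leD(4)[OF MD(2)[OF less_le[OF i]]] that by auto
        have "fixes_pointwise (inv \<sigma> \<circ> \<tau>) (M i)"
          unfolding fixes_pointwise_def using eq aut_inv_simps(1)[OF \<sigma>(1)] by simp
        moreover have "aut (inv \<sigma> \<circ> \<tau>)" using aut_comp aut_inv \<sigma>(1) \<tau>(1) by blast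
        \<comment> \<open>Over each earlier model the candidate has the type found there, because
          \<open>\<sigma>\<close> and \<open>\<tau>\<close> agree on \<open>M i\<close> and both
          reach \<open>b\<close>.\<close>
        ultimately have "conjugate (M i) c ?c" using \<tau>(3) unfolding conjugate_def by auto
        then have "nonsplit ?c (M i) M0" by (rule nonsplit_conjugate[OF \<tau>(5)])
        moreover have "?c \<notin> carrier (M i)"
        proof
          assume c: "?c \<in> carrier (M i)"
          then have "\<tau> ?c = \<tau> c" using eq aut_inv_simps(2)[OF \<sigma>(1)] \<tau>(3) by simp
          then have "?c = c" using aut_inv_simps(1)[OF \<tau>(1)] by metis
          then show False using c \<tau>(4) by simp
        qed
        ultimately show ?thesis by blast
      qed
      have cd: "?c \<notin> carrier (M d)" using * MD(4)[OF d] by blast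
      have "nonsplit ?c (M d) (M z)"
        by (rule nonsplit_continuous[OF cont M(1,3,4) d cB cd]) (use * M(2) in simp_all)
      then show ?thesis
        using \<sigma> cB cd aut_inv_simps(2)[OF \<sigma>(1)] M(2) d z_not_limit
        by (intro conjI exI[of _ \<sigma>] exI[of _ ?c]) auto
    qed
    show "?Q i g" if eq: "\<And>x. x \<in> carrier (M i) \<Longrightarrow> f x = g x" and "?Q i f" for i f g
    proof -
      have *: "(\<forall>x\<in>carrier (M i). \<tau> x = g x) \<longleftrightarrow> (\<forall>x\<in>carrier (M i). \<tau> x = f x)" for \<tau> using eq by auto
      have "(\<forall>x\<in>carrier (M i). g x = x) \<longleftrightarrow> (\<forall>x\<in>carrier (M i). f x = x)" using eq by auto
      then show ?thesis using that(2) unfolding * by blast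
    qed
  next
    fix f
    assume "\<And>x. x \<in> carrier (M z) \<Longrightarrow> f x = id x" "\<And>i. i \<in> Field ?r \<Longrightarrow> emb f (M i) B \<and> ?Q i f"
    then show thesis by (intro that)
  qed
  have "emb f (union_struct (M ` Field ?r)) B"
  proof (rule total_union(4)[OF MD(2)])
    show "|carrier (union_struct (M ` Field ?r))| <o |UNIV :: 'a set|" using small_B M(5) by simp
    show "emb f (M i) B" if "i \<in> Field ?r" for i using f[OF that] by (rule conjunct1)
  qed
  then have "emb f B B" using M(5) by simp
  then have "b \<in> f ` carrier B" using emb_B_onto b(1) by blast
  then obtain x i where x: "b = f x" "i \<in> Field ?r" "x \<in> carrier (M i)"
    using arg_cong[OF M(5), of carrier] by auto
  obtain \<tau> c where \<tau>: "aut \<tau>" "\<And>x. x \<in> carrier (M i) \<Longrightarrow> \<tau> x = f x" "\<tau> c = b" "c \<notin> carrier (M i)"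
    using conjunct2[OF f[OF x(2)]] by blast
  have "\<tau> c = \<tau> x" using x(1) \<tau>(2)[OF x(3)] \<tau>(3) by simp
  then have "c = x" using aut_inv_simps(1)[OF \<tau>(1)] by metis
  then show False using \<tau>(4) x(3) by simp
qed

end

section \<open>Existence of a model\<close>

text \<open>Two hypotheses belong to the encoding: \<open>universe\<close> gives the fixed type room
  for the model sought, and \<open>nonempty\<close> excludes the case in which the conditions on
  models of size \<open>lam\<close> hold vacuously.\<close>

theorem theorem3p6:
  fixes K :: "('a, 'f, 'r) aclass" and lam :: "'b rel"
  assumes "AEC K"
    and "Card_order lam" and "LS K \<le>o lam"
    and universe: "cardSuc (cardSuc lam) \<le>o |UNIV :: 'a set|"
    and nonempty: "models_of_card K lam \<noteq> {}"
    and "amalgamation_in K lam"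
    and "no_maximal_model_in K lam"
    and "stable_in K lam"
    and "splitting_continuous_in K lam"
  shows "\<exists>M\<in>models K. |carrier M| =o cardSuc (cardSuc lam)"
proof -
  have card_Suc: "Card_order (cardSuc lam)" by (rule cardSuc_Card_order[OF assms(2)])
  have lam_UNIV: "cardSuc lam \<le>o |UNIV :: 'a set|"
    using cardSuc_ordLeq[OF card_Suc] universe ordLeq_transitive by blast
  interpret aec_card K lam
    by unfold_locales (use assms(1-3) lam_UNIV in auto)
  interpret plus: aec_card K "cardSuc lam"
  proof unfold_locales
    show "LS K \<le>o cardSuc lam" using assms(3) cardSuc_ordLeq[OF assms(2)] ordLeq_transitive by blast
  qed (rule card_Suc, rule assms(4))
  \<comment> \<open>Once this is known, the chain argument leading from \<open>lam\<close> to its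
    successor is repeated one cardinal higher.\<close>
  have "no_maximal_model_in K (cardSuc lam)"
  proof (rule ccontr)
    assume "\<not> no_maximal_model_in K (cardSuc lam)"
    then obtain B where "B \<in> models_of_card K (cardSuc lam)"
      "\<And>N. N \<in> models_of_card K (cardSuc lam) \<Longrightarrow> B \<preceq>\<^bsub>K\<^esub> N \<Longrightarrow> N = B"
      unfolding no_maximal_model_in_def by blast
    then interpret stable_maximal_model K lam B
      by unfold_locales (use assms(4,6,8) in auto)
    show False using not_splitting_continuous assms(9) by blast
  qed
  moreover have "models_of_card K (cardSuc lam) \<noteq> {}"
    using model_of_cardSuc[OF nonempty assms(7)] by (auto simp: models_of_card_def)
  ultimately show ?thesis by (intro plus.model_of_cardSuc)
qed

end
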